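(* Let $L>0$, $V\in C^1([0,L];\mathbb{R})$ and, for $\varepsilon\in(0,1]$, $V_\varepsilon\in C^1([0,L];\mathbb{R})$ with $\|V-V_\varepsilon\|_{C^1([0,L])}\to0$ as $\varepsilon\to0^+$. Assume the only point $x\in[0,L]$ with $V'(x)=0$ is $\mathbf{x}_0\in(0,L)$, and $V(\mathbf{x}_0)=\min_{[0,L]}V=:E_0$. Let $\varepsilon_n\to0^+$, $E_n\in\mathbb{R}$ with $E_n\to E_*\in\mathbb{R}\cup\{+\infty\}$, and $\psi_n$ satisfy $$-\varepsilon_n^2\psi_n''+V_{\varepsilon_n}\psi_n-E_n\psi_n=r_n,\qquad \psi_n\in H^2(0,L)\cap H^1_0(0,L),\qquad\|\psi_n\|_{L^2(0,L)}=1,$$ with $\|r_n\|_{L^2(0,L)}=o(\varepsilon_n)$. Then $|\psi_n(x)|^2dx\rightharpoonup\mathfrak{m}_{E_*}$ weakly-$*$ as measures on $[0,L]$, where \begin{itemize} \item if $E_0<E_*<+\infty$: $\mathfrak{m}_{E_*}=C_{E_*}\dfrac{\mathbf{1}_{(x_-(E_* ),x_+(E_* ))}(x)\,dx}{\sqrt{(E_*-V(x))_+}}$ with $C_{E_*}=\Big(\int_{x_-(E_* )}^{x_+(E_* )}\frac{dx}{\sqrt{E_*-V(x)}}\Big)^{-1}$; \item if $E_*=E_0$: $\mathfrak{m}_{E_*}=\delta_{\mathbf{x}_0}$; \item if $E_*=+\infty$: $\mathfrak{m}_{E_*}=\frac{dx}{L}$. \end{itemize} Moreover, if $E_*<+\infty$,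 $$|\varepsilon_n\psi_n'(0)|^2\to 2C_{E_*}\sqrt{E_*-V(0)}\,\mathbf{1}_{V(0)<E_*},\qquad |\varepsilon_n\psi_n'(L)|^2\to 2C_{E_*}\sqrt{E_*-V(L)}\,\mathbf{1}_{V(L)<E_*},$$ (the right-hand sides being $0$ when the indicator vanishes), and if $E_*=+\infty$, $$E_n^{-1}|\varepsilon_n\psi_n'(0)|^2\to\frac2L,\qquad E_n^{-1}|\varepsilon_n\psi_n'(L)|^2\to\frac2L.$$
   Context: For $E\ge E_0$: $x_-(E)$ is the solution of $V(x_-(E))=E$ with $x_-(E)\le\mathbf{x}_0$ if $E\le V(0)$, and $x_-(E)=0$ if $E\ge V(0)$; $x_+(E)$ is the solution of $V(x_+(E))=E$ with $x_+(E)\ge\mathbf{x}_0$ if $E\le V(L)$, and $x_+(E)=L$ if $E\ge V(L)$. $(t)_+=\max(t,0)$. *)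

theory Defs
  imports "HOL-Analysis.Analysis" "HOL-Library.Extended_Real"
begin

text \<open>Turning points x_-(E), x_+(E) of the potential V on [0,L] with unique
  minimum point x0, for E \<ge> E0 = V x0.\<close>

definition xminus :: "(real \<Rightarrow> real) \<Rightarrow> real \<Rightarrow> real \<Rightarrow> real" where
  "xminus V x0 E = (if V 0 \<le> E then 0 else (THE x. x \<in> {0..x0} \<and> V x = E))"

definition xplus :: "(real \<Rightarrow> real) \<Rightarrow> real \<Rightarrow> real \<Rightarrow> real \<Rightarrow> real" where
  "xplus V x0 L E = (if V L \<le> E then L else (THE x. x \<in> {x0..L} \<and> V x = E))"

definition Cconst :: "(real \<Rightarrow> real) \<Rightarrow> real \<Rightarrow> real \<Rightarrow> real \<Rightarrow> real" where
  "Cconst V x0 L E =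
     1 / integral {xminus V x0 E <..< xplus V x0 L E} (\<lambda>x. 1 / sqrt (E - V x))"

definition limit_measure_integral ::
  "(real \<Rightarrow> real) \<Rightarrow> real \<Rightarrow> real \<Rightarrow> ereal \<Rightarrow> (real \<Rightarrow> real) \<Rightarrow> real" where
  "limit_measure_integral V x0 L Es f =
     (if Es = \<infinity> then integral {0..L} f / L
      else if Es = ereal (V x0) then f x0
      else Cconst V x0 L (real_of_ereal Es) *
           integral {xminus V x0 (real_of_ereal Es) <..< xplus V x0 L (real_of_ereal Es)}
             (\<lambda>x. f x / sqrt (real_of_ereal Es - V x)))"

end

theory Submission
  imports Defs
begin

text \<open>
  Put a = |psi|^2, b = |eps psi'|^2 and u = E - V. Multiplying the equation by h psi' and by h' psi
  and integrating by parts gives, for every h in C^1, the virial identity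
  h(L) b(L) - h(0) b(0) = int (2 u h' - h V') a + o(1); its errors are controlled by |r| = o(eps),
  and equipartition int h' (b - u a) = o(1) holds for merely continuous h' by Weierstrass approximation.
  No compactness is needed: the limit is found by solving 2 u h' - h V' = f - c for h. The solution
  u^(-1/2) int_0^x (f - c) / (2 sqrt u) vanishes at both ends exactly if c is the mean of f for the
  limit measure. It is singular at the turning points, so sqrt u is replaced by
  sqrt q with q = (u + sqrt (u^2 + d^2)) / 2, which changes the right-hand side by
  O(1 - u / sqrt (u^2 + d^2)). The multiplier (x - x0) / sqrt q, for which (x - x0) V' is positive
  away from x0, shows that a has little mass where this error is not small. With f = 1, c = 0 the
  same test functions compute the boundary terms. At the bottom of the well the multiplier x - x0
  suffices, and for infinite energy V is negligible in the virial identity divided by E.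
\<close>

subsection \<open>Products of absolutely continuous functions and the virial identity\<close>

text \<open>A multiplier has to be C^1 on all of [0,L], which rules out u^(-1/2) at a turning point.
  Hence every bound must be uniform in d: n tends to infinity first, with thresholds depending on d,
  and d tends to 0 afterwards. Two facts give this uniformity. The integral of the regularised
  density theta = sqrt q / rho, with rho = sqrt (u^2 + d^2), taken from the end on the same side of
  x0 is O(sqrt q), so that h / sqrt q stays bounded; this rests on V' being away from zero near the
  turning points. And away from x0 the multiplier (x - x0) / sqrt q is at least of order d^(-1/2)
  where u <= 0, so a bound on its virial identity that is free of d makes the mass there small. The
  function q is the positive root of q (q - u) = d^2 / 4, whence dq/du = q / rho; all errors then
  become multiples of the single function 1 - u / rho. The scale o(eps) of the source is the one at
  which 2 h psi' r = 2 h (eps psi') (r / eps) vanishes against a bounded kinetic energy.\<close>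

definition primitive_on :: "real \<Rightarrow> (real \<Rightarrow> real) \<Rightarrow> (real \<Rightarrow> real) \<Rightarrow> bool" where
  "primitive_on L F f \<longleftrightarrow>
     f absolutely_integrable_on {0..L} \<and> (\<forall>x\<in>{0..L}. F x = F 0 + integral {0..x} f)"

lemma primitive_onD:
  assumes "primitive_on L F f"
  shows "f absolutely_integrable_on {0..L}" "x \<in> {0..L} \<Longrightarrow> F x = F 0 + integral {0..x} f"
  using assms unfolding primitive_on_def by blast+

lemma absolutely_integrable_mult_continuous:
  fixes f g :: "real \<Rightarrow> real"
  assumes "f absolutely_integrable_on {a..b}" "continuous_on {a..b} g"
  shows "(\<lambda>x. f x * g x) absolutely_integrable_on {a..b}"
proof -
  have "bounded (g ` {a..b})"
    using assms(2) compact_continuous_image compact_imp_bounded by blast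
  moreover have "g \<in> borel_measurable (lebesgue_on {a..b})"
    using assms(2) by (simp add: continuous_imp_measurable_on_sets_lebesgue)
  ultimately have "(\<lambda>x. g x * f x) absolutely_integrable_on {a..b}"
    using absolutely_integrable_bounded_measurable_product_real assms(1) by fastforce
  then show ?thesis by (simp add: mult.commute)
qed

lemma primitive_on_increment:
  assumes "primitive_on L F f" "0 \<le> a" "a \<le> b" "b \<le> L"
  shows "F b - F a = integral {a..b} f" "f integrable_on {a..b}" "(\<lambda>x. \<bar>f x\<bar>) integrable_on {a..b}"
proof -
  have f: "f absolutely_integrable_on {0..L}" using assms(1) by (simp add: primitive_on_def)
  then have "f absolutely_integrable_on {a..b}"
    by (rule set_integrable_subset) (use assms in auto)
  then show "f integrable_on {a..b}" "(\<lambda>x. \<bar>f x\<bar>) integrable_on {a..b}"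
    by (auto simp: absolutely_integrable_on_def)
  have "f integrable_on {0..b}"
    using f by (metis absolutely_integrable_on_def assms(2,3,4) atLeastatMost_subset_iff integrable_on_subinterval order_refl)
  then have "integral {0..a} f + integral {a..b} f = integral {0..b} f"
    using assms by (intro Henstock_Kurzweil_Integration.integral_combine) auto
  moreover have "F b = F 0 + integral {0..b} f" "F a = F 0 + integral {0..a} f"
    using assms by (auto intro!: primitive_onD(2))
  ultimately show "F b - F a = integral {a..b} f" by simp
qed

lemma primitive_on_continuous:
  assumes "primitive_on L F f"
  shows "continuous_on {0..L} F"
proof -
  have "continuous_on {0..L} (\<lambda>x. F 0 + integral {0..x} f)"
    using primitive_onD(1)[OF assms]
    by (intro continuous_intros indefinite_integral_continuous_1)
       (auto simp: absolutely_integrable_on_def)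
  then show ?thesis
    by (rule continuous_on_eq) (rule primitive_onD(2)[OF assms, symmetric])
qed

lemma primitive_on_C1:
  assumes "\<And>x. x \<in> {0..L} \<Longrightarrow> (F has_real_derivative f x) (at x within {0..L})"
    and "continuous_on {0..L} f"
  shows "primitive_on L F f"
  unfolding primitive_on_def
proof (intro conjI ballI)
  show "f absolutely_integrable_on {0..L}"
    using assms(2) by (rule absolutely_integrable_continuous_real)
  fix x assume x: "x \<in> {0..L}"
  have "(f has_integral F x - F 0) {0..x}"
    using x by (intro fundamental_theorem_of_calculus)
      (auto simp flip: has_real_derivative_iff_has_vector_derivative
        intro: DERIV_subset[OF assms(1)])
  then show "F x = F 0 + integral {0..x} f" by (simp add: integral_unique)
qed

lemma primitive_on_add:
  assumes "primitive_on L F f" "primitive_on L G g"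
  shows "primitive_on L (\<lambda>x. F x + G x) (\<lambda>x. f x + g x)"
  unfolding primitive_on_def
proof (intro conjI ballI)
  show "(\<lambda>x. f x + g x) absolutely_integrable_on {0..L}"
    using assms by (intro set_integral_add primitive_onD(1))
  fix x assume x: "x \<in> {0..L}"
  have "integral {0..x} (\<lambda>x. f x + g x) = integral {0..x} f + integral {0..x} g"
    using x assms by (intro integral_add) (auto intro: primitive_on_increment)
  then show "F x + G x = F 0 + G 0 + integral {0..x} (\<lambda>x. f x + g x)"
    using primitive_onD(2)[OF assms(1) x] primitive_onD(2)[OF assms(2) x] by linarith
qed

text \<open>Integration by parts for psi', whose derivative is known only as an integrable function.
  Since \<open>primitive_on\<close> sees that derivative through its integral alone, the product
  rule comes from an additive estimate on short intervals and not from a pointwise rule.\<close>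

lemma primitive_on_mult:
  assumes F: "primitive_on L F f" and G: "primitive_on L G g"
  shows "primitive_on L (\<lambda>x. F x * G x) (\<lambda>x. f x * G x + g x * F x)"
proof -
  note cF = primitive_on_continuous[OF F] and cG = primitive_on_continuous[OF G]
  define h where "h = (\<lambda>x. f x * G x + g x * F x)"
  define m where "m = (\<lambda>x. \<bar>f x\<bar> + \<bar>g x\<bar>)"
  have h: "h absolutely_integrable_on {0..L}"
    unfolding h_def using F G cF cG
    by (intro set_integral_add absolutely_integrable_mult_continuous primitive_onD(1))
  have m: "m integrable_on {a..b}" if "0 \<le> a" "a \<le> b" "b \<le> L" for a b
    unfolding m_def using that F G by (intro integrable_add primitive_on_increment(3))
  have h_int: "h integrable_on {a..b}" if "0 \<le> a" "b \<le> L" for a b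
    using h that by (metis absolutely_integrable_on_def atLeastatMost_subset_iff integrable_on_subinterval)
  \<comment> \<open>On a short interval the increment of FG differs from the integral of h by at most
      the oscillation of F and G times the integral of m; this bound is additive.\<close>
  have local_est: "\<bar>F b * G b - F a * G a - integral {a..b} h\<bar> \<le> e * integral {a..b} m"
    if ab: "0 \<le> a" "a \<le> b" "b \<le> L" and osc: "\<And>z. z \<in> {a..b} \<Longrightarrow> \<bar>G b - G z\<bar> \<le> e \<and> \<bar>F a - F z\<bar> \<le> e"
    for a b e
  proof -
    have i1: "f integrable_on {a..b}" "g integrable_on {a..b}"
      using primitive_on_increment F G ab by auto
    have "F b * G b - F a * G a = (F b - F a) * G b + (G b - G a) * F a"
      by (simp add: algebra_simps)
    also have "\<dots> = integral {a..b} (\<lambda>z. f z * G b) + integral {a..b} (\<lambda>z. g z * F a)"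
      using primitive_on_increment(1)[OF F ab] primitive_on_increment(1)[OF G ab] by simp
    also have "\<dots> = integral {a..b} (\<lambda>z. f z * G b + g z * F a)"
      using i1 by (intro integral_add[symmetric]) (auto intro: integrable_on_mult_left)
    finally have "F b * G b - F a * G a - integral {a..b} h
       = integral {a..b} (\<lambda>z. f z * G b + g z * F a - h z)"
      using i1 ab h_int
      by (subst integral_diff) (auto intro!: integrable_add integrable_on_mult_left)
    also have "\<bar>\<dots>\<bar> \<le> integral {a..b} (\<lambda>z. e * m z)"
      unfolding real_norm_def[symmetric]
    proof (rule integral_norm_bound_integral)
      show "(\<lambda>z. f z * G b + g z * F a - h z) integrable_on {a..b}"
        using i1 ab h_int by (auto intro!: integrable_diff integrable_add integrable_on_mult_left)
      show "(\<lambda>z. e * m z) integrable_on {a..b}"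
        using m ab by (auto intro!: integrable_on_mult_right)
      fix z assume z: "z \<in> {a..b}"
      have "f z * G b + g z * F a - h z = f z * (G b - G z) + g z * (F a - F z)"
        by (simp add: h_def algebra_simps)
      also have "\<bar>\<dots>\<bar> \<le> \<bar>f z\<bar> * \<bar>G b - G z\<bar> + \<bar>g z\<bar> * \<bar>F a - F z\<bar>"
        by (metis abs_mult abs_triangle_ineq)
      also have "\<dots> \<le> \<bar>f z\<bar> * e + \<bar>g z\<bar> * e"
        using osc[OF z] by (intro add_mono mult_left_mono) auto
      finally show "norm (f z * G b + g z * F a - h z) \<le> e * m z"
        by (simp add: m_def algebra_simps)
    qed
    finally show ?thesis by simp
  qed
  have glob: "\<bar>F x * G x - F 0 * G 0 - integral {0..x} h\<bar> \<le> e * integral {0..x} m"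
    if x: "x \<in> {0..L}" and e: "e > 0" for x e
  proof -
    \<comment> \<open>The guards are there because \<open>Bolzano\<close> asks for the estimate on
      every short interval around \<open>t\<close>, including those that leave [0,x].\<close>
    define P where "P = (\<lambda>a b. 0 \<le> a \<longrightarrow> b \<le> x \<longrightarrow>
        \<bar>F b * G b - F a * G a - integral {a..b} h\<bar> \<le> e * integral {a..b} m)"
    have "P 0 x"
    proof (rule Bolzano[of 0 x P])
      show "0 \<le> x" using x by simp
    next
      fix a b c assume P: "P a b" "P b c" and le: "a \<le> b" "b \<le> c"
      show "P a c" unfolding P_def
      proof (intro impI)
        assume a: "0 \<le> a" and c: "c \<le> x"
        have "integral {a..b} h + integral {b..c} h = integral {a..c} h"
             "integral {a..b} m + integral {b..c} m = integral {a..c} m"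
          using le a c x h_int m by (auto intro!: Henstock_Kurzweil_Integration.integral_combine)
        moreover have "\<bar>F b * G b - F a * G a - integral {a..b} h\<bar> \<le> e * integral {a..b} m"
          "\<bar>F c * G c - F b * G b - integral {b..c} h\<bar> \<le> e * integral {b..c} m"
          using P a c le by (auto simp: P_def)
        ultimately show "\<bar>F c * G c - F a * G a - integral {a..c} h\<bar> \<le> e * integral {a..c} m"
          by (smt (verit) distrib_left)
      qed
    next
      fix t assume t: "0 \<le> t" "t \<le> x"
      then have tL: "t \<in> {0..L}" using x by auto
      obtain d1 where d1: "d1 > 0" "\<And>z. z \<in> {0..L} \<Longrightarrow> dist z t < d1 \<Longrightarrow> dist (F z) (F t) < e/2"
        using cF tL e unfolding continuous_on_iff by (meson half_gt_zero)
      obtain d2 where d2: "d2 > 0" "\<And>z. z \<in> {0..L} \<Longrightarrow> dist z t < d2 \<Longrightarrow> dist (G z) (G t) < e/2"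
        using cG tL e unfolding continuous_on_iff by (meson half_gt_zero)
      show "\<exists>d>0. \<forall>a b. a \<le> t \<and> t \<le> b \<and> b - a < d \<longrightarrow> P a b"
      proof (intro exI[of _ "min d1 d2"] conjI allI impI)
        show "min d1 d2 > 0" using d1 d2 by simp
        fix a b assume ab: "a \<le> t \<and> t \<le> b \<and> b - a < min d1 d2"
        show "P a b" unfolding P_def
        proof (intro impI local_est)
          assume a: "0 \<le> a" and b: "b \<le> x"
          show "0 \<le> a" "a \<le> b" "b \<le> L" using a b ab x by auto
          fix z assume z: "z \<in> {a..b}"
          have "\<bar>F y - F t\<bar> < e/2 \<and> \<bar>G y - G t\<bar> < e/2" if "y \<in> {a..b}" for y
            using d1(2)[of y] d2(2)[of y] that a b x ab by (auto simp: dist_real_def)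
          from this[of z] this[of a] this[of b] z ab
          have "\<bar>F z - F t\<bar> < e/2" "\<bar>G z - G t\<bar> < e/2" "\<bar>F a - F t\<bar> < e/2" "\<bar>G b - G t\<bar> < e/2"
            by auto
          then show "\<bar>G b - G z\<bar> \<le> e \<and> \<bar>F a - F z\<bar> \<le> e" by linarith
        qed
      qed
    qed
    then show ?thesis using x by (simp add: P_def)
  qed
  have eq: "F x * G x = F 0 * G 0 + integral {0..x} h" if x: "x \<in> {0..L}" for x
  proof -
    have "((\<lambda>e. e * integral {0..x} m) \<longlongrightarrow> 0 * integral {0..x} m) (at_right 0)"
      by (intro tendsto_intros)
    moreover have "eventually (\<lambda>e. \<bar>F x * G x - F 0 * G 0 - integral {0..x} h\<bar> \<le> e * integral {0..x} m) (at_right 0)"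
      by (rule eventually_mono[OF eventually_at_right_less]) (rule glob[OF x])
    ultimately have "\<bar>F x * G x - F 0 * G 0 - integral {0..x} h\<bar> \<le> 0 * integral {0..x} m"
      by (rule tendsto_lowerbound) simp
    then show ?thesis by simp
  qed
  have "primitive_on L (\<lambda>x. F x * G x) h"
    unfolding primitive_on_def using h eq by blast
  then show ?thesis by (simp add: h_def)
qed

text \<open>The first identity integrates the derivative of h (eps^2 y'^2 + (E - W) y^2), the second
  that of eps^2 h y y'; the equation eliminates y''. By the Dirichlet conditions only the y'^2
  boundary terms survive in the first and none in the second.\<close>

lemma virial_scalar:
  fixes eps E L :: real
  assumes L: "L > 0" and eps: "eps > 0"
    and W: "\<And>x. x \<in> {0..L} \<Longrightarrow> (W has_real_derivative W' x) (at x within {0..L})"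
    and W': "continuous_on {0..L} W'"
    and h: "\<And>x. x \<in> {0..L} \<Longrightarrow> (h has_real_derivative h' x) (at x within {0..L})"
    and h': "continuous_on {0..L} h'"
    and y: "primitive_on L y y'"
    and y': "primitive_on L y' (\<lambda>x. ((W x - E) * y x - r x) / eps\<^sup>2)"
    and bc: "y 0 = 0" "y L = 0"
  shows "((\<lambda>x. h' x * (eps\<^sup>2 * (y' x)\<^sup>2 + (E - W x) * (y x)\<^sup>2) - h x * W' x * (y x)\<^sup>2 - 2 * h x * y' x * r x)
            has_integral h L * (eps\<^sup>2 * (y' L)\<^sup>2) - h 0 * (eps\<^sup>2 * (y' 0)\<^sup>2)) {0..L}"
    and "((\<lambda>x. h x * (eps\<^sup>2 * (y' x)\<^sup>2 + (W x - E) * (y x)\<^sup>2 - y x * r x) + h' x * eps\<^sup>2 * y x * y' x)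
            has_integral 0) {0..L}"
proof -
  have hi: "(f has_integral F L - F 0) {0..L}" if "primitive_on L F f" for F f
    using primitive_on_increment[OF that, of 0 L] L by (simp add: has_integral_integral)
  have pW: "primitive_on L (\<lambda>x. E - W x) (\<lambda>x. 0 - W' x)"
    by (intro primitive_on_C1 DERIV_diff DERIV_const continuous_on_diff continuous_on_const W W')
  have ph: "primitive_on L h h'" by (rule primitive_on_C1[OF h h'])
  have pc: "primitive_on L (\<lambda>x. eps\<^sup>2) (\<lambda>x. 0)"
    by (intro primitive_on_C1 DERIV_const continuous_on_const)
  define d where "d = (\<lambda>x. ((W x - E) * y x - r x) / eps\<^sup>2)"
  have d: "eps\<^sup>2 * d x = (W x - E) * y x - r x" for x using eps by (simp add: d_def)
  note y'd = y'[folded d_def]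
  \<comment> \<open>This is the shape that \<open>primitive_on_mult\<close> yields; the zeros come
    from the derivative of the constant eps^2. Inserting the equation for eps^2 y'' cancels the
    terms with (E - W) y y' and leaves -2 h y' r.\<close>
  have "((\<lambda>x. h' x * (eps\<^sup>2 * (y' x * y' x) + (E - W x) * (y x * y x)) +
         (0 * (y' x * y' x) + (d x * y' x + d x * y' x) * eps\<^sup>2 +
          ((0 - W' x) * (y x * y x) + (y' x * y x + y' x * y x) * (E - W x))) * h x)
      has_integral h L * (eps\<^sup>2 * (y' L * y' L) + (E - W L) * (y L * y L)) -
         h 0 * (eps\<^sup>2 * (y' 0 * y' 0) + (E - W 0) * (y 0 * y 0))) {0..L}"
    by (intro hi primitive_on_mult primitive_on_add ph pc pW y y'd)
  moreover have "h' x * (eps\<^sup>2 * (y' x * y' x) + (E - W x) * (y x * y x)) +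
         (0 * (y' x * y' x) + (d x * y' x + d x * y' x) * eps\<^sup>2 +
          ((0 - W' x) * (y x * y x) + (y' x * y x + y' x * y x) * (E - W x))) * h x
      = h' x * (eps\<^sup>2 * (y' x)\<^sup>2 + (E - W x) * (y x)\<^sup>2) - h x * W' x * (y x)\<^sup>2 - 2 * h x * y' x * r x" for x
    using d[of x] by algebra
  ultimately show "((\<lambda>x. h' x * (eps\<^sup>2 * (y' x)\<^sup>2 + (E - W x) * (y x)\<^sup>2) - h x * W' x * (y x)\<^sup>2 - 2 * h x * y' x * r x)
            has_integral h L * (eps\<^sup>2 * (y' L)\<^sup>2) - h 0 * (eps\<^sup>2 * (y' 0)\<^sup>2)) {0..L}"
    by (simp only: bc mult_zero_right add_0_right power2_eq_square)
  have "((\<lambda>x. h' x * (eps\<^sup>2 * (y x * y' x)) + (0 * (y x * y' x) + (y' x * y' x + d x * y x) * eps\<^sup>2) * h x)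
      has_integral h L * (eps\<^sup>2 * (y L * y' L)) - h 0 * (eps\<^sup>2 * (y 0 * y' 0))) {0..L}"
    by (intro hi primitive_on_mult primitive_on_add ph pc y y'd)
  moreover have "h' x * (eps\<^sup>2 * (y x * y' x)) + (0 * (y x * y' x) + (y' x * y' x + d x * y x) * eps\<^sup>2) * h x
     = h x * (eps\<^sup>2 * (y' x)\<^sup>2 + (W x - E) * (y x)\<^sup>2 - y x * r x) + h' x * eps\<^sup>2 * y x * y' x" for x
    using d[of x] by algebra
  ultimately show "((\<lambda>x. h x * (eps\<^sup>2 * (y' x)\<^sup>2 + (W x - E) * (y x)\<^sup>2 - y x * r x) + h' x * eps\<^sup>2 * y x * y' x)
            has_integral 0) {0..L}"
    by (simp only: bc mult_zero_left mult_zero_right diff_self)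
qed

section \<open>Complex solutions with a square-integrable source\<close>

lemma abs_two_mult_le:
  fixes x y t :: real
  assumes "t > 0"
  shows "\<bar>2 * x * y\<bar> \<le> t * x\<^sup>2 + y\<^sup>2 / t"
proof -
  have "0 \<le> (sqrt t * \<bar>x\<bar> - \<bar>y\<bar> / sqrt t)\<^sup>2" by simp
  also have "\<dots> = t * x\<^sup>2 + y\<^sup>2 / t - 2 * \<bar>x\<bar> * \<bar>y\<bar>"
    using assms by (simp add: power2_diff power_mult_distrib power_divide)
  finally show ?thesis by (simp add: abs_mult)
qed

lemma square_integrable_imp_absolutely_integrable:
  fixes r :: "real \<Rightarrow> complex"
  assumes "r \<in> borel_measurable (lebesgue_on {a..b})" "(\<lambda>x. (cmod (r x))\<^sup>2) integrable_on {a..b}"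
  shows "r absolutely_integrable_on {a..b}"
proof (rule measurable_bounded_by_integrable_imp_absolutely_integrable)
  show "(\<lambda>x. 1 + (cmod (r x))\<^sup>2) integrable_on {a..b}"
    using assms(2) by (intro integrable_add) (auto intro: integrable_const_ivl)
  fix x
  show "norm (r x) \<le> 1 + (cmod (r x))\<^sup>2"
    using abs_two_mult_le[of 1 1 "cmod (r x)"] norm_ge_zero[of "r x"] by (simp del: norm_ge_zero)
qed (use assms in auto)

lemma Re_inner_bound:
  fixes z w :: complex
  assumes "t > 0"
  shows "\<bar>2 * (Re z * Re w + Im z * Im w)\<bar> \<le> t * (cmod z)\<^sup>2 + (cmod w)\<^sup>2 / t"
proof -
  have "\<bar>2 * (Re z * Re w + Im z * Im w)\<bar> \<le> \<bar>2 * Re z * Re w\<bar> + \<bar>2 * Im z * Im w\<bar>"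
    by (simp add: algebra_simps)
  also have "\<dots> \<le> (t * (Re z)\<^sup>2 + (Re w)\<^sup>2 / t) + (t * (Im z)\<^sup>2 + (Im w)\<^sup>2 / t)"
    by (intro add_mono abs_two_mult_le assms)
  also have "\<dots> = t * (cmod z)\<^sup>2 + (cmod w)\<^sup>2 / t"
    by (simp add: cmod_power2 algebra_simps add_divide_distrib)
  finally show ?thesis .
qed

text \<open>The equation holds only almost everywhere. Changing the integrand on a null set does not
  affect the integral, so psi'' may be exchanged for the everywhere defined value \<open>d\<close>
  that the equation prescribes.\<close>

lemma primitive_on_complex:
  fixes p q d :: "real \<Rightarrow> complex"
  assumes p: "\<And>x. x \<in> {0..L} \<Longrightarrow> p x = p 0 + integral {0..x} q"
    and d: "d absolutely_integrable_on {0..L}"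
    and ae: "AE x in lborel. x \<in> {0..L} \<longrightarrow> q x = d x"
  shows "primitive_on L (\<lambda>x. Re (p x)) (\<lambda>x. Re (d x))" "primitive_on L (\<lambda>x. Im (p x)) (\<lambda>x. Im (d x))"
proof -
  obtain N where N: "{x \<in> space lborel. \<not> (x \<in> {0..L} \<longrightarrow> q x = d x)} \<subseteq> N" "N \<in> null_sets lborel"
    using ae unfolding eventually_ae_filter by blast
  have neg: "negligible N"
    using N(2) by (simp add: negligible_iff_null_sets null_sets_completionI)
  have p': "p x = p 0 + integral {0..x} d" if x: "x \<in> {0..L}" for x
  proof -
    have "integral {0..x} q = integral {0..x} d"
      by (rule integral_spike[OF neg]) (use N x in auto)
    then show ?thesis using p[OF x] by simp
  qed
  have di: "d integrable_on {0..x}" if "x \<in> {0..L}" for x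
    using d that by (auto simp: absolutely_integrable_on_def intro: integrable_on_subinterval)
  have lin: "f (p x) = f (p 0) + integral {0..x} (\<lambda>x. f (d x))"
    if f: "bounded_linear f" and x: "x \<in> {0..L}" for f :: "complex \<Rightarrow> real" and x
  proof -
    have "f (p x) = f (p 0) + f (integral {0..x} d)"
      using p'[OF x] by (simp add: linear_add bounded_linear.linear[OF f])
    also have "f (integral {0..x} d) = integral {0..x} (f \<circ> d)"
      using integral_linear[OF di[OF x] f] by simp
    finally show ?thesis by (simp add: comp_def)
  qed
  show "primitive_on L (\<lambda>x. Re (p x)) (\<lambda>x. Re (d x))"
    unfolding primitive_on_def
    using absolutely_integrable_linear[OF d bounded_linear_Re, unfolded comp_def] lin[OF bounded_linear_Re]
    by blast
  show "primitive_on L (\<lambda>x. Im (p x)) (\<lambda>x. Im (d x))"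
    unfolding primitive_on_def
    using absolutely_integrable_linear[OF d bounded_linear_Im, unfolded comp_def] lin[OF bounded_linear_Im]
    by blast
qed

text \<open>W and E are real, so the real and imaginary parts of psi solve the same equation with
  the parts of r as sources, and their scalar identities add up. Young's inequality bounds the
  errors: its weight t stays free in the first estimate, to be sent to 0 after n; in the second the
  weight eps turns eps^2 |psi| |psi'| into at most eps (a + b) / 2.\<close>

lemma virial_complex:
  fixes eps E L M M' t :: real and psi dpsi ddpsi r :: "real \<Rightarrow> complex"
  assumes L: "L > 0" and eps: "eps > 0" and t: "t > 0"
    and W: "\<And>x. x \<in> {0..L} \<Longrightarrow> (W has_real_derivative W' x) (at x within {0..L})"
    and W': "continuous_on {0..L} W'"
    and h: "\<And>x. x \<in> {0..L} \<Longrightarrow> (h has_real_derivative h' x) (at x within {0..L})"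
    and h': "continuous_on {0..L} h'"
    and M: "\<And>x. x \<in> {0..L} \<Longrightarrow> \<bar>h x\<bar> \<le> M"
    and M': "\<And>x. x \<in> {0..L} \<Longrightarrow> \<bar>h' x\<bar> \<le> M'"
    and psi: "\<And>x. x \<in> {0..L} \<Longrightarrow> (psi has_vector_derivative dpsi x) (at x within {0..L})"
    and dpsi: "\<And>x. x \<in> {0..L} \<Longrightarrow> dpsi x = dpsi 0 + integral {0..x} ddpsi"
    and bc: "psi 0 = 0" "psi L = 0"
    and norm1: "integral {0..L} (\<lambda>x. (cmod (psi x))\<^sup>2) = 1"
    and r: "r \<in> borel_measurable (lebesgue_on {0..L})" "(\<lambda>x. (cmod (r x))\<^sup>2) integrable_on {0..L}"
    and eq: "AE x in lborel. x \<in> {0..L} \<longrightarrow>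
        - complex_of_real (eps\<^sup>2) * ddpsi x + complex_of_real (W x - E) * psi x = r x"
  defines "a \<equiv> \<lambda>x. (cmod (psi x))\<^sup>2" and "b \<equiv> \<lambda>x. eps\<^sup>2 * (cmod (dpsi x))\<^sup>2"
    and "R \<equiv> integral {0..L} (\<lambda>x. (cmod (r x))\<^sup>2)"
  shows "continuous_on {0..L} a" "continuous_on {0..L} b"
    and "\<bar>h L * b L - h 0 * b 0 - integral {0..L} (\<lambda>x. h' x * (b x + (E - W x) * a x) - h x * W' x * a x)\<bar>
         \<le> M * (t * integral {0..L} b + R / (t * eps\<^sup>2))"
    and "\<bar>integral {0..L} (\<lambda>x. h x * (b x + (W x - E) * a x))\<bar>
         \<le> M * (eps + R / eps) / 2 + M' * eps / 2 * (1 + integral {0..L} b)"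
proof -
  have Wc: "continuous_on {0..L} W" by (rule DERIV_continuous_on) (rule W)
  have hc: "continuous_on {0..L} h" by (rule DERIV_continuous_on) (rule h)
  have psic: "continuous_on {0..L} psi"
    by (rule continuous_on_vector_derivative) (rule psi)
  have ri: "r absolutely_integrable_on {0..L}"
    by (rule square_integrable_imp_absolutely_integrable[OF r])
  define d where "d = (\<lambda>x. (complex_of_real (W x - E) * psi x - r x) /\<^sub>R eps\<^sup>2)"
  have d: "d absolutely_integrable_on {0..L}"
    unfolding d_def
    by (intro absolutely_integrable_scaleR_left set_integral_diff ri absolutely_integrable_continuous_real
        continuous_intros Wc psic)
  have ae: "AE x in lborel. x \<in> {0..L} \<longrightarrow> ddpsi x = d x"
    using eq
  proof (rule eventually_mono)
    fix x assume *: "x \<in> {0..L} \<longrightarrow> - complex_of_real (eps\<^sup>2) * ddpsi x + complex_of_real (W x - E) * psi x = r x"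
    show "x \<in> {0..L} \<longrightarrow> ddpsi x = d x"
    proof
      assume "x \<in> {0..L}"
      with * have "complex_of_real (W x - E) * psi x - r x = eps\<^sup>2 *\<^sub>R ddpsi x"
        by (simp add: scaleR_conv_of_real algebra_simps)
      then show "ddpsi x = d x" using eps by (simp add: d_def)
    qed
  qed
  note prim = primitive_on_complex[OF dpsi d ae]
  define y1 y2 p1 p2 r1 r2 where "y1 = (\<lambda>x. Re (psi x))" and "y2 = (\<lambda>x. Im (psi x))" and
    "p1 = (\<lambda>x. Re (dpsi x))" and "p2 = (\<lambda>x. Im (dpsi x))" and
    "r1 = (\<lambda>x. Re (r x))" and "r2 = (\<lambda>x. Im (r x))"
  note defs = y1_def y2_def p1_def p2_def r1_def r2_def
  have p1: "primitive_on L p1 (\<lambda>x. ((W x - E) * y1 x - r1 x) / eps\<^sup>2)"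
    and p2: "primitive_on L p2 (\<lambda>x. ((W x - E) * y2 x - r2 x) / eps\<^sup>2)"
    using prim by (simp_all add: defs d_def divide_inverse mult.commute)
  have y1: "primitive_on L y1 p1"
    by (rule primitive_on_C1[OF _ primitive_on_continuous[OF p1]])
      (auto simp: has_real_derivative_iff_has_vector_derivative defs intro!: bounded_linear.has_vector_derivative[OF bounded_linear_Re] psi)
  have y2: "primitive_on L y2 p2"
    by (rule primitive_on_C1[OF _ primitive_on_continuous[OF p2]])
      (auto simp: has_real_derivative_iff_has_vector_derivative defs intro!: bounded_linear.has_vector_derivative[OF bounded_linear_Im] psi)
  have aeq: "a = (\<lambda>x. (y1 x)\<^sup>2 + (y2 x)\<^sup>2)" and beq: "b = (\<lambda>x. eps\<^sup>2 * (p1 x)\<^sup>2 + eps\<^sup>2 * (p2 x)\<^sup>2)"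
    by (auto simp: a_def b_def defs cmod_power2 algebra_simps)
  note c = primitive_on_continuous[OF y1] primitive_on_continuous[OF y2]
    primitive_on_continuous[OF p1] primitive_on_continuous[OF p2]
  show ac: "continuous_on {0..L} a" and bc': "continuous_on {0..L} b"
    unfolding aeq beq by (auto intro!: continuous_intros c)
  have bi: "b integrable_on {0..L}" and ai: "a integrable_on {0..L}"
    using ac bc' by (auto intro: integrable_continuous_real)
  have M0: "M \<ge> 0" using M[of 0] L by auto
  have M0': "M' \<ge> 0" using M'[of 0] L by auto
  have bcs: "y1 0 = 0" "y1 L = 0" "y2 0 = 0" "y2 L = 0" using bc by (auto simp: defs)
  note v1 = virial_scalar[OF L eps W W' h h' y1 p1 bcs(1,2)]
  note v2 = virial_scalar[OF L eps W W' h h' y2 p2 bcs(3,4)]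
  define f where "f = (\<lambda>x. h' x * (b x + (E - W x) * a x) - h x * W' x * a x)"
  have fi: "f integrable_on {0..L}" unfolding f_def
    by (intro integrable_continuous_real continuous_intros ac bc' hc h' Wc W')
  have "((\<lambda>x. f x - 2 * h x * (p1 x * r1 x + p2 x * r2 x)) has_integral h L * b L - h 0 * b 0) {0..L}"
    by (rule has_integral_eq_rhs[OF has_integral_eq[OF _ has_integral_add[OF v1(1) v2(1)]]])
      (auto simp: f_def aeq beq algebra_simps)
  from has_integral_diff[OF integrable_integral[OF fi] this]
  have i1: "((\<lambda>x. 2 * h x * (p1 x * r1 x + p2 x * r2 x)) has_integral
        integral {0..L} f - (h L * b L - h 0 * b 0)) {0..L}" by simp
  have r2i: "(\<lambda>x. t * b x + (cmod (r x))\<^sup>2 / (t * eps\<^sup>2)) integrable_on {0..L}"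
    by (intro integrable_add integrable_on_divide integrable_on_mult_right bi r)
  have "\<bar>integral {0..L} f - (h L * b L - h 0 * b 0)\<bar>
      \<le> integral {0..L} (\<lambda>x. M * (t * b x + (cmod (r x))\<^sup>2 / (t * eps\<^sup>2)))"
    unfolding integral_unique[OF i1, symmetric] real_norm_def[symmetric]
  proof (rule integral_norm_bound_integral)
    fix x assume x: "x \<in> {0..L}"
    have "\<bar>2 * h x * (p1 x * r1 x + p2 x * r2 x)\<bar> = \<bar>h x\<bar> * \<bar>2 * (p1 x * r1 x + p2 x * r2 x)\<bar>"
      by (simp only: abs_mult abs_numeral mult_ac)
    also have "\<dots> \<le> M * ((t * eps\<^sup>2) * (cmod (dpsi x))\<^sup>2 + (cmod (r x))\<^sup>2 / (t * eps\<^sup>2))"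
      using M[OF x] M0 t eps unfolding defs by (intro mult_mono Re_inner_bound) auto
    finally show "norm (2 * h x * (p1 x * r1 x + p2 x * r2 x)) \<le> M * (t * b x + (cmod (r x))\<^sup>2 / (t * eps\<^sup>2))"
      by (simp add: b_def algebra_simps)
  qed (use i1 r2i in \<open>auto intro: integrable_on_mult_right\<close>)
  also have "\<dots> = M * (t * integral {0..L} b + R / (t * eps\<^sup>2))"
    using bi r by (simp add: integral_add integrable_on_divide integrable_on_mult_right R_def)
  finally show "\<bar>h L * b L - h 0 * b 0 - integral {0..L} (\<lambda>x. h' x * (b x + (E - W x) * a x) - h x * W' x * a x)\<bar>
         \<le> M * (t * integral {0..L} b + R / (t * eps\<^sup>2))"
    unfolding f_def[symmetric] by linarith
  define g where "g = (\<lambda>x. h x * (b x + (W x - E) * a x))"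
  have gi: "g integrable_on {0..L}" unfolding g_def
    by (intro integrable_continuous_real continuous_intros ac bc' hc Wc)
  define e where "e = (\<lambda>x. h x * (y1 x * r1 x + y2 x * r2 x) - h' x * eps\<^sup>2 * (y1 x * p1 x + y2 x * p2 x))"
  have "((\<lambda>x. g x - e x) has_integral 0) {0..L}"
    by (rule has_integral_eq_rhs[OF has_integral_eq[OF _ has_integral_add[OF v1(2) v2(2)]]])
      (auto simp: g_def e_def aeq beq algebra_simps)
  from has_integral_diff[OF integrable_integral[OF gi] this]
  have i2: "(e has_integral integral {0..L} g) {0..L}" by simp
  have "\<bar>integral {0..L} g\<bar> \<le> integral {0..L} (\<lambda>x. M * (eps * a x + (cmod (r x))\<^sup>2 / eps) / 2 + M' * eps / 2 * (a x + b x))"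
    unfolding integral_unique[OF i2, symmetric] real_norm_def[symmetric]
  proof (rule integral_norm_bound_integral)
    fix x assume x: "x \<in> {0..L}"
    have 1: "\<bar>h x * (y1 x * r1 x + y2 x * r2 x)\<bar> = \<bar>h x\<bar> * \<bar>2 * (y1 x * r1 x + y2 x * r2 x)\<bar> / 2"
      by (simp add: abs_mult del: distrib_left_numeral)
    have "\<dots> \<le> M * (eps * (cmod (psi x))\<^sup>2 + (cmod (r x))\<^sup>2 / eps) / 2"
      using M[OF x] M0 eps unfolding defs by (intro divide_right_mono mult_mono Re_inner_bound) auto
    also have "\<dots> = M * (eps * a x + (cmod (r x))\<^sup>2 / eps) / 2" by (simp add: a_def)
    finally have e1: "\<bar>h x * (y1 x * r1 x + y2 x * r2 x)\<bar> \<le> M * (eps * a x + (cmod (r x))\<^sup>2 / eps) / 2"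
      using 1 by simp
    have 2: "\<bar>h' x * eps\<^sup>2 * (y1 x * p1 x + y2 x * p2 x)\<bar> = \<bar>h' x\<bar> * eps\<^sup>2 * \<bar>2 * (p1 x * y1 x + p2 x * y2 x)\<bar> / 2"
      using eps by (simp only: abs_mult abs_numeral abs_power2 mult.commute[of "p1 x"] mult.commute[of "p2 x"])
    have "\<dots> \<le> M' * eps\<^sup>2 * (eps * (cmod (dpsi x))\<^sup>2 + (cmod (psi x))\<^sup>2 / eps) / 2"
      using M'[OF x] M0' eps unfolding defs by (intro divide_right_mono mult_mono Re_inner_bound) auto
    also have "\<dots> = M' * eps / 2 * (a x + b x)"
      using eps by (simp add: a_def b_def field_simps power2_eq_square)
    finally have "\<bar>h' x * eps\<^sup>2 * (y1 x * p1 x + y2 x * p2 x)\<bar> \<le> M' * eps / 2 * (a x + b x)"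
      using 2 by simp
    with e1 show "norm (e x) \<le> M * (eps * a x + (cmod (r x))\<^sup>2 / eps) / 2 + M' * eps / 2 * (a x + b x)"
      unfolding e_def real_norm_def by linarith
  qed (use i2 ai bi r in \<open>auto intro!: integrable_add integrable_on_divide integrable_on_mult_right\<close>)
  also have "\<dots> = M * (eps * integral {0..L} a + R / eps) / 2 + M' * eps / 2 * (integral {0..L} a + integral {0..L} b)"
    using ai bi r
    by (simp add: integral_add integrable_on_divide integrable_on_mult_right integrable_add R_def)
  also have "integral {0..L} a = 1" using norm1 by (simp add: a_def)
  finally show "\<bar>integral {0..L} (\<lambda>x. h x * (b x + (W x - E) * a x))\<bar>
         \<le> M * (eps + R / eps) / 2 + M' * eps / 2 * (1 + integral {0..L} b)"
    by (simp add: g_def)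
qed

subsection \<open>The virial identity in the semiclassical limit\<close>

lemma tendsto_zero_by_bounds:
  fixes f :: "nat \<Rightarrow> real"
  assumes "\<And>\<kappa>. \<kappa> > 0 \<Longrightarrow> \<forall>\<^sub>F n in sequentially. \<bar>f n\<bar> \<le> C * \<kappa>"
  shows "f \<longlonglongrightarrow> 0"
proof (rule tendstoI)
  fix e :: real assume e: "e > 0"
  have "\<forall>\<^sub>F n in sequentially. \<bar>f n\<bar> \<le> C * (e / (2 * (1 + \<bar>C\<bar>)))"
    using e by (intro assms) (simp add: add_pos_nonneg)
  moreover have "C * (e / (2 * (1 + \<bar>C\<bar>))) < e"
  proof -
    have "C * (e / (2 * (1 + \<bar>C\<bar>))) \<le> (1 + \<bar>C\<bar>) * (e / (2 * (1 + \<bar>C\<bar>)))"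
      using e by (intro mult_right_mono) auto
    also have "\<dots> = e / 2" by (simp add: field_simps add_pos_nonneg)
    finally show ?thesis using e by linarith
  qed
  ultimately show "\<forall>\<^sub>F n in sequentially. dist (f n) 0 < e"
    by (auto elim!: eventually_mono)
qed

lemma tendsto_zero_mult_bounded:
  fixes a b :: "nat \<Rightarrow> real"
  assumes a: "a \<longlonglongrightarrow> 0" and b: "\<And>n. \<bar>b n\<bar> \<le> M"
  shows "(\<lambda>n. a n * b n) \<longlonglongrightarrow> 0"
proof (rule Lim_null_comparison)
  show "\<forall>\<^sub>F n in sequentially. norm (a n * b n) \<le> \<bar>a n\<bar> * M"
    by (intro always_eventually allI) (simp add: abs_mult mult_left_mono b)
  show "(\<lambda>n. \<bar>a n\<bar> * M) \<longlonglongrightarrow> 0"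
    using tendsto_mult[OF tendsto_rabs_zero[OF a] tendsto_const[of M]] by simp
qed

text \<open>For the boundary terms, where the regularised coefficient \<open>lam k\<close>
  multiplies a sequence that does not depend on k. One good k is fixed before n grows, so no
  uniformity in k is asked for.\<close>

lemma tendsto_inverse_by_approximation:
  fixes b lam :: "nat \<Rightarrow> real"
  assumes lam: "lam \<longlonglongrightarrow> l" "l > 0"
    and approx: "\<And>\<kappa>. \<kappa> > 0 \<Longrightarrow> \<forall>\<^sub>F k in sequentially. \<forall>\<^sub>F n in sequentially. \<bar>lam k * b n - 1\<bar> \<le> \<kappa>"
  shows "b \<longlonglongrightarrow> 1 / l"
proof -
  have "(\<lambda>n. b n - 1 / l) \<longlonglongrightarrow> 0"
  proof (rule tendsto_zero_by_bounds[where C = "2 / l + 1"])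
    fix \<kappa> :: real assume \<kappa>: "\<kappa> > 0"
    have "(\<lambda>k. 1 / lam k) \<longlonglongrightarrow> 1 / l" using lam by (intro tendsto_intros) auto
    then have "\<forall>\<^sub>F k in sequentially. dist (1 / lam k) (1 / l) < \<kappa>" using \<kappa> by (rule tendstoD)
    moreover have "\<forall>\<^sub>F k in sequentially. l / 2 < lam k" using lam by (intro order_tendstoD) auto
    ultimately have "\<forall>\<^sub>F k in sequentially. dist (1 / lam k) (1 / l) < \<kappa> \<and> l / 2 < lam k \<and>
       (\<forall>\<^sub>F n in sequentially. \<bar>lam k * b n - 1\<bar> \<le> \<kappa>)"
      using approx[OF \<kappa>] by eventually_elim simp
    then obtain k where k: "dist (1 / lam k) (1 / l) < \<kappa>" "l / 2 < lam k"
       "\<forall>\<^sub>F n in sequentially. \<bar>lam k * b n - 1\<bar> \<le> \<kappa>"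
      using eventually_happens'[OF sequentially_bot] by blast
    from k(3) show "\<forall>\<^sub>F n in sequentially. \<bar>b n - 1 / l\<bar> \<le> (2 / l + 1) * \<kappa>"
    proof eventually_elim
      case (elim n)
      have p: "lam k > 0" using k(2) lam(2) by linarith
      have "b n - 1 / l = (lam k * b n - 1) * (1 / lam k) + (1 / lam k - 1 / l)"
        using p by (simp add: field_simps)
      also have "\<bar>\<dots>\<bar> \<le> \<bar>lam k * b n - 1\<bar> * (1 / lam k) + \<bar>1 / lam k - 1 / l\<bar>"
        using abs_triangle_ineq[of "(lam k * b n - 1) * (1 / lam k)" "1 / lam k - 1 / l"] p
        by (simp only: abs_mult[of "lam k * b n - 1"] abs_of_pos[of "1 / lam k"] zero_less_divide_1_iff)
      also have "\<dots> \<le> \<kappa> * (2 / l) + \<kappa>"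
      proof (intro add_mono mult_mono elim)
        show "1 / lam k \<le> 2 / l" using k(2) p lam(2) by (simp add: field_simps)
        show "\<bar>1 / lam k - 1 / l\<bar> \<le> \<kappa>" using k(1) by (simp add: dist_real_def)
      qed (use \<kappa> p in auto)
      finally show ?case by (simp add: algebra_simps)
    qed
  qed
  then show ?thesis using Lim_null by blast
qed

lemma bounded_on_interval:
  fixes f :: "real \<Rightarrow> real"
  assumes "continuous_on {a..b} f"
  obtains M where "M > 0" "\<And>x. x \<in> {a..b} \<Longrightarrow> \<bar>f x\<bar> \<le> M"
proof -
  have "bounded (f ` {a..b})"
    using assms compact_continuous_image compact_imp_bounded by blast
  then show ?thesis using that unfolding bounded_pos by auto
qed

lemma abs_integral_le_weighted:
  fixes f g :: "real \<Rightarrow> real"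
  assumes "continuous_on {a..b} f" "continuous_on {a..b} g" "\<And>x. x \<in> {a..b} \<Longrightarrow> \<bar>f x\<bar> \<le> g x"
  shows "\<bar>integral {a..b} f\<bar> \<le> integral {a..b} g"
  unfolding real_norm_def[symmetric]
  by (rule integral_norm_bound_integral) (use assms in \<open>auto intro: integrable_continuous_real\<close>)

text \<open>Only the equation and the convergence of the potentials enter here; the shape of V is
  described by \<open>potential_well\<close>, and \<open>virial_sequence\<close> joins the
  two.\<close>

locale quasimode_family =
  fixes L :: real
    and V V' :: "real \<Rightarrow> real"
    and Veps Vdeps :: "real \<Rightarrow> real \<Rightarrow> real"
    and eps E :: "nat \<Rightarrow> real"
    and psi dpsi ddpsi r :: "nat \<Rightarrow> real \<Rightarrow> complex"
  assumes L_pos: "L > 0"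
    and V_C1: "\<And>x. x \<in> {0..L} \<Longrightarrow> (V has_real_derivative V' x) (at x within {0..L})"
    and V'_cont: "continuous_on {0..L} V'"
    and Veps_C1: "\<And>\<epsilon> x. \<epsilon> \<in> {0<..1} \<Longrightarrow> x \<in> {0..L} \<Longrightarrow>
                   (Veps \<epsilon> has_real_derivative Vdeps \<epsilon> x) (at x within {0..L})"
    and Vdeps_cont: "\<And>\<epsilon>. \<epsilon> \<in> {0<..1} \<Longrightarrow> continuous_on {0..L} (Vdeps \<epsilon>)"
    and Veps_conv: "\<And>e. e > 0 \<Longrightarrow> \<exists>\<delta>>0. \<forall>\<epsilon>\<in>{0<..1}. \<epsilon> < \<delta> \<longrightarrow>
                   (\<forall>x\<in>{0..L}. \<bar>V x - Veps \<epsilon> x\<bar> \<le> e \<and> \<bar>V' x - Vdeps \<epsilon> x\<bar> \<le> e)"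
    and eps_range: "\<And>n. eps n \<in> {0<..1}"
    and eps_lim: "eps \<longlonglongrightarrow> 0"
    and psi_deriv: "\<And>n x. x \<in> {0..L} \<Longrightarrow> (psi n has_vector_derivative dpsi n x) (at x within {0..L})"
    and dpsi_AC: "\<And>n x. x \<in> {0..L} \<Longrightarrow> dpsi n x = dpsi n 0 + integral {0..x} (ddpsi n)"
    and psi_bc: "\<And>n. psi n 0 = 0" "\<And>n. psi n L = 0"
    and psi_norm: "\<And>n. integral {0..L} (\<lambda>x. (cmod (psi n x))\<^sup>2) = 1"
    and r_meas: "\<And>n. r n \<in> borel_measurable (lebesgue_on {0..L})"
    and r_L2: "\<And>n. (\<lambda>x. (cmod (r n x))\<^sup>2) integrable_on {0..L}"
    and equation: "\<And>n. AE x in lborel. x \<in> {0..L} \<longrightarrow>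
        - complex_of_real ((eps n)\<^sup>2) * ddpsi n x
        + complex_of_real (Veps (eps n) x - E n) * psi n x = r n x"
    and r_small: "(\<lambda>n. sqrt (integral {0..L} (\<lambda>x. (cmod (r n x))\<^sup>2)) / eps n) \<longlonglongrightarrow> 0"
begin

definition W where "W n = Veps (eps n)"
definition W' where "W' n = Vdeps (eps n)"
definition A where "A n x = (cmod (psi n x))\<^sup>2"
definition B where "B n x = (eps n)\<^sup>2 * (cmod (dpsi n x))\<^sup>2"
definition R where "R n = integral {0..L} (\<lambda>x. (cmod (r n x))\<^sup>2)"
text \<open>The scale of the kinetic energy. It stays bounded when the energies converge and is
  comparable to E n when they diverge, so dividing by it treats both regimes at once.\<close>

definition N where "N n = 1 + \<bar>E n\<bar>"

lemma eps_pos: "eps n > 0" using eps_range by auto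
lemma N_ge1: "N n \<ge> 1" by (simp add: N_def)
lemma N_pos: "N n > 0" by (simp add: N_def add_pos_nonneg)
lemma A_nonneg: "A n x \<ge> 0" by (simp add: A_def)
lemma B_nonneg: "B n x \<ge> 0" by (simp add: B_def)

lemma W_deriv: "x \<in> {0..L} \<Longrightarrow> (W n has_real_derivative W' n x) (at x within {0..L})"
  using Veps_C1 eps_range by (simp add: W_def W'_def)

lemma W'_cont: "continuous_on {0..L} (W' n)"
  using Vdeps_cont eps_range by (simp add: W'_def)

lemma W_cont: "continuous_on {0..L} (W n)"
  by (rule DERIV_continuous_on) (rule W_deriv)

lemma V_cont: "continuous_on {0..L} V"
  by (rule DERIV_continuous_on) (rule V_C1)

lemma W_close:
  assumes "\<kappa> > 0"
  shows "\<forall>\<^sub>F n in sequentially. \<forall>x\<in>{0..L}. \<bar>V x - W n x\<bar> \<le> \<kappa> \<and> \<bar>V' x - W' n x\<bar> \<le> \<kappa>"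
proof -
  obtain d where d: "d > 0" "\<And>\<epsilon>. \<epsilon> \<in> {0<..1} \<Longrightarrow> \<epsilon> < d \<Longrightarrow>
      \<forall>x\<in>{0..L}. \<bar>V x - Veps \<epsilon> x\<bar> \<le> \<kappa> \<and> \<bar>V' x - Vdeps \<epsilon> x\<bar> \<le> \<kappa>"
    using Veps_conv[OF assms] by blast
  have "\<forall>\<^sub>F n in sequentially. eps n < d"
    using order_tendstoD(2)[OF eps_lim d(1)] .
  then show ?thesis
    by eventually_elim (use d(2) eps_range in \<open>simp add: W_def W'_def\<close>)
qed

lemma virial_bound:
  assumes "\<And>x. x \<in> {0..L} \<Longrightarrow> (h has_real_derivative h' x) (at x within {0..L})"
    and "continuous_on {0..L} h'"
    and "\<And>x. x \<in> {0..L} \<Longrightarrow> \<bar>h x\<bar> \<le> M"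
    and "\<And>x. x \<in> {0..L} \<Longrightarrow> \<bar>h' x\<bar> \<le> M'"
  shows "t > 0 \<Longrightarrow> \<bar>h L * B n L - h 0 * B n 0 - integral {0..L} (\<lambda>x. h' x * (B n x + (E n - W n x) * A n x) - h x * W' n x * A n x)\<bar>
         \<le> M * (t * integral {0..L} (B n) + R n / (t * (eps n)\<^sup>2))"
    and "\<bar>integral {0..L} (\<lambda>x. h x * (B n x + (W n x - E n) * A n x))\<bar>
         \<le> M * (eps n + R n / eps n) / 2 + M' * eps n / 2 * (1 + integral {0..L} (B n))"
proof -
  have eq: "AE x in lborel. x \<in> {0..L} \<longrightarrow>
        - complex_of_real ((eps n)\<^sup>2) * ddpsi n x
        + complex_of_real (W n x - E n) * psi n x = r n x"
    using equation by (simp add: W_def)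
  note v = virial_complex[OF L_pos eps_pos _ W_deriv W'_cont assms psi_deriv dpsi_AC psi_bc psi_norm r_meas r_L2 eq]
  show "t > 0 \<Longrightarrow> \<bar>h L * B n L - h 0 * B n 0 - integral {0..L} (\<lambda>x. h' x * (B n x + (E n - W n x) * A n x) - h x * W' n x * A n x)\<bar>
         \<le> M * (t * integral {0..L} (B n) + R n / (t * (eps n)\<^sup>2))"
    unfolding A_def B_def R_def by (rule v(3))
  show "\<bar>integral {0..L} (\<lambda>x. h x * (B n x + (W n x - E n) * A n x))\<bar>
         \<le> M * (eps n + R n / eps n) / 2 + M' * eps n / 2 * (1 + integral {0..L} (B n))"
    unfolding A_def B_def R_def by (rule v(4)[OF zero_less_one])
qed

lemma A_cont: "continuous_on {0..L} (A n)" and B_cont: "continuous_on {0..L} (B n)"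
proof -
  have eq: "AE x in lborel. x \<in> {0..L} \<longrightarrow>
        - complex_of_real ((eps n)\<^sup>2) * ddpsi n x
        + complex_of_real (W n x - E n) * psi n x = r n x"
    using equation by (simp add: W_def)
  \<comment> \<open>The zero multiplier, with bounds 0, gives access to the two continuity
    statements.\<close>
  note v = virial_complex(1,2)[OF L_pos eps_pos zero_less_one W_deriv W'_cont DERIV_const[of 0] continuous_on_const[of _ 0]
     _ _ psi_deriv dpsi_AC psi_bc psi_norm r_meas r_L2 eq, of 0 0]
  show "continuous_on {0..L} (A n)" using v(1) unfolding A_def[abs_def] by simp
  show "continuous_on {0..L} (B n)" using v(2) unfolding B_def[abs_def] by simp
qed

lemma A_norm: "integral {0..L} (A n) = 1"
  using psi_norm by (simp add: A_def[abs_def])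

lemma A_int: "(A n) integrable_on {0..L}" and B_int: "(B n) integrable_on {0..L}"
  using A_cont B_cont by (auto intro: integrable_continuous_real)

lemma abs_integral_A_le:
  assumes "continuous_on {0..L} f" "\<And>x. x \<in> {0..L} \<Longrightarrow> \<bar>f x\<bar> \<le> M"
  shows "\<bar>integral {0..L} (\<lambda>x. f x * A n x)\<bar> \<le> M"
proof -
  have "\<bar>integral {0..L} (\<lambda>x. f x * A n x)\<bar> \<le> integral {0..L} (\<lambda>x. M * A n x)"
    by (rule abs_integral_le_weighted)
      (auto intro!: continuous_intros assms A_cont mult_right_mono simp: abs_mult A_nonneg)
  then show ?thesis using A_int A_norm by (simp add: integral_mult_right)
qed

text \<open>This is the form in which the assumption |r| = o(eps) is used.\<close>

lemma R_eps2: "(\<lambda>n. R n / (eps n)\<^sup>2) \<longlonglongrightarrow> 0"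
proof -
  have "R n \<ge> 0" for n unfolding R_def by (intro integral_nonneg r_L2) auto
  then have "(sqrt (R n) / eps n)\<^sup>2 = R n / (eps n)\<^sup>2" for n by (simp add: power_divide)
  then show ?thesis using tendsto_power[OF r_small, of 2] by (simp add: R_def)
qed

lemma R_eps: "(\<lambda>n. R n / eps n) \<longlonglongrightarrow> 0"
proof -
  have "R n / (eps n)\<^sup>2 * eps n = R n / eps n" for n
    using eps_pos[of n] by (simp add: power2_eq_square)
  then show ?thesis using tendsto_mult[OF R_eps2 eps_lim] by simp
qed

text \<open>The equation tested with psi itself: the second virial identity with the constant
  multiplier 1, whose derivative term disappears.\<close>

lemma energy_balance: "(\<lambda>n. integral {0..L} (B n) + integral {0..L} (\<lambda>x. (W n x - E n) * A n x)) \<longlonglongrightarrow> 0"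
proof -
  have bound: "\<bar>integral {0..L} (B n) + integral {0..L} (\<lambda>x. (W n x - E n) * A n x)\<bar> \<le> (eps n + R n / eps n) / 2" for n
  proof -
    have "\<bar>integral {0..L} (\<lambda>x. 1 * (B n x + (W n x - E n) * A n x))\<bar>
      \<le> 1 * (eps n + R n / eps n) / 2 + 0 * eps n / 2 * (1 + integral {0..L} (B n))"
      by (rule virial_bound(2)) auto
    moreover have "(\<lambda>x. (W n x - E n) * A n x) integrable_on {0..L}"
      by (intro integrable_continuous_real continuous_intros W_cont A_cont)
    ultimately show ?thesis by (simp add: integral_add B_int)
  qed
  have "(\<lambda>n. (eps n + R n / eps n) / 2) \<longlonglongrightarrow> (0 + 0) / 2"
    by (intro tendsto_intros eps_lim R_eps) simp
  then have lim: "(\<lambda>n. (eps n + R n / eps n) / 2) \<longlonglongrightarrow> 0" by simp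
  show ?thesis
    by (rule Lim_null_comparison[OF always_eventually lim]) (simp only: real_norm_def bound simp_thms)
qed

lemma kinetic_bound:
  obtains C where "C > 0"
    "\<forall>\<^sub>F n in sequentially. integral {0..L} (B n) \<le> C * N n \<and> (\<forall>x\<in>{0..L}. \<bar>W n x - E n\<bar> \<le> C * N n)"
proof -
  obtain K where K: "K > 0" "\<And>x. x \<in> {0..L} \<Longrightarrow> \<bar>V x\<bar> \<le> K"
    using bounded_on_interval[OF V_cont] by blast
  have "\<forall>\<^sub>F n in sequentially. \<bar>integral {0..L} (B n) + integral {0..L} (\<lambda>x. (W n x - E n) * A n x)\<bar> < 1"
    using order_tendstoD(2)[OF tendsto_rabs_zero[OF energy_balance] zero_less_one] .
  \<comment> \<open>In K + 2, K bounds V, one unit pays for W - V and one for the error in the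
    energy balance.\<close>
  with W_close[OF zero_less_one]
  have "\<forall>\<^sub>F n in sequentially. integral {0..L} (B n) \<le> (K + 2) * N n \<and> (\<forall>x\<in>{0..L}. \<bar>W n x - E n\<bar> \<le> (K + 2) * N n)"
  proof eventually_elim
    case (elim n)
    have *: "\<bar>W n x - E n\<bar> \<le> K + 1 + \<bar>E n\<bar>" if "x \<in> {0..L}" for x
      using K(2)[OF that] bspec[OF elim(1) that] by linarith
    have "\<bar>integral {0..L} (\<lambda>x. (W n x - E n) * A n x)\<bar> \<le> K + 1 + \<bar>E n\<bar>"
      by (rule abs_integral_A_le) (intro continuous_intros W_cont, rule *)
    then have "integral {0..L} (B n) \<le> K + 2 + \<bar>E n\<bar>" using elim(2) by linarith
    moreover have "K + 2 + \<bar>E n\<bar> \<le> (K + 2) * N n"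
      using K(1) mult_right_mono[of 1 "K+2" "\<bar>E n\<bar>"] by (simp add: N_def distrib_left)
    ultimately have "integral {0..L} (B n) \<le> (K + 2) * N n" "K + 1 + \<bar>E n\<bar> \<le> (K + 2) * N n"
      by linarith+
    then show ?case using order_trans[OF *] by blast
  qed
  with K(1) show ?thesis by (intro that[of "K + 2"]) auto
qed

text \<open>Used with g = h', for which g' need not exist, whereas the identity requires a
  differentiable multiplier. The bound on the derivative of the approximating polynomial may blow up
  with the accuracy, but it is multiplied by eps n, and the accuracy is fixed before n
  grows.\<close>

lemma equipartition:
  assumes g: "continuous_on {0..L} g"
  shows "(\<lambda>n. integral {0..L} (\<lambda>x. g x * (B n x + (W n x - E n) * A n x)) / N n) \<longlonglongrightarrow> 0"
proof -
  obtain C where C: "C > 0"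
    "\<forall>\<^sub>F n in sequentially. integral {0..L} (B n) \<le> C * N n \<and> (\<forall>x\<in>{0..L}. \<bar>W n x - E n\<bar> \<le> C * N n)"
    by (rule kinetic_bound)
  show ?thesis
  \<comment> \<open>Replacing g by the polynomial costs C through B and C through (W - E) A; the
    polynomial itself costs 1.\<close>
  proof (rule tendsto_zero_by_bounds[where C="2 * C + 1"])
    fix \<kappa> :: real assume \<kappa>: "\<kappa> > 0"
    obtain p where p: "real_polynomial_function p" "\<And>x. x \<in> {0..L} \<Longrightarrow> \<bar>g x - p x\<bar> < \<kappa>"
      by (rule Stone_Weierstrass_real_polynomial_function[OF compact_Icc g \<kappa>]) blast
    obtain p' where p': "real_polynomial_function p'" "\<And>x. (p has_real_derivative p' x) (at x)"
      using has_real_derivative_polynomial_function[OF p(1)] by blast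
    have pc: "continuous_on {0..L} p" "continuous_on {0..L} p'"
      using p(1) p'(1) by (auto intro!: continuous_on_polymonial_function simp: real_polynomial_function_eq)
    obtain M where M: "M > 0" "\<And>x. x \<in> {0..L} \<Longrightarrow> \<bar>p x\<bar> \<le> M"
      using bounded_on_interval[OF pc(1)] by blast
    obtain M' where M': "M' > 0" "\<And>x. x \<in> {0..L} \<Longrightarrow> \<bar>p' x\<bar> \<le> M'"
      using bounded_on_interval[OF pc(2)] by blast
    have "(\<lambda>n. M * (eps n + R n / eps n) / 2 + M' * eps n / 2 * (1 + C)) \<longlonglongrightarrow>
       M * (0 + 0) / 2 + M' * 0 / 2 * (1 + C)"
      by (intro tendsto_intros eps_lim R_eps) auto
    then have "\<forall>\<^sub>F n in sequentially. M * (eps n + R n / eps n) / 2 + M' * eps n / 2 * (1 + C) < \<kappa>"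
      by (rule order_tendstoD) (use \<kappa> in simp)
    with C(2) show "\<forall>\<^sub>F n in sequentially.
        \<bar>integral {0..L} (\<lambda>x. g x * (B n x + (W n x - E n) * A n x)) / N n\<bar> \<le> (2 * C + 1) * \<kappa>"
    proof eventually_elim
      case (elim n)
      let ?D = "\<lambda>x. B n x + (W n x - E n) * A n x"
      have N: "N n \<ge> 1" "N n > 0" using N_ge1[of n] N_pos[of n] by auto
      have Dc: "continuous_on {0..L} ?D" by (intro continuous_intros B_cont A_cont W_cont)
      have B0: "integral {0..L} (B n) \<ge> 0" by (intro integral_nonneg B_int B_nonneg)
      have "\<bar>integral {0..L} (\<lambda>x. p x * ?D x)\<bar>
         \<le> M * (eps n + R n / eps n) / 2 + M' * eps n / 2 * (1 + integral {0..L} (B n))"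
        by (rule virial_bound(2)[OF has_field_derivative_at_within[OF p'(2)] pc(2) M(2) M'(2)])
      also have "\<dots> \<le> N n * (M * (eps n + R n / eps n) / 2) + M' * eps n / 2 * (N n * (1 + C))"
      proof (intro add_mono mult_left_mono)
        have "R n \<ge> 0" unfolding R_def by (intro integral_nonneg r_L2) auto
        then have "M * (eps n + R n / eps n) / 2 \<ge> 0" using M(1) eps_pos[of n] by simp
        then show "M * (eps n + R n / eps n) / 2 \<le> N n * (M * (eps n + R n / eps n) / 2)"
          using mult_right_mono[OF N(1)] by fastforce
        show "1 + integral {0..L} (B n) \<le> N n * (1 + C)"
          using elim(1) N by (simp add: algebra_simps)
        show "0 \<le> M' * eps n / 2" using M' eps_pos[of n] by simp
      qed
      also have "\<dots> = N n * (M * (eps n + R n / eps n) / 2 + M' * eps n / 2 * (1 + C))"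
        by (simp add: algebra_simps)
      also have "\<dots> \<le> N n * \<kappa>" using elim(2) N by (intro mult_left_mono) auto
      finally have 1: "\<bar>integral {0..L} (\<lambda>x. p x * ?D x)\<bar> \<le> N n * \<kappa>" .
      have "\<bar>integral {0..L} (\<lambda>x. (g x - p x) * ?D x)\<bar> \<le> integral {0..L} (\<lambda>x. \<kappa> * (B n x + C * N n * A n x))"
      proof (rule abs_integral_le_weighted)
        fix x assume x: "x \<in> {0..L}"
        have "\<bar>?D x\<bar> \<le> B n x + \<bar>W n x - E n\<bar> * A n x"
          using B_nonneg[of n x] A_nonneg[of n x] by (metis abs_mult abs_of_nonneg abs_triangle_ineq)
        also have "\<dots> \<le> B n x + C * N n * A n x"
          using elim(1) x A_nonneg by (intro add_left_mono mult_right_mono) auto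
        finally show "\<bar>(g x - p x) * ?D x\<bar> \<le> \<kappa> * (B n x + C * N n * A n x)"
          unfolding abs_mult using p(2)[OF x] \<kappa> by (intro mult_mono) auto
      qed (intro continuous_intros g pc Dc A_cont B_cont)+
      also have "\<dots> = \<kappa> * (integral {0..L} (B n) + C * N n)"
        using A_int B_int A_norm by (simp add: integral_add integral_mult_right integrable_on_mult_right)
      also have "\<dots> \<le> \<kappa> * (C * N n + C * N n)" using elim(1) \<kappa> by (intro mult_left_mono) auto
      finally have 2: "\<bar>integral {0..L} (\<lambda>x. (g x - p x) * ?D x)\<bar> \<le> \<kappa> * (2 * C * N n)" by simp
      have "integral {0..L} (\<lambda>x. g x * ?D x) = integral {0..L} (\<lambda>x. (g x - p x) * ?D x + p x * ?D x)"
        by (simp add: left_diff_distrib)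
      also have "\<dots> = integral {0..L} (\<lambda>x. (g x - p x) * ?D x) + integral {0..L} (\<lambda>x. p x * ?D x)"
        by (intro integral_add integrable_continuous_real continuous_on_mult continuous_on_diff g pc Dc)
      finally have "\<bar>integral {0..L} (\<lambda>x. g x * ?D x)\<bar> \<le> \<kappa> * (2 * C * N n) + N n * \<kappa>"
        using 1 2 by linarith
      then show ?case using N by (simp add: abs_divide divide_le_eq algebra_simps)
    qed
  qed
qed

text \<open>Subtracting equipartition with weight h' removes B under the integral and doubles the
  term h' (E - W) A. Only then is W replaced by V.\<close>

lemma virial_limit:
  assumes h: "\<And>x. x \<in> {0..L} \<Longrightarrow> (h has_real_derivative h' x) (at x within {0..L})"
    and h': "continuous_on {0..L} h'"
  shows "(\<lambda>n. (h L * B n L - h 0 * B n 0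
            - integral {0..L} (\<lambda>x. (2 * h' x * (E n - V x) - h x * V' x) * A n x)) / N n) \<longlonglongrightarrow> 0"
proof -
  have hc: "continuous_on {0..L} h" by (rule DERIV_continuous_on) (rule h)
  obtain M where M: "M > 0" "\<And>x. x \<in> {0..L} \<Longrightarrow> \<bar>h x\<bar> \<le> M"
    using bounded_on_interval[OF hc] by blast
  obtain M' where M': "M' > 0" "\<And>x. x \<in> {0..L} \<Longrightarrow> \<bar>h' x\<bar> \<le> M'"
    using bounded_on_interval[OF h'] by blast
  obtain C where C: "C > 0"
    "\<forall>\<^sub>F n in sequentially. integral {0..L} (B n) \<le> C * N n \<and> (\<forall>x\<in>{0..L}. \<bar>W n x - E n\<bar> \<le> C * N n)"
    by (rule kinetic_bound)
  show ?thesis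
  \<comment> \<open>M (C + 1) bounds the source term for the Young weight t = \<kappa>, the last 1
    is equipartition, and 2 M' + M is the cost of passing from W, W' to V, V'.\<close>
  proof (rule tendsto_zero_by_bounds[where C="M * (C + 1) + 2 * M' + M + 1"])
    fix \<kappa> :: real assume \<kappa>: "\<kappa> > 0"
    have "(\<lambda>n. R n / (eps n)\<^sup>2 / \<kappa>) \<longlonglongrightarrow> 0 / \<kappa>" using \<kappa> by (intro tendsto_intros R_eps2) auto
    then have "\<forall>\<^sub>F n in sequentially. R n / (eps n)\<^sup>2 / \<kappa> < \<kappa>"
      by (rule order_tendstoD) (use \<kappa> in simp)
    moreover have "\<forall>\<^sub>F n in sequentially. \<bar>integral {0..L} (\<lambda>x. h' x * (B n x + (W n x - E n) * A n x)) / N n\<bar> < \<kappa>"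
      using order_tendstoD(2)[OF tendsto_rabs_zero[OF equipartition[OF h']] \<kappa>] .
    ultimately show "\<forall>\<^sub>F n in sequentially. \<bar>(h L * B n L - h 0 * B n 0
            - integral {0..L} (\<lambda>x. (2 * h' x * (E n - V x) - h x * V' x) * A n x)) / N n\<bar>
         \<le> (M * (C + 1) + 2 * M' + M + 1) * \<kappa>"
      using C(2) W_close[OF \<kappa>]
    proof eventually_elim
      case (elim n)
      have N: "N n \<ge> 1" "N n > 0" using N_ge1[of n] N_pos[of n] by auto
      let ?X = "h L * B n L - h 0 * B n 0"
      let ?I = "integral {0..L} (\<lambda>x. (2 * h' x * (E n - V x) - h x * V' x) * A n x)"
      let ?I1 = "integral {0..L} (\<lambda>x. h' x * (B n x + (E n - W n x) * A n x) - h x * W' n x * A n x)"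
      let ?I2 = "integral {0..L} (\<lambda>x. h' x * (B n x + (W n x - E n) * A n x))"
      let ?I3 = "integral {0..L} (\<lambda>x. (2 * h' x * (V x - W n x) + h x * (V' x - W' n x)) * A n x)"
      have "integral {0..L} (\<lambda>x. h' x * (B n x + (E n - W n x) * A n x) - h x * W' n x * A n x
          - h' x * (B n x + (W n x - E n) * A n x)) = ?I1 - ?I2"
        by (intro integral_diff integrable_continuous_real continuous_intros hc h' A_cont B_cont W_cont W'_cont)
      moreover have "integral {0..L} (\<lambda>x. (2 * h' x * (E n - V x) - h x * V' x) * A n x
          + (2 * h' x * (V x - W n x) + h x * (V' x - W' n x)) * A n x) = ?I + ?I3"
        by (intro integral_add integrable_continuous_real continuous_intros hc h' A_cont B_cont W_cont W'_cont V_cont V'_cont)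
      moreover have "(\<lambda>x. h' x * (B n x + (E n - W n x) * A n x) - h x * W' n x * A n x
          - h' x * (B n x + (W n x - E n) * A n x))
          = (\<lambda>x. (2 * h' x * (E n - V x) - h x * V' x) * A n x
          + (2 * h' x * (V x - W n x) + h x * (V' x - W' n x)) * A n x)"
        by (simp add: algebra_simps)
      ultimately have split: "?X - ?I = (?X - ?I1) + ?I2 + ?I3" by simp
      have "\<bar>?X - ?I1\<bar> \<le> M * (\<kappa> * integral {0..L} (B n) + R n / (\<kappa> * (eps n)\<^sup>2))"
        by (rule virial_bound(1)[OF h h' M(2) M'(2) \<kappa>])
      also have "\<dots> \<le> M * (\<kappa> * (C * N n) + \<kappa> * N n)"
      proof (intro mult_left_mono add_mono)
        show "integral {0..L} (B n) \<le> C * N n" using elim(3) by simp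
        have "R n / (\<kappa> * (eps n)\<^sup>2) = R n / (eps n)\<^sup>2 / \<kappa>" by (simp add: mult.commute)
        also have "\<dots> \<le> \<kappa> * 1" using elim(1) by simp
        also have "\<dots> \<le> \<kappa> * N n" using N \<kappa> by (intro mult_left_mono) auto
        finally show "R n / (\<kappa> * (eps n)\<^sup>2) \<le> \<kappa> * N n" .
      qed (use M \<kappa> in auto)
      finally have 1: "\<bar>?X - ?I1\<bar> \<le> M * (C + 1) * \<kappa> * N n" by (simp add: algebra_simps)
      have 2: "\<bar>?I2\<bar> \<le> \<kappa> * N n" using elim(2) N by (simp add: abs_divide divide_less_eq)
      have "\<bar>?I3\<bar> \<le> (2 * M' + M) * \<kappa>"
      proof (rule abs_integral_A_le)
        show "continuous_on {0..L} (\<lambda>x. 2 * h' x * (V x - W n x) + h x * (V' x - W' n x))"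
          by (intro continuous_intros hc h' W_cont W'_cont V_cont V'_cont)
        fix x assume x: "x \<in> {0..L}"
        have "\<bar>2 * h' x * (V x - W n x) + h x * (V' x - W' n x)\<bar>
          \<le> 2 * \<bar>h' x\<bar> * \<bar>V x - W n x\<bar> + \<bar>h x\<bar> * \<bar>V' x - W' n x\<bar>"
          by (metis (no_types) abs_mult abs_numeral abs_triangle_ineq)
        also have "\<dots> \<le> 2 * M' * \<kappa> + M * \<kappa>"
          using elim(4) x M M' by (intro add_mono mult_mono) auto
        finally show "\<bar>2 * h' x * (V x - W n x) + h x * (V' x - W' n x)\<bar> \<le> (2 * M' + M) * \<kappa>"
          by (simp add: algebra_simps)
      qed
      also have "\<dots> \<le> (2 * M' + M) * \<kappa> * N n" using N M M' \<kappa> by simp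
      finally have 3: "\<bar>?I3\<bar> \<le> (2 * M' + M) * \<kappa> * N n" .
      have "\<bar>?X - ?I\<bar> \<le> M * (C + 1) * \<kappa> * N n + \<kappa> * N n + (2 * M' + M) * \<kappa> * N n"
        unfolding split using 1 2 3 by linarith
      also have "\<dots> = (M * (C + 1) + 2 * M' + M + 1) * \<kappa> * N n" by (simp add: algebra_simps)
      finally show ?case using N by (simp add: abs_divide divide_le_eq)
    qed
  qed
qed

end

subsection \<open>Regularisation of the inverse square root\<close>

definition rho :: "real \<Rightarrow> real \<Rightarrow> real" where
  "rho d u = sqrt (u\<^sup>2 + d\<^sup>2)"

text \<open>A positive analytic approximation of the positive part of u.\<close>

definition ppart :: "real \<Rightarrow> real \<Rightarrow> real" where
  "ppart d u = (u + rho d u) / 2"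

text \<open>The derivative of 2 sqrt (ppart d u) in u. As d tends to 0 it tends to 1 / sqrt u for u
  > 0 and to 0 for u < 0: a smooth stand-in for the density of the limit measure.\<close>

definition theta :: "real \<Rightarrow> real \<Rightarrow> real" where
  "theta d u = sqrt (ppart d u) / rho d u"

text \<open>Lies between 0 and 2. It is O(d^2) where u stays above a positive level and at least 1
  where u <= 0, so its mean bounds the mass in the forbidden region.\<close>

definition gap :: "real \<Rightarrow> real \<Rightarrow> real" where
  "gap d u = 1 - u / rho d u"

context
  fixes d :: real
  assumes d: "d > 0"
begin

lemma rho_pos: "rho d u > 0"
  using d by (simp add: rho_def add_nonneg_pos)

lemma rho_sq: "(rho d u)\<^sup>2 = u\<^sup>2 + d\<^sup>2"
  by (simp add: rho_def)

lemma rho_gt_abs: "\<bar>u\<bar> < rho d u"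
  unfolding rho_def using d by (intro real_less_rsqrt) simp

lemma rho_le: "rho d u \<le> \<bar>u\<bar> + d"
  unfolding rho_def using d by (intro real_le_lsqrt) (auto simp: power2_sum)

lemma ppart_pos: "ppart d u > 0"
  using rho_gt_abs[of u] by (simp add: ppart_def)

lemma ppart_ge: "u \<le> ppart d u"
  using rho_gt_abs[of u] by (simp add: ppart_def)

lemma ppart_le_rho: "ppart d u \<le> rho d u"
  using rho_gt_abs[of u] by (simp add: ppart_def)

lemma ppart_le: "u \<le> s \<Longrightarrow> 0 \<le> s \<Longrightarrow> ppart d u \<le> s + d"
  using rho_le[of u] d by (simp add: ppart_def)

lemma rho_DERIV: "(rho d has_real_derivative u / rho d u) (at u within S)"
proof -
  have "((\<lambda>u. u\<^sup>2 + d\<^sup>2) has_real_derivative 2 * u) (at u within S)"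
    by (auto intro!: derivative_eq_intros)
  moreover have "0 < u\<^sup>2 + d\<^sup>2" using d by (simp add: add_nonneg_pos)
  ultimately have "((\<lambda>u. sqrt (u\<^sup>2 + d\<^sup>2)) has_real_derivative inverse (sqrt (u\<^sup>2 + d\<^sup>2)) / 2 * (2 * u)) (at u within S)"
    by (intro DERIV_chain2[OF DERIV_real_sqrt])
  moreover have "inverse (sqrt (u\<^sup>2 + d\<^sup>2)) / 2 * (2 * u) = u / rho d u"
    by (simp add: rho_def inverse_eq_divide)
  moreover have "rho d = (\<lambda>u. sqrt (u\<^sup>2 + d\<^sup>2))" by (rule ext) (rule rho_def)
  ultimately show ?thesis by (simp only:)
qed

text \<open>Since ppart (ppart - u) = d^2 / 4, the derivative is ppart / rho. Powers of ppart
  therefore differentiate to multiples of the same power over rho, which keeps the regularised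
  virial identity explicit.\<close>

lemma ppart_DERIV: "(ppart d has_real_derivative ppart d u / rho d u) (at u within S)"
proof -
  have "((\<lambda>u. (u + rho d u) / 2) has_real_derivative (1 + u / rho d u) / 2) (at u within S)"
    by (intro DERIV_cdivide DERIV_add rho_DERIV DERIV_ident)
  then show ?thesis using rho_pos[of u] by (simp add: ppart_def[abs_def] field_simps)
qed

lemma sqrt_ppart_DERIV: "((\<lambda>u. sqrt (ppart d u)) has_real_derivative theta d u / 2) (at u within S)"
proof -
  have "((\<lambda>u. sqrt (ppart d u)) has_real_derivative
       inverse (sqrt (ppart d u)) / 2 * (ppart d u / rho d u)) (at u within S)"
    by (rule DERIV_chain2[OF DERIV_real_sqrt[OF ppart_pos] ppart_DERIV])
  moreover have "inverse t / 2 * (t\<^sup>2 / rho d u) = t / rho d u / 2" if "t > 0" for t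
    using that rho_pos[of u] by (simp add: field_simps power2_eq_square)
  from this[of "sqrt (ppart d u)"]
  have "inverse (sqrt (ppart d u)) / 2 * (ppart d u / rho d u) = theta d u / 2"
    using ppart_pos[of u] by (simp add: theta_def)
  ultimately show ?thesis by (simp only:)
qed

lemma inverse_sqrt_ppart_DERIV:
  "((\<lambda>u. 1 / sqrt (ppart d u)) has_real_derivative - 1 / (2 * rho d u * sqrt (ppart d u))) (at u within S)"
proof -
  have nz: "sqrt (ppart d u) \<noteq> 0" using ppart_pos[of u] by simp
  have "((\<lambda>u. 1 / sqrt (ppart d u)) has_real_derivative
      (0 * sqrt (ppart d u) - 1 * (theta d u / 2)) / (sqrt (ppart d u) * sqrt (ppart d u))) (at u within S)"
    by (intro DERIV_divide DERIV_const sqrt_ppart_DERIV nz)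
  moreover have "(0 * t - 1 * (t / rho d u / 2)) / (t * t) = - 1 / (2 * rho d u * t)" if "t \<noteq> 0" for t
    using that rho_pos[of u] by (simp add: field_simps)
  from this[OF nz] have "(0 * sqrt (ppart d u) - 1 * (theta d u / 2)) / (sqrt (ppart d u) * sqrt (ppart d u))
     = - 1 / (2 * rho d u * sqrt (ppart d u))" unfolding theta_def .
  ultimately show ?thesis by (simp only:)
qed

lemma rho_cont: "continuous_on S (rho d)" and ppart_cont: "continuous_on S (ppart d)"
  by (rule DERIV_continuous_on, rule rho_DERIV ppart_DERIV)+

lemma theta_cont: "continuous_on S (theta d)" and gap_cont: "continuous_on S (gap d)"
  unfolding theta_def[abs_def] gap_def[abs_def] using rho_pos
  by (auto intro!: continuous_intros rho_cont ppart_cont simp: less_imp_neq[THEN not_sym])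

lemma theta_nonneg: "theta d u \<ge> 0"
  using rho_pos[of u] ppart_pos[of u] by (simp add: theta_def)

text \<open>A majorant free of d, for dominated convergence and for the bounds away from turning
  points.\<close>

lemma theta_le: "u \<noteq> 0 \<Longrightarrow> theta d u \<le> 1 / sqrt \<bar>u\<bar>"
proof -
  assume u: "u \<noteq> 0"
  have "theta d u \<le> sqrt (rho d u) / rho d u"
    unfolding theta_def using ppart_le_rho[of u] rho_pos[of u] by (intro divide_right_mono) auto
  also have "\<dots> = 1 / sqrt (rho d u)"
    using rho_pos[of u] by (simp add: field_simps)
  also have "\<dots> \<le> 1 / sqrt \<bar>u\<bar>"
    using rho_gt_abs[of u] u rho_pos[of u] by (intro divide_left_mono) auto
  finally show ?thesis .
qed

lemma gap_nonneg: "gap d u \<ge> 0"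
  using rho_gt_abs[of u] rho_pos[of u] by (simp add: gap_def divide_le_eq)

lemma gap_small:
  assumes "u \<ge> s" "s > 0"
  shows "gap d u \<le> (d / s)\<^sup>2"
proof -
  have u: "u > 0" "rho d u > 0" "rho d u \<ge> s" using assms rho_gt_abs[of u] by auto
  have "(rho d u - u) * (rho d u + u) = d\<^sup>2"
    using rho_sq[of u] by (simp add: algebra_simps power2_eq_square)
  then have "rho d u - u = d\<^sup>2 / (rho d u + u)"
    using u by (simp add: nonzero_eq_divide_eq)
  moreover have "gap d u = (rho d u - u) / rho d u"
    using u by (simp add: gap_def diff_divide_distrib)
  ultimately have "gap d u = d\<^sup>2 / ((rho d u + u) * rho d u)" by simp
  also have "\<dots> \<le> d\<^sup>2 / (s * s)"
    using u assms by (intro divide_left_mono mult_mono mult_pos_pos) auto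
  finally show ?thesis by (simp add: power_divide power2_eq_square)
qed

lemma ppart_mono:
  assumes "u \<le> v"
  shows "ppart d u \<le> ppart d v"
proof (rule DERIV_nonneg_imp_nondecreasing[OF assms])
  fix x
  have "0 \<le> ppart d x / rho d x" using ppart_pos[of x] rho_pos[of x] by simp
  then show "\<exists>y. (ppart d has_real_derivative y) (at x) \<and> 0 \<le> y"
    using ppart_DERIV by blast
qed

end

lemma ppart_tendsto: "u \<ge> 0 \<Longrightarrow> d \<longlonglongrightarrow> 0 \<Longrightarrow> (\<lambda>k. ppart (d k) u) \<longlonglongrightarrow> u"
proof -
  assume u: "u \<ge> 0" and d: "d \<longlonglongrightarrow> 0"
  have "(\<lambda>k. ppart (d k) u) \<longlonglongrightarrow> (u + sqrt (u\<^sup>2 + 0\<^sup>2)) / 2"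
    unfolding ppart_def rho_def by (intro tendsto_intros d) auto
  then show ?thesis using u by simp
qed

text \<open>The point u = 0 is excluded because theta d 0 = 1 / sqrt (2 d) diverges.\<close>

lemma theta_tendsto:
  assumes "u \<noteq> 0" "d \<longlonglongrightarrow> 0"
  shows "(\<lambda>k. theta (d k) u) \<longlonglongrightarrow> (if u > 0 then 1 / sqrt u else 0)"
proof -
  have "(\<lambda>k. theta (d k) u) \<longlonglongrightarrow> sqrt ((u + sqrt (u\<^sup>2 + 0\<^sup>2)) / 2) / sqrt (u\<^sup>2 + 0\<^sup>2)"
    unfolding theta_def ppart_def rho_def using assms by (intro tendsto_intros) auto
  also have "sqrt ((u + sqrt (u\<^sup>2 + 0\<^sup>2)) / 2) / sqrt (u\<^sup>2 + 0\<^sup>2) = (if u > 0 then 1 / sqrt u else 0)"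
    by (auto simp: field_simps)
  finally show ?thesis .
qed

section \<open>Estimates for an increasing potential at its turning point\<close>

lemma strict_mono_of_deriv_pos:
  fixes V :: "real \<Rightarrow> real"
  assumes V: "\<And>x. x \<in> {a..b} \<Longrightarrow> (V has_real_derivative V' x) (at x within {a..b})"
    and pos: "\<And>x. x \<in> {a<..b} \<Longrightarrow> V' x > 0"
    and "a \<le> x" "x < y" "y \<le> b"
  shows "V x < V y"
proof -
  have "\<exists>z\<in>{x<..<y}. V y - V x = (\<lambda>h. V' z * h) (y - x)"
  proof (rule mvt_simple)
    fix z assume z: "x \<le> z" "z \<le> y"
    have "(V has_real_derivative V' z) (at z within {x..y})"
      by (rule DERIV_subset[OF V]) (use z assms in auto)
    then show "(V has_derivative (\<lambda>h. V' z * h)) (at z within {x..y})"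
      by (simp add: has_field_derivative_def)
  qed (use assms in auto)
  then obtain z where z: "z \<in> {x<..<y}" "V y - V x = V' z * (y - x)" by blast
  have "V' z > 0" using z assms by (intro pos) auto
  then have "V' z * (y - x) > 0" using \<open>x < y\<close> by simp
  then show ?thesis using z(2) by linarith
qed

text \<open>Near a turning point V' is bounded away from zero, so that integrating theta against V',
  where it has the primitive -2 sqrt (ppart d (e - V)), controls the integral of theta itself.\<close>

lemma increasing_potential:
  fixes V V' :: "real \<Rightarrow> real"
  assumes ab: "a < b"
    and V: "\<And>x. x \<in> {a..b} \<Longrightarrow> (V has_real_derivative V' x) (at x within {a..b})"
    and V': "continuous_on {a..b} V'"
    and pos: "\<And>x. x \<in> {a<..b} \<Longrightarrow> V' x > 0"
    and e: "V a < e"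
  shows "\<exists>x1 c. a < x1 \<and> x1 \<le> b \<and> c > 0 \<and> V x1 < e \<and> (\<forall>x\<in>{x1..b}. V' x \<ge> c)"
proof -
  have Vc: "continuous_on {a..b} V" by (rule DERIV_continuous_on) (rule V)
  obtain \<delta> where \<delta>: "\<delta> > 0" "\<And>x. x \<in> {a..b} \<Longrightarrow> dist x a < \<delta> \<Longrightarrow> dist (V x) (V a) < e - V a"
    using Vc[unfolded continuous_on_iff, THEN bspec, of a] e ab by (metis atLeastAtMost_iff diff_gt_0_iff_gt less_imp_le order_refl)
  \<comment> \<open>V' may vanish at \<open>a\<close>, the bottom of the well. The point x1 stays
    strictly to its right, yet close enough that V x1 < e, so the compact interval [x1,b] contains
    any turning point and V' has a positive minimum on it.\<close>
  define x1 where "x1 = min b (a + \<delta> / 2)"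
  have x1: "a < x1" "x1 \<le> b" using ab \<delta> by (auto simp: x1_def)
  have "dist (V x1) (V a) < e - V a" using x1 \<delta>(1) by (intro \<delta>(2)) (auto simp: x1_def dist_real_def)
  then have Vx1: "V x1 < e" by (simp add: dist_real_def)
  have "continuous_on {x1..b} V'" by (rule continuous_on_subset[OF V']) (use x1 in auto)
  then obtain z where z: "z \<in> {x1..b}" "\<And>x. x \<in> {x1..b} \<Longrightarrow> V' z \<le> V' x"
    using continuous_attains_inf[of "{x1..b}" V'] x1 by auto
  have "V' z > 0" using z x1 by (intro pos) auto
  then show ?thesis using x1 Vx1 z by blast
qed

text \<open>M does not depend on d. A multiplier built from the integral of theta thus remains
  bounded after division by sqrt (ppart d (e - V)).\<close>

lemma theta_tail_bound:
  fixes V V' :: "real \<Rightarrow> real"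
  assumes ab: "a < b"
    and V: "\<And>x. x \<in> {a..b} \<Longrightarrow> (V has_real_derivative V' x) (at x within {a..b})"
    and V': "continuous_on {a..b} V'"
    and pos: "\<And>x. x \<in> {a<..b} \<Longrightarrow> V' x > 0"
    and e: "V a < e"
  obtains M where "M > 0" "\<And>d x. d > 0 \<Longrightarrow> x \<in> {a..b} \<Longrightarrow>
    integral {x..b} (\<lambda>y. theta d (e - V y)) \<le> M * sqrt (ppart d (e - V x))"
proof -
  obtain x1 c where x1: "a < x1" "x1 \<le> b" "c > 0" "V x1 < e" "\<And>x. x \<in> {x1..b} \<Longrightarrow> V' x \<ge> c"
    using increasing_potential[OF assms] by blast
  have Vc: "continuous_on {a..b} V" by (rule DERIV_continuous_on) (rule V)
  define \<eta> where "\<eta> = e - V x1"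
  have \<eta>: "\<eta> > 0" using x1 by (simp add: \<eta>_def)
  \<comment> \<open>The term 2 / c serves the part beyond x1. On [a,x1] one has e - V >= \<eta>, so
    theta is at most 1 / sqrt \<eta> = sqrt \<eta> / \<eta>, and for x < x1 the root of ppart at x
    is at least sqrt \<eta>.\<close>
  define M where "M = 2 / c + (x1 - a) / \<eta>"
  have mono: "V x \<le> V y" if "a \<le> x" "x \<le> y" "y \<le> b" for x y
    using strict_mono_of_deriv_pos[OF V pos, of x y] that by (cases "x = y") auto
  show thesis
  proof (rule that)
    show "M > 0" using x1 \<eta> by (auto simp: M_def intro!: add_pos_pos divide_pos_pos)
    fix d x :: real assume d: "d > 0" and x: "x \<in> {a..b}"
    have \<theta>c: "continuous_on {a..b} (\<lambda>y. theta d (e - V y))"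
      by (rule continuous_on_compose2[OF theta_cont[OF d, of UNIV]]) (auto intro!: continuous_intros Vc)
    have \<theta>i: "(\<lambda>y. theta d (e - V y)) integrable_on {s..t}" if "a \<le> s" "t \<le> b" for s t
      by (rule integrable_continuous_real[OF continuous_on_subset[OF \<theta>c]]) (use that in auto)
    have tail: "integral {z..b} (\<lambda>y. theta d (e - V y)) \<le> 2 / c * sqrt (ppart d (e - V z))"
      if z: "z \<in> {x1..b}" for z
    proof -
      have "((\<lambda>y. V' y * theta d (e - V y)) has_integral
          (- 2 * sqrt (ppart d (e - V b))) - (- 2 * sqrt (ppart d (e - V z)))) {z..b}"
      proof (rule fundamental_theorem_of_calculus)
        fix y assume y: "y \<in> {z..b}"
        have "(V has_real_derivative V' y) (at y within {z..b})"
          by (rule DERIV_subset[OF V]) (use y z x1 in auto)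
        then have "((\<lambda>y. e - V y) has_real_derivative 0 - V' y) (at y within {z..b})"
          by (intro DERIV_diff DERIV_const)
        from DERIV_chain2[OF sqrt_ppart_DERIV[OF d] this]
        have "((\<lambda>y. - 2 * sqrt (ppart d (e - V y))) has_real_derivative
           - 2 * (theta d (e - V y) / 2 * (0 - V' y))) (at y within {z..b})"
          by (rule DERIV_cmult)
        then show "((\<lambda>y. - 2 * sqrt (ppart d (e - V y))) has_vector_derivative V' y * theta d (e - V y)) (at y within {z..b})"
          by (simp add: has_real_derivative_iff_has_vector_derivative mult.commute)
      qed (use z in auto)
      from has_integral_mult_right[OF this, of "1 / c"]
      have I: "((\<lambda>y. 1 / c * (V' y * theta d (e - V y))) has_integral
          1 / c * (2 * sqrt (ppart d (e - V z)) - 2 * sqrt (ppart d (e - V b)))) {z..b}" by simp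
      have "integral {z..b} (\<lambda>y. theta d (e - V y)) \<le> 1 / c * (2 * sqrt (ppart d (e - V z)) - 2 * sqrt (ppart d (e - V b)))"
      proof (rule has_integral_le[OF integrable_integral I])
        show "(\<lambda>y. theta d (e - V y)) integrable_on {z..b}" using z x1 by (intro \<theta>i) auto
        fix y assume y: "y \<in> {z..b}"
        have "c * theta d (e - V y) \<le> V' y * theta d (e - V y)"
          using x1(5)[of y] y z theta_nonneg[OF d] by (intro mult_right_mono) auto
        then show "theta d (e - V y) \<le> 1 / c * (V' y * theta d (e - V y))"
          using x1(3) by (simp add: field_simps)
      qed
      also have "\<dots> \<le> 1 / c * (2 * sqrt (ppart d (e - V z)))"
        using x1(3) ppart_pos[OF d, of "e - V b"] by (intro mult_left_mono) auto
      finally show ?thesis by simp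
    qed
    show "integral {x..b} (\<lambda>y. theta d (e - V y)) \<le> M * sqrt (ppart d (e - V x))"
    proof (cases "x \<ge> x1")
      case True
      then have "integral {x..b} (\<lambda>y. theta d (e - V y)) \<le> 2 / c * sqrt (ppart d (e - V x))"
        using x by (intro tail) auto
      also have "\<dots> \<le> M * sqrt (ppart d (e - V x))"
        using x1 \<eta> ppart_pos[OF d, of "e - V x"] by (intro mult_right_mono) (auto simp: M_def)
      finally show ?thesis .
    next
      case False
      let ?s = "sqrt (ppart d (e - V x))"
      have s: "sqrt \<eta> \<le> ?s"
        using mono[of x x1] x x1 False ppart_ge[OF d, of "e - V x"] by (simp add: \<eta>_def)
      have s1: "sqrt (ppart d (e - V x1)) \<le> ?s"
        using mono[of x x1] x x1 False by (intro real_sqrt_le_mono ppart_mono[OF d]) simp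
      have "integral {x..b} (\<lambda>y. theta d (e - V y))
          = integral {x..x1} (\<lambda>y. theta d (e - V y)) + integral {x1..b} (\<lambda>y. theta d (e - V y))"
        using x x1 False by (intro Henstock_Kurzweil_Integration.integral_combine[symmetric] \<theta>i) auto
      also have "integral {x..x1} (\<lambda>y. theta d (e - V y)) \<le> integral {x..x1} (\<lambda>y. 1 / sqrt \<eta>)"
      proof (rule integral_le)
        show "(\<lambda>y. theta d (e - V y)) integrable_on {x..x1}" using x x1 by (intro \<theta>i) auto
        fix y assume y: "y \<in> {x..x1}"
        have u: "e - V y \<ge> \<eta>" using mono[of y x1] y x x1 by (auto simp: \<eta>_def)
        then have "theta d (e - V y) \<le> 1 / sqrt \<bar>e - V y\<bar>" using \<eta> by (intro theta_le[OF d]) auto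
        also have "\<dots> \<le> 1 / sqrt \<eta>" using u \<eta> by (intro divide_left_mono) auto
        finally show "theta d (e - V y) \<le> 1 / sqrt \<eta>" .
      qed (rule integrable_const_ivl)
      also have "integral {x..x1} (\<lambda>y. 1 / sqrt \<eta>) = (x1 - x) * (1 / sqrt \<eta>)"
        using False by simp
      also have "\<dots> \<le> (x1 - a) * (1 / sqrt \<eta>)"
        using x \<eta> by (intro mult_right_mono) auto
      also have "\<dots> = (x1 - a) / \<eta> * sqrt \<eta>" using \<eta> by (simp add: field_simps)
      also have "\<dots> \<le> (x1 - a) / \<eta> * ?s" using s x1 \<eta> by (intro mult_left_mono) auto
      also have "integral {x1..b} (\<lambda>y. theta d (e - V y)) \<le> 2 / c * sqrt (ppart d (e - V x1))"
        using x1 by (intro tail) auto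
      also have "\<dots> \<le> 2 / c * ?s" using s1 x1 by (intro mult_left_mono) auto
      finally show ?thesis by (simp add: M_def algebra_simps)
    qed
  qed
qed

text \<open>Up to x1 the integrand is continuous. Beyond x1 its product with V' has an explicit
  primitive, and V' >= c > 0 permits dividing by V' again.\<close>

lemma inverse_sqrt_integrable:
  fixes V V' :: "real \<Rightarrow> real"
  assumes ab: "a < b"
    and V: "\<And>x. x \<in> {a..b} \<Longrightarrow> (V has_real_derivative V' x) (at x within {a..b})"
    and V': "continuous_on {a..b} V'"
    and pos: "\<And>x. x \<in> {a<..b} \<Longrightarrow> V' x > 0"
    and e: "V a < e"
  shows "(\<lambda>x. 1 / sqrt \<bar>e - V x\<bar>) integrable_on {a..b}"
proof -
  obtain x1 c where x1: "a < x1" "x1 \<le> b" "c > 0" "V x1 < e" "\<And>x. x \<in> {x1..b} \<Longrightarrow> V' x \<ge> c"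
    using increasing_potential[OF assms] by blast
  have Vc: "continuous_on {a..b} V" by (rule DERIV_continuous_on) (rule V)
  have mono: "V x < V y" if "a \<le> x" "x < y" "y \<le> b" for x y
    using strict_mono_of_deriv_pos[OF V pos] that by blast
  have 1: "(\<lambda>x. 1 / sqrt \<bar>e - V x\<bar>) integrable_on {a..x1}"
  proof (intro integrable_continuous_real continuous_intros)
    show "continuous_on {a..x1} V" by (rule continuous_on_subset[OF Vc]) (use x1 in auto)
    show "\<forall>x\<in>{a..x1}. sqrt \<bar>e - V x\<bar> \<noteq> 0"
    proof
      fix x assume "x \<in> {a..x1}"
      then have "V x \<le> V x1" using mono[of x x1] x1 by (cases "x = x1") auto
      then show "sqrt \<bar>e - V x\<bar> \<noteq> 0" using x1 by simp
    qed
  qed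
  define Z where "Z = {x \<in> {a..b}. V x = e}"
  have uniq: "x = y" if "x \<in> Z" "y \<in> Z" for x y
  proof (rule ccontr)
    assume "x \<noteq> y"
    then have "V x < V y \<or> V y < V x"
      using mono[of x y] mono[of y x] that by (auto simp: Z_def neq_iff)
    then show False using that by (auto simp: Z_def)
  qed
  have "finite Z"
  proof (cases "Z = {}")
    case False
    then obtain z where "z \<in> Z" by blast
    with uniq have "Z \<subseteq> {z}" by blast
    then show ?thesis by (rule finite_subset) simp
  qed simp
  \<comment> \<open>The function \<open>sqrt\<close> is odd in HOL, so -2 sqrt (e - V) is one
    continuous primitive on both sides of the turning point, which is the only exceptional
    point.\<close>
  have "((\<lambda>x. V' x * (1 / sqrt \<bar>e - V x\<bar>)) has_integral (- 2 * sqrt (e - V b)) - (- 2 * sqrt (e - V x1))) {x1..b}"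
  proof (rule fundamental_theorem_of_calculus_interior_strong[OF \<open>finite Z\<close> x1(2)])
    fix x assume x: "x \<in> {x1<..<b} - Z"
    then have ux: "e - V x \<noteq> 0" using x1 by (auto simp: Z_def)
    have "(V has_real_derivative V' x) (at x)"
      using V[of x] x x1 by (simp add: at_within_Icc_at)
    then have dV: "((\<lambda>x. e - V x) has_real_derivative 0 - V' x) (at x)"
      by (intro DERIV_diff DERIV_const)
    have "(sqrt has_real_derivative 1 / (2 * sqrt \<bar>e - V x\<bar>)) (at (e - V x))"
      using ux by (intro DERIV_real_sqrt_generic) (auto simp: field_simps real_sqrt_minus abs_if simp flip: real_sqrt_minus)
    from DERIV_cmult[OF DERIV_chain2[OF this dV], of "-2"]
    show "((\<lambda>x. - 2 * sqrt (e - V x)) has_vector_derivative V' x * (1 / sqrt \<bar>e - V x\<bar>)) (at x)"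
      by (simp add: has_real_derivative_iff_has_vector_derivative)
  next
    show "continuous_on {x1..b} (\<lambda>x. - 2 * sqrt (e - V x))"
      by (intro continuous_intros continuous_on_subset[OF Vc]) (use x1 in auto)
  qed
  \<comment> \<open>Nonnegativity upgrades integrability to absolute integrability, which survives
    multiplication by the continuous 1 / V'.\<close>
  then have "(\<lambda>x. V' x * (1 / sqrt \<bar>e - V x\<bar>)) absolutely_integrable_on {x1..b}"
    using x1 by (intro nonnegative_absolutely_integrable_1) (auto intro!: divide_nonneg_nonneg intro: order_trans less_imp_le)
  moreover have "continuous_on {x1..b} (\<lambda>x. 1 / V' x)"
    using x1 by (intro continuous_intros continuous_on_subset[OF V']) force+
  ultimately have "(\<lambda>x. V' x * (1 / sqrt \<bar>e - V x\<bar>) * (1 / V' x)) absolutely_integrable_on {x1..b}"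
    by (rule absolutely_integrable_mult_continuous)
  then have "(\<lambda>x. V' x * (1 / sqrt \<bar>e - V x\<bar>) * (1 / V' x)) integrable_on {x1..b}"
    by (simp add: absolutely_integrable_on_def)
  then have 2: "(\<lambda>x. 1 / sqrt \<bar>e - V x\<bar>) integrable_on {x1..b}"
    by (rule integrable_eq) (use x1 in force)
  show ?thesis
    using x1 by (intro Henstock_Kurzweil_Integration.integrable_combine[OF _ _ 1 2]) auto
qed

subsection \<open>Potential wells\<close>

locale potential_well =
  fixes L x0 :: real and V V' :: "real \<Rightarrow> real"
  assumes x0_pos: "0 < x0" and x0_less: "x0 < L"
    and V_C1: "\<And>x. x \<in> {0..L} \<Longrightarrow> (V has_real_derivative V' x) (at x within {0..L})"
    and V'_cont: "continuous_on {0..L} V'"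
    and crit: "\<And>x. x \<in> {0..L} \<Longrightarrow> V' x = 0 \<longleftrightarrow> x = x0"
    and x0_min: "\<And>x. x \<in> {0..L} \<Longrightarrow> V x0 \<le> V x"
begin

lemma V_cont: "continuous_on {0..L} V"
  by (rule DERIV_continuous_on) (rule V_C1)

lemma V_mvt:
  assumes "0 \<le> x" "x < y" "y \<le> L"
  obtains z where "x < z" "z < y" "V y - V x = V' z * (y - x)"
proof -
  have "\<exists>z\<in>{x<..<y}. V y - V x = (\<lambda>h. V' z * h) (y - x)"
  proof (rule mvt_simple)
    fix z assume z: "x \<le> z" "z \<le> y"
    have "(V has_real_derivative V' z) (at z within {x..y})"
      by (rule DERIV_subset[OF V_C1]) (use z assms in auto)
    then show "(V has_derivative (\<lambda>h. V' z * h)) (at z within {x..y})"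
      by (simp add: has_field_derivative_def)
  qed (use assms in auto)
  then show ?thesis using that by auto
qed

lemma V'_zero_between:
  assumes "0 \<le> x" "x \<le> y" "y \<le> L" and "V' x \<le> 0 \<and> 0 \<le> V' y \<or> V' y \<le> 0 \<and> 0 \<le> V' x"
  shows "x \<le> x0 \<and> x0 \<le> y"
proof -
  have c: "continuous_on {x..y} V'" by (rule continuous_on_subset[OF V'_cont]) (use assms in auto)
  have "\<exists>z. x \<le> z \<and> z \<le> y \<and> V' z = 0"
    using assms(4) IVT'[OF _ _ assms(2) c, of 0] IVT2'[OF _ _ assms(2) c, of 0] by blast
  then obtain z where "x \<le> z" "z \<le> y" "V' z = 0" by blast
  moreover from this have "z = x0" using crit[of z] assms by auto
  ultimately show ?thesis by simp
qed

text \<open>Minimality of V x0 and the mean value theorem give a point z between x0 and x with V' z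
  >= 0. If V' x were not positive, the intermediate value theorem would place a zero of V' to the
  right of x0.\<close>

lemma V'_pos: 
  assumes "x0 < x" "x \<le> L"
  shows "V' x > 0"
proof (rule ccontr)
  assume "\<not> V' x > 0"
  then have neg: "V' x \<le> 0" by simp
  obtain z where z: "x0 < z" "z < x" "V x - V x0 = V' z * (x - x0)"
    using V_mvt[of x0 x] assms x0_pos by auto
  have "V' z * (x - x0) \<ge> 0" using x0_min[of x] z assms x0_pos by auto
  then have "V' z \<ge> 0" using assms by (simp add: zero_le_mult_iff)
  with neg have "z \<le> x0" using V'_zero_between[of z x] z assms x0_pos by auto
  then show False using z by simp
qed

lemma V'_neg: 
  assumes "0 \<le> x" "x < x0"
  shows "V' x < 0"
proof (rule ccontr)
  assume "\<not> V' x < 0"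
  then have neg: "V' x \<ge> 0" by simp
  obtain z where z: "x < z" "z < x0" "V x0 - V x = V' z * (x0 - x)"
    using V_mvt[of x x0] assms x0_less by auto
  have "V' z * (x0 - x) \<le> 0" using x0_min[of x] z assms x0_less by auto
  then have "V' z \<le> 0" using assms by (simp add: mult_le_0_iff)
  with neg have "x0 \<le> z" using V'_zero_between[of x z] z assms x0_less by auto
  then show False using z by simp
qed

lemma V_increasing: "x0 \<le> x \<Longrightarrow> x < y \<Longrightarrow> y \<le> L \<Longrightarrow> V x < V y"
proof -
  assume *: "x0 \<le> x" "x < y" "y \<le> L"
  obtain z where z: "x < z" "z < y" "V y - V x = V' z * (y - x)"
    using V_mvt[of x y] * x0_pos by auto
  then have "V' z * (y - x) > 0" using V'_pos[of z] * by simp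
  then show "V x < V y" using z by linarith
qed

lemma V_decreasing: "0 \<le> x \<Longrightarrow> x < y \<Longrightarrow> y \<le> x0 \<Longrightarrow> V y < V x"
proof -
  assume *: "0 \<le> x" "x < y" "y \<le> x0"
  obtain z where z: "x < z" "z < y" "V y - V x = V' z * (y - x)"
    using V_mvt[of x y] * x0_less by auto
  then have "V' z * (y - x) < 0" using V'_neg[of z] * by (simp add: mult_less_0_iff)
  then show "V y < V x" using z by linarith
qed

lemma V_gt_min: "x \<in> {0..L} \<Longrightarrow> x \<noteq> x0 \<Longrightarrow> V x0 < V x"
  using V_increasing[of x0 x] V_decreasing[of x x0] by (cases x x0 rule: linorder_cases) auto

lemma virial_weight_nonneg: "x \<in> {0..L} \<Longrightarrow> (x - x0) * V' x \<ge> 0"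
proof (cases x x0 rule: linorder_cases)
  case less
  assume "x \<in> {0..L}"
  then have "V' x < 0" using less by (intro V'_neg) auto
  then show ?thesis using less by (simp add: zero_le_mult_iff)
next
  case greater
  assume "x \<in> {0..L}"
  then have "V' x > 0" using greater by (intro V'_pos) auto
  then show ?thesis using greater by simp
qed simp

lemma virial_weight_pos: "x \<in> {0..L} \<Longrightarrow> x \<noteq> x0 \<Longrightarrow> (x - x0) * V' x > 0"
  using virial_weight_nonneg[of x] crit[of x] by (simp add: less_le)

section \<open>The two monotone branches of the well\<close>

lemma right_C1: "x \<in> {x0..L} \<Longrightarrow> (V has_real_derivative V' x) (at x within {x0..L})"
  using x0_pos by (intro DERIV_subset[OF V_C1]) auto

lemma right_cont: "continuous_on {x0..L} V'"
  using x0_pos by (intro continuous_on_subset[OF V'_cont]) auto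

text \<open>Reflection turns the decreasing branch into an increasing potential on [-x0,0], so the
  estimates for increasing potentials apply to both sides.\<close>

lemma left_C1:
  assumes x: "x \<in> {-x0..0}"
  shows "((\<lambda>x. V (-x)) has_real_derivative - V' (-x)) (at x within {-x0..0})"
proof -
  have "(V has_real_derivative V' (-x)) (at (-x) within uminus ` {-x0..0})"
    using x x0_less by (intro DERIV_subset[OF V_C1]) auto
  from DERIV_image_chain[OF this DERIV_minus[OF DERIV_ident]]
  show ?thesis by (simp add: comp_def)
qed

lemma left_cont: "continuous_on {-x0..0} (\<lambda>x. - V' (-x))"
  using x0_less by (intro continuous_intros continuous_on_compose2[OF V'_cont]) auto

lemma inverse_sqrt_integrable_well:
  assumes e: "V x0 < e"
  shows "(\<lambda>x. 1 / sqrt \<bar>e - V x\<bar>) integrable_on {0..L}"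
proof -
  have 1: "(\<lambda>x. 1 / sqrt \<bar>e - V x\<bar>) integrable_on {x0..L}"
    by (rule inverse_sqrt_integrable[OF x0_less right_C1 right_cont _ e]) (auto intro: V'_pos)
  have "(\<lambda>x. 1 / sqrt \<bar>e - V (-x)\<bar>) integrable_on {-x0..0}"
    by (rule inverse_sqrt_integrable[OF _ left_C1 left_cont, of e])
      (use x0_pos e in \<open>auto intro: V'_neg\<close>)
  \<comment> \<open>The bound 0 is written as -0 to match the reflection rule.\<close>
  then have "(\<lambda>x. 1 / sqrt \<bar>e - V (-x)\<bar>) integrable_on {-x0..-0}" by simp
  then have 2: "(\<lambda>x. 1 / sqrt \<bar>e - V x\<bar>) integrable_on {0..x0}"
    by (simp only: Henstock_Kurzweil_Integration.integrable_reflect_real[where f="\<lambda>x. 1 / sqrt \<bar>e - V x\<bar>"])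
  show ?thesis
    using x0_pos x0_less by (intro Henstock_Kurzweil_Integration.integrable_combine[OF _ _ 2 1]) auto
qed

lemma theta_tail_bounds:
  assumes e: "V x0 < e"
  obtains M where "M > 0"
    "\<And>d x. d > 0 \<Longrightarrow> x \<in> {0..x0} \<Longrightarrow> integral {0..x} (\<lambda>y. theta d (e - V y)) \<le> M * sqrt (ppart d (e - V x))"
    "\<And>d x. d > 0 \<Longrightarrow> x \<in> {x0..L} \<Longrightarrow> integral {x..L} (\<lambda>y. theta d (e - V y)) \<le> M * sqrt (ppart d (e - V x))"
proof -
  obtain M1 where M1: "M1 > 0" "\<And>d x. d > 0 \<Longrightarrow> x \<in> {x0..L} \<Longrightarrow>
     integral {x..L} (\<lambda>y. theta d (e - V y)) \<le> M1 * sqrt (ppart d (e - V x))"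
    by (rule theta_tail_bound[OF x0_less right_C1 right_cont _ e]) (auto intro: V'_pos)
  obtain M2 where M2: "M2 > 0" "\<And>d x. d > 0 \<Longrightarrow> x \<in> {-x0..0} \<Longrightarrow>
     integral {x..0} (\<lambda>y. theta d (e - V (-y))) \<le> M2 * sqrt (ppart d (e - V (-x)))"
    by (rule theta_tail_bound[OF _ left_C1 left_cont, of e]) (use x0_pos e in \<open>auto intro: V'_neg\<close>)
  show thesis
  proof (rule that[of "max M1 M2"])
    fix d x :: real assume d: "d > 0"
    have mono: "M1 * sqrt (ppart d (e - V x)) \<le> max M1 M2 * sqrt (ppart d (e - V x))"
      "M2 * sqrt (ppart d (e - V x)) \<le> max M1 M2 * sqrt (ppart d (e - V x))"
      using ppart_pos[OF d, of "e - V x"] by (intro mult_right_mono; simp)+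
    show "integral {x..L} (\<lambda>y. theta d (e - V y)) \<le> max M1 M2 * sqrt (ppart d (e - V x))" if "x \<in> {x0..L}"
      using M1(2)[OF d that] mono(1) by linarith
    assume x: "x \<in> {0..x0}"
    have "integral {-x..-0} (\<lambda>y. theta d (e - V (-y))) \<le> M2 * sqrt (ppart d (e - V (-(-x))))"
      using M2(2)[OF d, of "-x"] x by simp
    then have "integral {0..x} (\<lambda>y. theta d (e - V y)) \<le> M2 * sqrt (ppart d (e - V x))"
      by (simp only: Henstock_Kurzweil_Integration.integral_reflect_real[where f="\<lambda>y. theta d (e - V y)"] minus_minus)
    then show "integral {0..x} (\<lambda>y. theta d (e - V y)) \<le> max M1 M2 * sqrt (ppart d (e - V x))"
      using mono(2) by linarith
  qed (use M1 in simp)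
qed

text \<open>Describes the turning point by the sublevel set, which removes the case distinction. The
  endpoint 0 is left out: there V 0 < e may hold although xminus = 0 is not below it.\<close>

lemma xminus_props:
  assumes e: "V x0 < e"
  shows "0 \<le> xminus V x0 e \<and> xminus V x0 e < x0 \<and> (\<forall>x. 0 < x \<longrightarrow> x \<le> x0 \<longrightarrow> (V x < e \<longleftrightarrow> xminus V x0 e < x))"
proof (cases "V 0 \<le> e")
  case True
  then show ?thesis using x0_pos V_decreasing[of 0] by (force simp: xminus_def)
next
  case False
  have "continuous_on {0..x0} V" using x0_less by (intro continuous_on_subset[OF V_cont]) auto
  then obtain z where z: "0 \<le> z" "z \<le> x0" "V z = e"
    using IVT2'[of V x0 e 0] e False x0_pos by auto
  have "xminus V x0 e = (THE x. x \<in> {0..x0} \<and> V x = e)" using False by (simp add: xminus_def)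
  also have "\<dots> = z"
  proof (rule the_equality)
    fix y assume y: "y \<in> {0..x0} \<and> V y = e"
    show "y = z"
      using V_decreasing[of y z] V_decreasing[of z y] y z by (cases y z rule: linorder_cases) auto
  qed (use z in auto)
  finally have xm: "xminus V x0 e = z" .
  have "V x < e \<longleftrightarrow> z < x" if "0 < x" "x \<le> x0" for x
    using V_decreasing[of x z] V_decreasing[of z x] that z by (cases x z rule: linorder_cases) auto
  moreover have "z < x0" using z e by (cases "z = x0") auto
  ultimately show ?thesis using z by (simp add: xm)
qed

lemma xplus_props:
  assumes e: "V x0 < e"
  shows "x0 < xplus V x0 L e \<and> xplus V x0 L e \<le> L \<and> (\<forall>x. x0 \<le> x \<longrightarrow> x < L \<longrightarrow> (V x < e \<longleftrightarrow> x < xplus V x0 L e))"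
proof (cases "V L \<le> e")
  case True
  then show ?thesis using x0_less V_increasing[of _ L] by (force simp: xplus_def)
next
  case False
  have "continuous_on {x0..L} V" using x0_pos by (intro continuous_on_subset[OF V_cont]) auto
  then obtain z where z: "x0 \<le> z" "z \<le> L" "V z = e"
    using IVT'[of V x0 e L] e False x0_less by auto
  have "xplus V x0 L e = (THE x. x \<in> {x0..L} \<and> V x = e)" using False by (simp add: xplus_def)
  also have "\<dots> = z"
  proof (rule the_equality)
    fix y assume y: "y \<in> {x0..L} \<and> V y = e"
    show "y = z"
      using V_increasing[of y z] V_increasing[of z y] y z by (cases y z rule: linorder_cases) auto
  qed (use z in auto)
  finally have xm: "xplus V x0 L e = z" .
  have "V x < e \<longleftrightarrow> x < z" if "x0 \<le> x" "x < L" for x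
    using V_increasing[of x z] V_increasing[of z x] that z by (cases x z rule: linorder_cases) auto
  moreover have "x0 < z" using z e by (cases "z = x0") auto
  ultimately show ?thesis using z by (simp add: xm)
qed

lemma classical_region_iff:
  assumes e: "V x0 < e" and x: "0 < x" "x < L"
  shows "x \<in> {xminus V x0 e<..<xplus V x0 L e} \<longleftrightarrow> V x < e"
  using xminus_props[OF e] xplus_props[OF e] x by (cases "x \<le> x0") force+

lemma integral_classical_region:
  fixes g :: "real \<Rightarrow> real"
  assumes e: "V x0 < e"
  shows "integral {xminus V x0 e<..<xplus V x0 L e} (\<lambda>x. g x / sqrt (e - V x))
       = integral {0..L} (\<lambda>x. g x * (if e - V x > 0 then 1 / sqrt (e - V x) else 0))"
proof -
  let ?S = "{xminus V x0 e<..<xplus V x0 L e}"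
  let ?f = "\<lambda>x. g x / sqrt (e - V x)"
  let ?h = "\<lambda>x. g x * (if e - V x > 0 then 1 / sqrt (e - V x) else 0)"
  have sub: "?S \<subseteq> {0..L}" using xminus_props[OF e] xplus_props[OF e] by auto
  have "integral ?S ?f = integral UNIV (\<lambda>x. if x \<in> ?S then ?f x else 0)"
    by (rule integral_restrict_UNIV[symmetric])
  also have "\<dots> = integral UNIV (\<lambda>x. if x \<in> {0..L} then ?h x else 0)"
  \<comment> \<open>The endpoints are discarded because V < e may hold there although they never
    belong to the open interval.\<close>
  proof (rule integral_spike[of "{0, L}"])
    fix x assume x: "x \<in> UNIV - {0, L}"
    show "(if x \<in> {0..L} then ?h x else 0) = (if x \<in> ?S then ?f x else 0)"
    proof (cases "x \<in> {0..L}")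
      case True
      then show ?thesis using classical_region_iff[OF e, of x] x by auto
    next
      case False
      then show ?thesis using sub by auto
    qed
  qed simp
  also have "\<dots> = integral {0..L} ?h" by (rule integral_restrict_UNIV)
  finally show ?thesis .
qed

lemma turning_points_finite: "finite {x \<in> {0..L}. V x = e}"
proof -
  have inj1: "inj_on V {0..x0}"
  proof (rule inj_onI)
    fix x y assume "x \<in> {0..x0}" "y \<in> {0..x0}" "V x = V y"
    then show "x = y"
      using V_decreasing[of x y] V_decreasing[of y x] by (cases x y rule: linorder_cases) auto
  qed
  have inj2: "inj_on V {x0..L}"
  proof (rule inj_onI)
    fix x y assume "x \<in> {x0..L}" "y \<in> {x0..L}" "V x = V y"
    then show "x = y"
      using V_increasing[of x y] V_increasing[of y x] by (cases x y rule: linorder_cases) auto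
  qed
  have "finite ((V -` {e} \<inter> {0..x0}) \<union> (V -` {e} \<inter> {x0..L}))"
    by (intro finite_UnI finite_vimage_IntI inj1 inj2) auto
  then show ?thesis by (rule rev_finite_subset) auto
qed

lemma theta_comp_cont: "d > 0 \<Longrightarrow> continuous_on {0..L} (\<lambda>x. theta d (e - V x))"
  by (rule continuous_on_compose2[OF theta_cont[where S=UNIV]]) (auto intro!: continuous_intros V_cont)

text \<open>Dominated convergence with the integrable majorant G / sqrt |e - V|; the limit of theta
  restricts the integral to the classical region.\<close>

lemma theta_integral_limit:
  assumes e: "V x0 < e" and g: "continuous_on {0..L} g" and d: "\<And>k. d k > 0" "d \<longlonglongrightarrow> 0"
  shows "(\<lambda>k. integral {0..L} (\<lambda>x. g x * theta (d k) (e - V x)))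
     \<longlonglongrightarrow> integral {xminus V x0 e<..<xplus V x0 L e} (\<lambda>x. g x / sqrt (e - V x))"
proof -
  define Z where "Z = {x \<in> {0..L}. V x = e}"
  have Z: "negligible Z" unfolding Z_def by (intro negligible_finite turning_points_finite)
  obtain G where G: "G > 0" "\<And>x. x \<in> {0..L} \<Longrightarrow> \<bar>g x\<bar> \<le> G"
    using bounded_on_interval[OF g] by blast
  \<comment> \<open>At a turning point the majorant is 1 / 0 = 0 while theta diverges, so the
    integrand is set to 0 on this null set.\<close>
  define f where "f k x = (if x \<in> Z then 0 else g x * theta (d k) (e - V x))" for k x
  define h where "h x = g x * (if e - V x > 0 then 1 / sqrt (e - V x) else 0)" for x
  have gi: "(\<lambda>x. g x * theta (d k) (e - V x)) integrable_on {0..L}" for k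
    by (intro integrable_continuous_real continuous_intros g theta_comp_cont d)
  have "(\<lambda>k. integral {0..L} (f k)) \<longlonglongrightarrow> integral {0..L} h"
  proof (rule dominated_convergence(2))
    show "f k integrable_on {0..L}" for k
      by (rule integrable_spike[OF gi Z]) (auto simp: f_def)
    show "(\<lambda>x. G * (1 / sqrt \<bar>e - V x\<bar>)) integrable_on {0..L}"
      by (intro integrable_on_mult_right inverse_sqrt_integrable_well e)
    show "norm (f k x) \<le> G * (1 / sqrt \<bar>e - V x\<bar>)" if x: "x \<in> {0..L}" for k x
    proof (cases "x \<in> Z")
      case True
      then show ?thesis using G by (simp add: f_def)
    next
      case False
      then have "e - V x \<noteq> 0" using x by (auto simp: Z_def)
      then show ?thesis
        using False G x theta_le[OF d(1)[of k], of "e - V x"] theta_nonneg[OF d(1)[of k], of "e - V x"]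
        unfolding f_def by (auto simp: abs_mult simp del: times_divide_eq_right intro!: mult_mono)
    qed
    show "(\<lambda>k. f k x) \<longlonglongrightarrow> h x" if x: "x \<in> {0..L}" for x
    proof (cases "x \<in> Z")
      case True
      then show ?thesis by (simp add: f_def h_def Z_def)
    next
      case False
      then have "e - V x \<noteq> 0" using x by (auto simp: Z_def)
      from tendsto_mult[OF tendsto_const theta_tendsto[OF this d(2)]] False
      show ?thesis by (simp only: f_def h_def if_False)
    qed
  qed
  moreover have "integral {0..L} (f k) = integral {0..L} (\<lambda>x. g x * theta (d k) (e - V x))" for k
    by (rule integral_spike[OF Z]) (auto simp: f_def)
  moreover have "integral {0..L} h = integral {xminus V x0 e<..<xplus V x0 L e} (\<lambda>x. g x / sqrt (e - V x))"
    unfolding h_def integral_classical_region[OF e] ..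
  ultimately show ?thesis by simp
qed

lemma classical_period_pos:
  assumes e: "V x0 < e"
  shows "integral {xminus V x0 e<..<xplus V x0 L e} (\<lambda>x. 1 / sqrt (e - V x)) > 0"
proof -
  define a b where "a = xminus V x0 e" and "b = xplus V x0 L e"
  have ab: "0 \<le> a" "a < x0" "x0 < b" "b \<le> L"
    using xminus_props[OF e] xplus_props[OF e] by (auto simp: a_def b_def)
  have pos: "V x < e" if "x \<in> {a<..<b}" for x
    using classical_region_iff[OF e, of x] that ab by (auto simp: a_def b_def)
  have "(\<lambda>x. 1 / sqrt \<bar>e - V x\<bar>) integrable_on {a..b}"
    by (rule integrable_on_subinterval[OF inverse_sqrt_integrable_well[OF e]]) (use ab in auto)
  then have "(\<lambda>x. 1 / sqrt \<bar>e - V x\<bar>) integrable_on {a<..<b}"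
    by (simp add: integrable_on_open_interval_real)
  then have i: "(\<lambda>x. 1 / sqrt (e - V x)) integrable_on {a<..<b}"
    by (rule integrable_eq) (use pos in force)
  have "integral {a<..<b} (\<lambda>x. 1 / sqrt (e - V x0)) \<le> integral {a<..<b} (\<lambda>x. 1 / sqrt (e - V x))"
  proof (rule integral_le[OF _ i])
    show "(\<lambda>x. 1 / sqrt (e - V x0)) integrable_on {a<..<b}"
      by (simp add: integrable_on_open_interval_real integrable_const_ivl)
    fix x assume x: "x \<in> {a<..<b}"
    have "V x0 \<le> V x" using x ab by (intro x0_min) auto
    then show "1 / sqrt (e - V x0) \<le> 1 / sqrt (e - V x)"
      using pos[OF x] by (intro divide_left_mono) auto
  qed
  moreover have "integral {a<..<b} (\<lambda>x. 1 / sqrt (e - V x0)) = (b - a) * (1 / sqrt (e - V x0))"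
    using ab by (simp flip: integral_open_interval_real)
  moreover have "(b - a) * (1 / sqrt (e - V x0)) > 0" using ab e by (intro mult_pos_pos) auto
  ultimately show ?thesis by (simp only: a_def[symmetric] b_def[symmetric])
qed

end

subsection \<open>Concentration for sequences satisfying the virial identity\<close>

text \<open>The limits at finite energy see the solutions only as probability densities with two
  nonnegative boundary terms, tied together by the virial identity for every C^1 multiplier.\<close>

locale virial_sequence = potential_well +
  fixes e :: real and A :: "nat \<Rightarrow> real \<Rightarrow> real" and bL b0 :: "nat \<Rightarrow> real"
  assumes e_ge: "V x0 \<le> e"
    and A_cont: "\<And>n. continuous_on {0..L} (A n)"
    and A_nonneg: "\<And>n x. A n x \<ge> 0"
    and A_norm: "\<And>n. integral {0..L} (A n) = 1"
    and bL_nonneg: "\<And>n. bL n \<ge> 0" and b0_nonneg: "\<And>n. b0 n \<ge> 0"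
    and virial: "\<And>h h'. (\<And>x. x \<in> {0..L} \<Longrightarrow> (h has_real_derivative h' x) (at x within {0..L})) \<Longrightarrow>
        continuous_on {0..L} h' \<Longrightarrow>
        (\<lambda>n. h L * bL n - h 0 * b0 n - integral {0..L} (\<lambda>x. (2 * h' x * (e - V x) - h x * V' x) * A n x)) \<longlonglongrightarrow> 0"
begin

lemma L_pos: "L > 0" using x0_pos x0_less by simp

section \<open>Means against the densities\<close>

lemma mean_le:
  assumes "continuous_on {0..L} f" "continuous_on {0..L} g" "\<And>x. x \<in> {0..L} \<Longrightarrow> f x \<le> g x"
  shows "integral {0..L} (\<lambda>x. f x * A n x) \<le> integral {0..L} (\<lambda>x. g x * A n x)"
  by (intro integral_le integrable_continuous_real continuous_intros mult_right_mono assms A_cont A_nonneg)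

lemma mean_const: "integral {0..L} (\<lambda>x. c * A n x) = c"
  using A_norm by simp

lemma mean_nonneg:
  assumes "continuous_on {0..L} f" "\<And>x. x \<in> {0..L} \<Longrightarrow> 0 \<le> f x"
  shows "0 \<le> integral {0..L} (\<lambda>x. f x * A n x)"
  using mean_le[of "\<lambda>x. 0" f n] assms by simp

lemma mean_add:
  assumes "continuous_on {0..L} f" "continuous_on {0..L} g"
  shows "integral {0..L} (\<lambda>x. (f x + g x) * A n x) = integral {0..L} (\<lambda>x. f x * A n x) + integral {0..L} (\<lambda>x. g x * A n x)"
  unfolding distrib_right
  by (intro integral_add integrable_continuous_real continuous_intros assms A_cont)

lemma mean_diff:
  assumes "continuous_on {0..L} f" "continuous_on {0..L} g"
  shows "integral {0..L} (\<lambda>x. (f x - g x) * A n x) = integral {0..L} (\<lambda>x. f x * A n x) - integral {0..L} (\<lambda>x. g x * A n x)"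
  unfolding left_diff_distrib
  by (intro integral_diff integrable_continuous_real continuous_intros assms A_cont)

lemma mean_cmult: "integral {0..L} (\<lambda>x. (c * f x) * A n x) = c * integral {0..L} (\<lambda>x. f x * A n x)"
  by (simp add: mult.assoc)

lemma mean_abs_le:
  assumes "continuous_on {0..L} f" "continuous_on {0..L} g" "\<And>x. x \<in> {0..L} \<Longrightarrow> \<bar>f x\<bar> \<le> g x"
  shows "\<bar>integral {0..L} (\<lambda>x. f x * A n x)\<bar> \<le> integral {0..L} (\<lambda>x. g x * A n x)"
  by (rule abs_integral_le_weighted)
    (auto intro!: continuous_intros assms A_cont mult_right_mono simp: abs_mult A_nonneg)

text \<open>With h = x - x0 the identity says that a sum of three nonnegative terms tends to 0: the
  two boundary terms and the mean of G. Hence each tends to 0, and G >= 2 (V - e) forces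
  concentration at the only minimum.\<close>

lemma ground_state_limit:
  assumes e: "e = V x0"
  shows "bL \<longlonglongrightarrow> 0" "b0 \<longlonglongrightarrow> 0"
    and "continuous_on {0..L} f \<Longrightarrow> (\<lambda>n. integral {0..L} (\<lambda>x. f x * A n x)) \<longlonglongrightarrow> f x0"
proof -
  define G where "G x = 2 * (V x - e) + (x - x0) * V' x" for x
  have G: "0 \<le> G x" "2 * (V x - e) \<le> G x" if "x \<in> {0..L}" for x
    using x0_min[OF that] virial_weight_nonneg[OF that] by (auto simp: G_def e)
  have Gc: "continuous_on {0..L} G"
    unfolding G_def[abs_def] by (intro continuous_intros V_cont V'_cont)
  have "(\<lambda>n. (L - x0) * bL n - (0 - x0) * b0 n - integral {0..L} (\<lambda>x. (2 * 1 * (e - V x) - (x - x0) * V' x) * A n x)) \<longlonglongrightarrow> 0"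
    by (rule virial) (auto intro!: derivative_eq_intros)
  moreover have "(2 * 1 * (e - V x) - (x - x0) * V' x) * A n x = - (G x * A n x)" for x n
    by (simp add: G_def algebra_simps)
  ultimately have lim: "(\<lambda>n. (L - x0) * bL n + x0 * b0 n + integral {0..L} (\<lambda>x. G x * A n x)) \<longlonglongrightarrow> 0"
    by simp
  have nn: "(L - x0) * bL n \<ge> 0" "x0 * b0 n \<ge> 0" "integral {0..L} (\<lambda>x. G x * A n x) \<ge> 0" for n
    using x0_pos x0_less bL_nonneg b0_nonneg G Gc by (auto intro!: mean_nonneg mult_nonneg_nonneg)
  have l1: "(\<lambda>n. (L - x0) * bL n) \<longlonglongrightarrow> 0"
    by (rule tendsto_sandwich[OF _ _ tendsto_const lim]) (use nn in \<open>auto intro!: always_eventually add_increasing2 simp: add.assoc\<close>)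
  have l2: "(\<lambda>n. x0 * b0 n) \<longlonglongrightarrow> 0"
    by (rule tendsto_sandwich[OF _ _ tendsto_const lim]) (use nn in \<open>auto intro!: always_eventually add_increasing add_increasing2\<close>)
  have l3: "(\<lambda>n. integral {0..L} (\<lambda>x. G x * A n x)) \<longlonglongrightarrow> 0"
    by (rule tendsto_sandwich[OF _ _ tendsto_const lim]) (use nn in \<open>auto intro!: always_eventually add_increasing\<close>)
  show "bL \<longlonglongrightarrow> 0" using tendsto_divide[OF l1 tendsto_const, of "L - x0"] x0_less by simp
  show "b0 \<longlonglongrightarrow> 0" using tendsto_divide[OF l2 tendsto_const, of x0] x0_pos by simp
  assume f: "continuous_on {0..L} f"
  have x0: "x0 \<in> {0..L}" using x0_pos x0_less by simp
  have "(\<lambda>n. integral {0..L} (\<lambda>x. f x * A n x) - f x0) \<longlonglongrightarrow> 0"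
  proof (rule tendsto_zero_by_bounds[where C = 2])
    fix \<kappa> :: real assume \<kappa>: "\<kappa> > 0"
    \<comment> \<open>On the compact set where f differs from f x0 by at least \<kappa>, V - e has a
      positive minimum m, and C = 2 F / m makes C (V - e) dominate the oscillation 2 F.\<close>
    obtain C where C: "C > 0" "\<And>x. x \<in> {0..L} \<Longrightarrow> \<bar>f x - f x0\<bar> \<le> \<kappa> + C * (V x - e)"
    proof -
      obtain F where F: "F > 0" "\<And>x. x \<in> {0..L} \<Longrightarrow> \<bar>f x\<bar> \<le> F"
        using bounded_on_interval[OF f] by blast
      define K where "K = {x \<in> {0..L}. \<kappa> \<le> \<bar>f x - f x0\<bar>}"
      have "closed K" unfolding K_def
        by (intro continuous_on_closed_Collect_le continuous_intros f closed_atLeastAtMost)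
      moreover have "bounded K" by (rule bounded_subset[of "{0..L}"]) (auto simp: K_def)
      ultimately have "compact K" by (simp add: compact_eq_bounded_closed)
      have "\<exists>m>0. \<forall>x\<in>K. m \<le> V x - e"
      proof (cases "K = {}")
        case False
        have "continuous_on K (\<lambda>x. V x - e)"
          by (intro continuous_intros continuous_on_subset[OF V_cont]) (auto simp: K_def)
        then obtain z where z: "z \<in> K" "\<And>x. x \<in> K \<Longrightarrow> V z - e \<le> V x - e"
          using continuous_attains_inf[OF \<open>compact K\<close> False, of "\<lambda>x. V x - e"] by blast
        have "z \<noteq> x0" "z \<in> {0..L}" using z(1) \<kappa> by (auto simp: K_def)
        then have "V z - e > 0" using V_gt_min[of z] by (simp add: e)
        with z(2) show ?thesis by blast
      qed (auto intro: exI[of _ 1])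
      then obtain m where m: "m > 0" "\<And>x. x \<in> K \<Longrightarrow> m \<le> V x - e" by blast
      show thesis
      proof (rule that[of "2 * F / m"])
        show "2 * F / m > 0" using F m by simp
        fix x assume x: "x \<in> {0..L}"
        show "\<bar>f x - f x0\<bar> \<le> \<kappa> + 2 * F / m * (V x - e)"
        proof (cases "x \<in> K")
          case True
          have "\<bar>f x - f x0\<bar> \<le> 2 * F" using F(2)[OF x] F(2)[OF x0] by linarith
          also have "\<dots> = 2 * F / m * m" using m by simp
          also have "\<dots> \<le> 2 * F / m * (V x - e)" using F m True by (intro mult_left_mono) auto
          finally show ?thesis using \<kappa> by simp
        next
          case False
          then have "\<bar>f x - f x0\<bar> \<le> \<kappa>" using x by (auto simp: K_def)
          moreover have "0 \<le> 2 * F / m * (V x - e)" using F m x0_min[OF x] by (simp add: e)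
          ultimately show ?thesis by linarith
        qed
      qed
    qed
    \<comment> \<open>The factor 2 reflects V - e <= G / 2.\<close>
    have "\<forall>\<^sub>F n in sequentially. integral {0..L} (\<lambda>x. G x * A n x) < 2 * \<kappa> / C"
      by (rule order_tendstoD(2)[OF l3]) (use \<kappa> C in simp)
    then show "\<forall>\<^sub>F n in sequentially. \<bar>integral {0..L} (\<lambda>x. f x * A n x) - f x0\<bar> \<le> 2 * \<kappa>"
    proof eventually_elim
      case (elim n)
      have "\<bar>integral {0..L} (\<lambda>x. (f x - f x0) * A n x)\<bar> \<le> integral {0..L} (\<lambda>x. (\<kappa> + C / 2 * G x) * A n x)"
      proof (rule mean_abs_le)
        fix x assume x: "x \<in> {0..L}"
        have "C * (V x - e) \<le> C / 2 * G x" using G(2)[OF x] C(1) by (simp add: mult_left_mono)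
        then show "\<bar>f x - f x0\<bar> \<le> \<kappa> + C / 2 * G x" using C(2)[OF x] by linarith
      qed (intro continuous_intros f Gc)+
      also have "\<dots> = \<kappa> + C / 2 * integral {0..L} (\<lambda>x. G x * A n x)"
        by (subst mean_add) (auto intro!: continuous_intros Gc simp: mean_cmult A_norm)
      also have "\<dots> \<le> 2 * \<kappa>" using elim C(1) by (simp add: field_simps)
      also have "integral {0..L} (\<lambda>x. (f x - f x0) * A n x) = integral {0..L} (\<lambda>x. f x * A n x) - f x0"
        by (subst mean_diff) (auto intro!: continuous_intros f simp: A_norm)
      finally show ?case .
    qed
  qed
  then show "(\<lambda>n. integral {0..L} (\<lambda>x. f x * A n x)) \<longlonglongrightarrow> f x0"
    using Lim_null by blast
qed

section \<open>Regularised multipliers and the mass of the forbidden region\<close>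

abbreviation "u x \<equiv> e - V x"
abbreviation "sq d x \<equiv> sqrt (ppart d (u x))"

lemma u_cont: "continuous_on {0..L} (\<lambda>x. u x)" by (intro continuous_intros V_cont)

context
  fixes d :: real
  assumes d: "d > 0"
begin

lemma sq_pos: "sq d x > 0" using ppart_pos[OF d] by simp

lemma sq_cont: "continuous_on {0..L} (\<lambda>x. sq d x)"
  by (rule continuous_on_compose2[OF DERIV_continuous_on[OF sqrt_ppart_DERIV[OF d]] u_cont]) (rule subset_UNIV)

lemma rho_u_cont: "continuous_on {0..L} (\<lambda>x. rho d (u x))"
  by (rule continuous_on_compose2[OF rho_cont[OF d] u_cont]) (rule subset_UNIV)

lemma gap_u_cont: "continuous_on {0..L} (\<lambda>x. gap d (u x))"
  by (rule continuous_on_compose2[OF gap_cont[OF d] u_cont]) (rule subset_UNIV)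

lemma theta_u_cont: "continuous_on {0..L} (\<lambda>x. theta d (u x))"
  by (rule continuous_on_compose2[OF theta_cont[OF d] u_cont]) (rule subset_UNIV)

text \<open>For k = 1 / sqrt (ppart d u) one has k + 2 u k' = gap d u / sqrt (ppart d u); the gap is
  negligible where u > 0 but bounded below where u \<le> 0.\<close>

lemma virial_regularised:
  assumes h: "\<And>x. x \<in> {0..L} \<Longrightarrow> (h has_real_derivative h' x) (at x within {0..L})"
    and h': "continuous_on {0..L} h'"
  shows "(\<lambda>n. h L / sq d L * bL n - h 0 / sq d 0 * b0 n
     - integral {0..L} (\<lambda>x. (2 * h' x * u x / sq d x - V' x * h x * gap d (u x) / sq d x) * A n x)) \<longlonglongrightarrow> 0"
proof -
  have hc: "continuous_on {0..L} h" by (rule DERIV_continuous_on) (rule h)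
  let ?h = "\<lambda>x. h x / sq d x"
  let ?h' = "\<lambda>x. h' x / sq d x + h x * V' x / (2 * rho d (u x) * sq d x)"
  have nz: "sq d x \<noteq> 0" "rho d (u x) \<noteq> 0" for x
    using sq_pos[of x] rho_pos[OF d, of "u x"] by auto
  have "(?h has_real_derivative ?h' x) (at x within {0..L})" if x: "x \<in> {0..L}" for x
  proof -
    have du: "((\<lambda>x. u x) has_real_derivative 0 - V' x) (at x within {0..L})"
      by (intro DERIV_diff DERIV_const V_C1 x)
    have "((\<lambda>x. h x * (1 / sq d x)) has_real_derivative
        h' x * (1 / sq d x) + (- 1 / (2 * rho d (u x) * sq d x) * (0 - V' x)) * h x) (at x within {0..L})"
      by (intro DERIV_mult h x DERIV_chain2[OF inverse_sqrt_ppart_DERIV[OF d] du])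
    moreover have "h' x * (1 / sq d x) + (- 1 / (2 * rho d (u x) * sq d x) * (0 - V' x)) * h x = ?h' x"
      by (simp add: mult.commute)
    ultimately show ?thesis by (simp add: mult.commute)
  qed
  moreover have "continuous_on {0..L} ?h'"
    using nz by (intro continuous_intros h' hc V'_cont sq_cont rho_u_cont) auto
  ultimately have "(\<lambda>n. ?h L * bL n - ?h 0 * b0 n
      - integral {0..L} (\<lambda>x. (2 * ?h' x * u x - ?h x * V' x) * A n x)) \<longlonglongrightarrow> 0"
    by (rule virial)
  moreover have "2 * ?h' x * u x - ?h x * V' x
      = 2 * h' x * u x / sq d x - V' x * h x * gap d (u x) / sq d x" for x
    using nz[of x] by (simp add: gap_def field_simps)
  ultimately show ?thesis by simp
qed

end

text \<open>For the multiplier (x - x0) / sqrt q, the weighted gap and both boundary terms carry the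
  same sign and are controlled by the mean of 2 u / sqrt q. That mean is at most 2 sqrt (e - V x0),
  as u <= sqrt (e - V x0) sqrt q, and 1 is added for the vanishing error. So S is free of d; only
  the threshold for n depends on d.\<close>

lemma tightness:
  "\<exists>S>0. \<forall>d>0. \<forall>\<^sub>F n in sequentially.
    integral {0..L} (\<lambda>x. ((x - x0) * V' x * gap d (u x) / sq d x) * A n x)
      + (L - x0) / sq d L * bL n + x0 / sq d 0 * b0 n \<le> S"
proof (intro exI[of _ "2 * sqrt (e - V x0) + 1"] conjI allI impI)
  show "2 * sqrt (e - V x0) + 1 > 0" using e_ge by (intro add_nonneg_pos) auto
  fix d :: real assume d: "d > 0"
  let ?w = "\<lambda>x. (x - x0) * V' x * gap d (u x) / sq d x"
  have nz: "sq d x \<noteq> 0" for x using sq_pos[OF d, of x] by simp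
  have wc: "continuous_on {0..L} ?w"
    using nz by (intro continuous_intros V'_cont gap_u_cont sq_cont d) auto
  have uc: "continuous_on {0..L} (\<lambda>x. 2 * u x / sq d x)"
    using nz by (intro continuous_intros u_cont sq_cont d V_cont) auto
  have "(\<lambda>n. (L - x0) / sq d L * bL n - (0 - x0) / sq d 0 * b0 n
     - integral {0..L} (\<lambda>x. (2 * 1 * u x / sq d x - V' x * (x - x0) * gap d (u x) / sq d x) * A n x)) \<longlonglongrightarrow> 0"
    by (rule virial_regularised[OF d]) (auto intro!: derivative_eq_intros)
  then have "\<forall>\<^sub>F n in sequentially. (L - x0) / sq d L * bL n - (0 - x0) / sq d 0 * b0 n
     - integral {0..L} (\<lambda>x. (2 * 1 * u x / sq d x - V' x * (x - x0) * gap d (u x) / sq d x) * A n x) < 1"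
    by (rule order_tendstoD) simp
  then show "\<forall>\<^sub>F n in sequentially. integral {0..L} (\<lambda>x. ?w x * A n x)
      + (L - x0) / sq d L * bL n + x0 / sq d 0 * b0 n \<le> 2 * sqrt (e - V x0) + 1"
  proof eventually_elim
    case (elim n)
    have "integral {0..L} (\<lambda>x. (2 * u x / sq d x) * A n x) \<le> integral {0..L} (\<lambda>x. (2 * sqrt (e - V x0)) * A n x)"
    proof (rule mean_le[OF uc continuous_on_const])
      fix x assume x: "x \<in> {0..L}"
      have "u x \<le> sqrt (e - V x0) * sq d x"
      proof (cases "u x \<le> 0")
        case True
        have "0 \<le> sqrt (e - V x0) * sq d x" using e_ge sq_pos[OF d, of x] by simp
        then show ?thesis using True by linarith
      next
        case False
        then have "u x = sqrt (u x) * sqrt (u x)" by simp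
        also have "\<dots> \<le> sqrt (e - V x0) * sq d x"
          using x0_min[OF x] ppart_ge[OF d, of "u x"] False by (intro mult_mono) auto
        finally show ?thesis .
      qed
      then show "2 * u x / sq d x \<le> 2 * sqrt (e - V x0)"
        using sq_pos[OF d, of x] by (simp add: divide_le_eq)
    qed
    moreover have "integral {0..L} (\<lambda>x. (2 * 1 * u x / sq d x - V' x * (x - x0) * gap d (u x) / sq d x) * A n x)
       = integral {0..L} (\<lambda>x. (2 * u x / sq d x) * A n x) - integral {0..L} (\<lambda>x. ?w x * A n x)"
      using mean_diff[OF uc wc, of n] by (simp add: mult.commute[of _ "V' _"])
    moreover have "integral {0..L} (\<lambda>x. (2 * sqrt (e - V x0)) * A n x) = 2 * sqrt (e - V x0)"
      by (rule mean_const)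
    moreover have "(0 - x0) / sq d 0 * b0 n = - (x0 / sq d 0 * b0 n)" by simp
    ultimately show ?case using elim by linarith
  qed
qed

lemma tightness_terms_nonneg:
  assumes d: "d > 0"
  shows "integral {0..L} (\<lambda>x. ((x - x0) * V' x * gap d (u x) / sq d x) * A n x) \<ge> 0"
    and "(L - x0) / sq d L * bL n \<ge> 0" and "x0 / sq d 0 * b0 n \<ge> 0"
proof -
  have nz: "sq d x \<noteq> 0" for x using sq_pos[OF d, of x] by simp
  show "integral {0..L} (\<lambda>x. ((x - x0) * V' x * gap d (u x) / sq d x) * A n x) \<ge> 0"
  proof (rule mean_nonneg)
    show "continuous_on {0..L} (\<lambda>x. (x - x0) * V' x * gap d (u x) / sq d x)"
      using nz by (intro continuous_intros V'_cont gap_u_cont sq_cont d) auto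
    show "0 \<le> (x - x0) * V' x * gap d (u x) / sq d x" if "x \<in> {0..L}" for x
      using virial_weight_nonneg[OF that] gap_nonneg[OF d] sq_pos[OF d, of x]
      by (intro divide_nonneg_pos mult_nonneg_nonneg[of "(x - x0) * V' x"]) auto
  qed
  show "(L - x0) / sq d L * bL n \<ge> 0" "x0 / sq d 0 * b0 n \<ge> 0"
    using x0_pos x0_less bL_nonneg b0_nonneg sq_pos[OF d] by (auto intro!: mult_nonneg_nonneg divide_nonneg_pos)
qed

text \<open>At an endpoint with u <= 0 one has q <= d, so the coefficient of the boundary term in
  \<open>tightness\<close> is at least of order d^(-1/2) while the total stays below S. Taking d =
  \<kappa>^2 gives a bound linear in \<kappa>.\<close>

lemma boundary_vanishes:
  shows "e \<le> V L \<Longrightarrow> bL \<longlonglongrightarrow> 0" and "e \<le> V 0 \<Longrightarrow> b0 \<longlonglongrightarrow> 0"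
proof -
  obtain S where S: "S > 0" "\<And>d. d > 0 \<Longrightarrow> \<forall>\<^sub>F n in sequentially.
    integral {0..L} (\<lambda>x. ((x - x0) * V' x * gap d (u x) / sq d x) * A n x)
      + (L - x0) / sq d L * bL n + x0 / sq d 0 * b0 n \<le> S"
    using tightness by blast
  have key: "b \<le> S / c * \<kappa>" if "\<kappa> > 0" "c > 0" "e \<le> V x" "c / sq (\<kappa>\<^sup>2) x * b \<le> S" for b c \<kappa> x
  proof -
    have d: "\<kappa>\<^sup>2 > 0" using that by simp
    have "ppart (\<kappa>\<^sup>2) (u x) \<le> 0 + \<kappa>\<^sup>2" using that d by (intro ppart_le) auto
    then have s: "sq (\<kappa>\<^sup>2) x \<le> \<kappa>" using that(1) by (intro real_le_lsqrt) auto
    have "b \<le> S / c * sq (\<kappa>\<^sup>2) x" using that(2,4) sq_pos[OF d, of x] by (simp add: field_simps)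
    also have "\<dots> \<le> S / c * \<kappa>" using s S(1) that(2) by (intro mult_left_mono) auto
    finally show ?thesis .
  qed
  show "bL \<longlonglongrightarrow> 0" if "e \<le> V L"
  proof (rule tendsto_zero_by_bounds[where C = "S / (L - x0)"])
    fix \<kappa> :: real assume \<kappa>: "\<kappa> > 0"
    then have d: "\<kappa>\<^sup>2 > 0" by simp
    show "\<forall>\<^sub>F n in sequentially. \<bar>bL n\<bar> \<le> S / (L - x0) * \<kappa>"
      using S(2)[OF d]
    proof eventually_elim
      case (elim n)
      then have "(L - x0) / sq (\<kappa>\<^sup>2) L * bL n \<le> S" using tightness_terms_nonneg(1,3)[OF d, of n] by linarith
      then show ?case using key[OF \<kappa> _ that] x0_less bL_nonneg[of n] by simp
    qed
  qed
  show "b0 \<longlonglongrightarrow> 0" if "e \<le> V 0"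
  proof (rule tendsto_zero_by_bounds[where C = "S / x0"])
    fix \<kappa> :: real assume \<kappa>: "\<kappa> > 0"
    then have d: "\<kappa>\<^sup>2 > 0" by simp
    show "\<forall>\<^sub>F n in sequentially. \<bar>b0 n\<bar> \<le> S / x0 * \<kappa>"
      using S(2)[OF d]
    proof eventually_elim
      case (elim n)
      then have "x0 / sq (\<kappa>\<^sup>2) 0 * b0 n \<le> S" using tightness_terms_nonneg(1,2)[OF d, of n] by linarith
      then show ?case using key[OF \<kappa> _ that] x0_pos b0_nonneg[of n] by simp
    qed
  qed
qed

text \<open>Where u > s the gap itself is at most (d / s)^2. Where u <= s, also sqrt q <= sqrt (2 s)
  as soon as d < s, so the gap is at most sqrt (2 s) / c times the weight controlled by
  \<open>tightness\<close>. First s is chosen small, then d.\<close>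

lemma gap_concentration:
  assumes e: "V x0 < e" and d: "\<And>k. d k > 0" "d \<longlonglongrightarrow> (0::real)" and \<kappa>: "\<kappa> > 0"
  shows "\<forall>\<^sub>F k in sequentially. \<forall>\<^sub>F n in sequentially. integral {0..L} (\<lambda>x. gap (d k) (u x) * A n x) \<le> \<kappa>"
proof -
  obtain S where S: "S > 0" "\<And>d. d > 0 \<Longrightarrow> \<forall>\<^sub>F n in sequentially.
    integral {0..L} (\<lambda>x. ((x - x0) * V' x * gap d (u x) / sq d x) * A n x)
      + (L - x0) / sq d L * bL n + x0 / sq d 0 * b0 n \<le> S"
    using tightness by blast
  \<comment> \<open>Half the depth of the well at energy e keeps the region u <= \<eta> away from
    x0, where the weight (x - x0) V' vanishes.\<close>
  define \<eta> where "\<eta> = (e - V x0) / 2"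
  have \<eta>: "\<eta> > 0" using e by (simp add: \<eta>_def)
  have "\<exists>c>0. \<forall>x\<in>{0..L}. u x \<le> \<eta> \<longrightarrow> c \<le> (x - x0) * V' x"
  proof -
    define K where "K = {x \<in> {0..L}. u x \<le> \<eta>}"
    have "closed K" unfolding K_def
      by (intro continuous_on_closed_Collect_le u_cont continuous_on_const closed_atLeastAtMost)
    moreover have "bounded K" by (rule bounded_subset[of "{0..L}"]) (auto simp: K_def)
    ultimately have "compact K" by (simp add: compact_eq_bounded_closed)
    show ?thesis
    proof (cases "K = {}")
      case False
      have "continuous_on K (\<lambda>x. (x - x0) * V' x)"
        by (intro continuous_intros continuous_on_subset[OF V'_cont]) (auto simp: K_def)
      then obtain z where z: "z \<in> K" "\<And>x. x \<in> K \<Longrightarrow> (z - x0) * V' z \<le> (x - x0) * V' x"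
        using continuous_attains_inf[OF \<open>compact K\<close> False, of "\<lambda>x. (x - x0) * V' x"] by blast
      have "z \<noteq> x0" using z(1) e by (auto simp: K_def \<eta>_def)
      then have "(z - x0) * V' z > 0" using z(1) by (intro virial_weight_pos) (auto simp: K_def)
      then show ?thesis using z(2) unfolding K_def by blast
    next
      case True
      then show ?thesis by (intro exI[of _ 1]) (auto simp: K_def)
    qed
  qed
  then obtain c where c: "c > 0" "\<And>x. x \<in> {0..L} \<Longrightarrow> u x \<le> \<eta> \<Longrightarrow> c \<le> (x - x0) * V' x"
    by blast
  \<comment> \<open>Chosen so that sqrt (2 s) S / c <= \<kappa> / 2, while s <= \<eta> keeps the
    lower bound c available.\<close>
  define s where "s = min \<eta> ((\<kappa> * c / (2 * S))\<^sup>2 / 2)"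
  have s: "s > 0" "s \<le> \<eta>" "2 * s \<le> (\<kappa> * c / (2 * S))\<^sup>2"
    using \<eta> \<kappa> c S(1) by (auto simp: s_def)
  have s2: "sqrt (2 * s) \<le> \<kappa> * c / (2 * S)"
    using s(3) \<kappa> c S(1) by (intro real_le_lsqrt) auto
  have "(\<lambda>k. (d k / s)\<^sup>2) \<longlonglongrightarrow> (0 / s)\<^sup>2" using s by (intro tendsto_intros d) auto
  then have "\<forall>\<^sub>F k in sequentially. (d k / s)\<^sup>2 < \<kappa> / 2"
    by (rule order_tendstoD) (use \<kappa> in simp)
  moreover have "\<forall>\<^sub>F k in sequentially. d k < s" by (rule order_tendstoD(2)[OF d(2) s(1)])
  ultimately show ?thesis
  proof eventually_elim
    case (elim k)
    let ?d = "d k"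
    let ?w = "\<lambda>x. (x - x0) * V' x * gap ?d (u x) / sq ?d x"
    note dk = d(1)[of k]
    have nz: "sq ?d x \<noteq> 0" for x using sq_pos[OF dk, of x] by simp
    have wc: "continuous_on {0..L} ?w"
      using nz by (intro continuous_intros V'_cont gap_u_cont sq_cont dk) auto
    have pw: "gap ?d (u x) \<le> sqrt (2 * s) / c * ?w x + (?d / s)\<^sup>2" if x: "x \<in> {0..L}" for x
    proof (cases "u x \<le> s")
      case True
      have "ppart ?d (u x) \<le> s + ?d" using True s by (intro ppart_le dk) auto
      then have "sq ?d x \<le> sqrt (2 * s)" using elim by simp
      moreover have "1 \<le> (x - x0) * V' x / c" using c(1) c(2)[OF x] True s by simp
      ultimately have "sq ?d x * 1 \<le> sqrt (2 * s) * ((x - x0) * V' x / c)"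
        using s by (intro mult_mono) auto
      then have "(sq ?d x * 1) * (gap ?d (u x) / sq ?d x) \<le> (sqrt (2 * s) * ((x - x0) * V' x / c)) * (gap ?d (u x) / sq ?d x)"
        using gap_nonneg[OF dk, of "u x"] sq_pos[OF dk, of x] by (intro mult_right_mono divide_nonneg_pos)
      moreover have "(sq ?d x * 1) * (gap ?d (u x) / sq ?d x) = gap ?d (u x)" using nz[of x] by simp
      moreover have "(sqrt (2 * s) * ((x - x0) * V' x / c)) * (gap ?d (u x) / sq ?d x) = sqrt (2 * s) / c * ?w x"
        by (simp add: mult_ac)
      moreover have "0 \<le> (?d / s)\<^sup>2" by simp
      ultimately show ?thesis by linarith
    next
      case False
      have "0 \<le> ?w x"
        using virial_weight_nonneg[OF x] gap_nonneg[OF dk] sq_pos[OF dk, of x]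
        by (intro divide_nonneg_pos mult_nonneg_nonneg[of "(x - x0) * V' x"])
      then have "0 \<le> sqrt (2 * s) / c * ?w x" using s c by (intro mult_nonneg_nonneg) auto
      moreover have "gap ?d (u x) \<le> (?d / s)\<^sup>2" using False s by (intro gap_small dk) auto
      ultimately show ?thesis by linarith
    qed
    show ?case using S(2)[OF dk]
    proof eventually_elim
      case (elim n)
      have I: "integral {0..L} (\<lambda>x. ?w x * A n x) \<le> S"
        using elim tightness_terms_nonneg(2,3)[OF dk, of n] by linarith
      have "integral {0..L} (\<lambda>x. gap ?d (u x) * A n x)
          \<le> integral {0..L} (\<lambda>x. (sqrt (2 * s) / c * ?w x + (?d / s)\<^sup>2) * A n x)"
        by (rule mean_le[OF _ _ pw]) (intro continuous_on_add continuous_on_mult continuous_on_const wc gap_u_cont dk)+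
      also have "\<dots> = integral {0..L} (\<lambda>x. (sqrt (2 * s) / c * ?w x) * A n x) + integral {0..L} (\<lambda>x. (?d / s)\<^sup>2 * A n x)"
        by (intro mean_add continuous_on_mult continuous_on_const wc)
      also have "integral {0..L} (\<lambda>x. (?d / s)\<^sup>2 * A n x) = (?d / s)\<^sup>2" by (rule mean_const)
      also have "integral {0..L} (\<lambda>x. (sqrt (2 * s) / c * ?w x) * A n x) = sqrt (2 * s) / c * integral {0..L} (\<lambda>x. ?w x * A n x)"
        by (rule mean_cmult)
      also have "\<dots> \<le> sqrt (2 * s) / c * S" using I s c by (intro mult_left_mono) auto
      also have "\<dots> \<le> (\<kappa> * c / (2 * S)) / c * S"
        using s2 c S(1) by (intro mult_right_mono divide_right_mono) auto
      also have "\<dots> = \<kappa> / 2" using c S(1) by simp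
      finally show ?case using \<open>(?d / s)\<^sup>2 < \<kappa> / 2\<close> by linarith
    qed
  qed
qed

text \<open>With h' = f theta / 2 the integrand of the regularised virial identity is f
  up to an error of order gap, which is where A n does not concentrate.\<close>

lemma regularised_limit:
  assumes e: "V x0 < e" and d: "\<And>k. d k > 0" "d \<longlonglongrightarrow> (0::real)" and \<kappa>: "\<kappa> > 0"
    and h: "\<And>k x. x \<in> {0..L} \<Longrightarrow> (h k has_real_derivative f k x * theta (d k) (u x) / 2) (at x within {0..L})"
    and f: "\<And>k. continuous_on {0..L} (f k)"
    and F: "\<And>k x. x \<in> {0..L} \<Longrightarrow> \<bar>f k x\<bar> \<le> F"
    and M: "\<And>k x. x \<in> {0..L} \<Longrightarrow> \<bar>h k x\<bar> \<le> M * sq (d k) x"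
  shows "\<forall>\<^sub>F k in sequentially. \<forall>\<^sub>F n in sequentially.
    \<bar>h k L / sq (d k) L * bL n - h k 0 / sq (d k) 0 * b0 n - integral {0..L} (\<lambda>x. f k x * A n x)\<bar> \<le> \<kappa>"
proof -
  obtain D where D: "D > 0" "\<And>x. x \<in> {0..L} \<Longrightarrow> \<bar>V' x\<bar> \<le> D"
    using bounded_on_interval[OF V'_cont] by blast
  \<comment> \<open>Bounds the coefficient f + V' h / sqrt q of the gap in the error: F for f, D M
    for the other term. The later C + 1 keeps the quotient meaningful when C = 0.\<close>
  define C where "C = F + D * M"
  have "0 \<le> M * sq (d 0) 0" using M[of 0 0] L_pos abs_ge_zero[of "h 0 0"] by simp
  then have "M \<ge> 0" using sq_pos[OF d(1)[of 0], of 0] by (simp add: zero_le_mult_iff)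
  moreover have "F \<ge> 0" using F[of 0 0] L_pos abs_ge_zero[of "f 0 0"] by simp
  ultimately have C: "C \<ge> 0" using D by (simp add: C_def)
  have "\<forall>\<^sub>F k in sequentially. \<forall>\<^sub>F n in sequentially. integral {0..L} (\<lambda>x. gap (d k) (u x) * A n x) \<le> \<kappa> / (2 * (C + 1))"
    using \<kappa> C by (intro gap_concentration e d) auto
  then show ?thesis
  proof eventually_elim
    case (elim k)
    let ?d = "d k"
    note dk = d(1)[of k]
    have nz: "sq ?d x \<noteq> 0" "rho ?d (u x) \<noteq> 0" for x
      using sq_pos[OF dk, of x] rho_pos[OF dk, of "u x"] by auto
    have hc: "continuous_on {0..L} (h k)" by (rule DERIV_continuous_on) (rule h)
    let ?h' = "\<lambda>x. f k x * theta ?d (u x) / 2"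
    let ?g = "\<lambda>x. 2 * ?h' x * u x / sq ?d x - V' x * h k x * gap ?d (u x) / sq ?d x"
    have h'c: "continuous_on {0..L} ?h'" by (intro continuous_intros f theta_u_cont dk) simp
    have gc: "continuous_on {0..L} ?g"
      using nz by (intro continuous_intros V'_cont h'c hc gap_u_cont sq_cont V_cont dk) auto
    have "(\<lambda>n. h k L / sq ?d L * bL n - h k 0 / sq ?d 0 * b0 n - integral {0..L} (\<lambda>x. ?g x * A n x)) \<longlonglongrightarrow> 0"
      by (rule virial_regularised[OF dk h h'c])
    then have "\<forall>\<^sub>F n in sequentially. \<bar>h k L / sq ?d L * bL n - h k 0 / sq ?d 0 * b0 n - integral {0..L} (\<lambda>x. ?g x * A n x)\<bar> < \<kappa> / 2"
      using \<kappa> by (intro order_tendstoD(2)[OF tendsto_rabs_zero]) auto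
    then show ?case using elim
    proof eventually_elim
      case (elim n)
      have "\<bar>integral {0..L} (\<lambda>x. (?g x - f k x) * A n x)\<bar> \<le> integral {0..L} (\<lambda>x. (C * gap ?d (u x)) * A n x)"
      proof (rule mean_abs_le)
        fix x assume x: "x \<in> {0..L}"
        have "2 * ?h' x * u x / sq ?d x = f k x * (u x / rho ?d (u x))"
          using nz[of x] by (simp add: theta_def)
        also have "u x / rho ?d (u x) = 1 - gap ?d (u x)" by (simp add: gap_def)
        finally have "?g x - f k x = - ((f k x + V' x * (h k x / sq ?d x)) * gap ?d (u x))"
          by (simp add: algebra_simps)
        then have "\<bar>?g x - f k x\<bar> = \<bar>f k x + V' x * (h k x / sq ?d x)\<bar> * gap ?d (u x)"
          by (simp only: abs_minus_cancel abs_mult abs_of_nonneg[OF gap_nonneg[OF dk]])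
        also have "\<dots> \<le> C * gap ?d (u x)"
        proof (rule mult_right_mono[OF _ gap_nonneg[OF dk]])
          have "\<bar>h k x / sq ?d x\<bar> \<le> M"
            using M[OF x, of k] sq_pos[OF dk, of x] by (simp add: abs_divide divide_le_eq)
          then have "\<bar>V' x * (h k x / sq ?d x)\<bar> \<le> D * M"
            unfolding abs_mult using D(2)[OF x] D(1) by (intro mult_mono) auto
          then show "\<bar>f k x + V' x * (h k x / sq ?d x)\<bar> \<le> C"
            using F[OF x, of k] unfolding C_def by linarith
        qed
        finally show "\<bar>?g x - f k x\<bar> \<le> C * gap ?d (u x)" .
      qed (intro continuous_on_diff continuous_on_mult continuous_on_const gc f gap_u_cont dk)+
      also have "\<dots> = C * integral {0..L} (\<lambda>x. gap ?d (u x) * A n x)" by (rule mean_cmult)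
      also have "\<dots> \<le> C * (\<kappa> / (2 * (C + 1)))" using elim(2) C by (intro mult_left_mono)
      also have "\<dots> \<le> \<kappa> / 2" using C \<kappa> by (simp add: field_simps)
      also have "integral {0..L} (\<lambda>x. (?g x - f k x) * A n x) = integral {0..L} (\<lambda>x. ?g x * A n x) - integral {0..L} (\<lambda>x. f k x * A n x)"
        by (rule mean_diff[OF gc f])
      finally show ?case using elim(1) by linarith
    qed
  qed
qed

text \<open>The additive constant decides at which end of the interval the multiplier
  vanishes.\<close>

lemma theta_primitive:
  assumes "d > 0" "continuous_on {0..L} f" "x \<in> {0..L}"
  shows "((\<lambda>x. 1 / 2 * integral {0..x} (\<lambda>y. f y * theta d (u y)) + c) has_real_derivative
     f x * theta d (u x) / 2) (at x within {0..L})"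
proof -
  have "((\<lambda>x. integral {0..x} (\<lambda>y. f y * theta d (u y))) has_real_derivative f x * theta d (u x)) (at x within {0..L})"
    using assms by (intro integral_has_real_derivative continuous_on_mult theta_u_cont)
  from DERIV_add[OF DERIV_cmult[OF this, of "1/2"] DERIV_const[of c]]
  show ?thesis by simp
qed

lemma theta_weighted_integral_bound:
  assumes d: "d > 0" and f: "continuous_on {0..L} f" "\<And>x. x \<in> {0..L} \<Longrightarrow> \<bar>f x\<bar> \<le> F"
    and "0 \<le> a" "b \<le> L"
  shows "\<bar>integral {a..b} (\<lambda>y. f y * theta d (u y))\<bar> \<le> F * integral {a..b} (\<lambda>y. theta d (u y))"
proof -
  have sub: "{a..b} \<subseteq> {0..L}" using assms by auto
  have "\<bar>integral {a..b} (\<lambda>y. f y * theta d (u y))\<bar> \<le> integral {a..b} (\<lambda>y. F * theta d (u y))"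
    using sub by (intro abs_integral_le_weighted continuous_on_mult continuous_on_const
        continuous_on_subset[OF theta_u_cont[OF d]] continuous_on_subset[OF f(1)])
      (auto simp: abs_mult theta_nonneg[OF d] intro!: mult_right_mono f(2))
  then show ?thesis by simp
qed

lemma theta_integral_split:
  assumes d: "d > 0" and f: "continuous_on {0..L} f" and x: "x \<in> {0..L}"
  shows "integral {0..x} (\<lambda>y. f y * theta d (u y)) + integral {x..L} (\<lambda>y. f y * theta d (u y))
    = integral {0..L} (\<lambda>y. f y * theta d (u y))"
  using x by (intro Henstock_Kurzweil_Integration.integral_combine integrable_continuous_real
      continuous_on_mult f theta_u_cont d) auto

section \<open>Limit measure and boundary terms above the bottom of the well\<close>

definition dk :: "nat \<Rightarrow> real" where "dk k = 1 / real (Suc k)"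

lemma dk: "dk k > 0" "dk k \<le> 1" "dk \<longlonglongrightarrow> 0"
  using lim_inverse_n' LIMSEQ_Suc[OF lim_1_over_n] by (auto simp: dk_def[abs_def])

text \<open>The period of the classical motion for p^2 + V at energy e, with reflection at any end
  of [0,L] that is reached: the speed is 2 sqrt (e - V) and the interval is crossed twice.\<close>

definition period :: real where
  "period = integral {xminus V x0 e<..<xplus V x0 L e} (\<lambda>x. 1 / sqrt (e - V x))"

lemma Cconst_period: "Cconst V x0 L e = 1 / period"
  by (simp add: Cconst_def period_def)

definition period_reg :: "nat \<Rightarrow> real" where
  "period_reg k = integral {0..L} (\<lambda>x. theta (dk k) (u x))"

lemma period_reg_nonneg: "period_reg k \<ge> 0"
  unfolding period_reg_def
  by (intro integral_nonneg integrable_continuous_real theta_u_cont theta_nonneg dk)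

lemma period_reg_limit:
  assumes e: "V x0 < e"
  shows "period_reg \<longlonglongrightarrow> period" "period > 0"
  using theta_integral_limit[OF e continuous_on_const[of _ 1] dk(1,3)] classical_period_pos[OF e]
  by (simp_all add: period_reg_def[abs_def] period_def)

text \<open>Split at x0, each half is a tail measured from its own end, and ppart at x0 is at most e
  - V x0 + 1 because dk k <= 1.\<close>

lemma period_reg_bounded:
  assumes e: "V x0 < e"
  shows "\<exists>K\<ge>0. \<forall>k. period_reg k \<le> K"
proof -
  obtain M where M: "M > 0"
    "\<And>d x. d > 0 \<Longrightarrow> x \<in> {0..x0} \<Longrightarrow> integral {0..x} (\<lambda>y. theta d (e - V y)) \<le> M * sq d x"
    "\<And>d x. d > 0 \<Longrightarrow> x \<in> {x0..L} \<Longrightarrow> integral {x..L} (\<lambda>y. theta d (e - V y)) \<le> M * sq d x"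
    by (rule theta_tail_bounds[OF e]) blast
  have "period_reg k \<le> 2 * M * sqrt (e - V x0 + 1)" for k
  proof -
    have "period_reg k = integral {0..x0} (\<lambda>y. theta (dk k) (u y)) + integral {x0..L} (\<lambda>y. theta (dk k) (u y))"
      using theta_integral_split[OF dk(1)[of k] continuous_on_const[of _ 1], of x0] x0_pos x0_less
      by (simp add: period_reg_def)
    also have "\<dots> \<le> M * sq (dk k) x0 + M * sq (dk k) x0"
      using x0_pos x0_less by (intro add_mono M dk) auto
    also have "\<dots> = 2 * M * sq (dk k) x0" by simp
    also have "\<dots> \<le> 2 * M * sqrt (e - V x0 + 1)"
    proof (intro mult_left_mono real_sqrt_le_mono)
      show "ppart (dk k) (u x0) \<le> e - V x0 + 1"
        using ppart_le[OF dk(1)[of k] order_refl, of "u x0"] e dk(2)[of k] by simp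
    qed (use M in simp)
    finally show ?thesis .
  qed
  moreover have "2 * M * sqrt (e - V x0 + 1) \<ge> 0" using M e by simp
  ultimately show ?thesis by blast
qed

text \<open>For every k the mean c k of g is taken against the regularised density and not against
  its limit. The multiplier then vanishes exactly at both ends, and the boundary terms drop out
  before any limit is taken.\<close>

lemma measure_limit:
  assumes e: "V x0 < e" and g: "continuous_on {0..L} g"
  shows "(\<lambda>n. integral {0..L} (\<lambda>x. g x * A n x)) \<longlonglongrightarrow>
    Cconst V x0 L e * integral {xminus V x0 e<..<xplus V x0 L e} (\<lambda>x. g x / sqrt (e - V x))"
proof -
  obtain G where G: "G > 0" "\<And>x. x \<in> {0..L} \<Longrightarrow> \<bar>g x\<bar> \<le> G"
    using bounded_on_interval[OF g] by blast
  obtain M where M: "M > 0"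
    "\<And>d x. d > 0 \<Longrightarrow> x \<in> {0..x0} \<Longrightarrow> integral {0..x} (\<lambda>y. theta d (e - V y)) \<le> M * sq d x"
    "\<And>d x. d > 0 \<Longrightarrow> x \<in> {x0..L} \<Longrightarrow> integral {x..L} (\<lambda>y. theta d (e - V y)) \<le> M * sq d x"
    by (rule theta_tail_bounds[OF e]) blast
  define J where "J k = integral {0..L} (\<lambda>x. g x * theta (dk k) (u x))" for k
  \<comment> \<open>If period_reg k were 0, the quotient would be 0 by convention; this is
    consistent, since J k would vanish as well.\<close>
  define c where "c k = J k / period_reg k" for k
  have J: "\<bar>J k\<bar> \<le> G * period_reg k" for k
    using theta_weighted_integral_bound[OF dk(1)[of k] g G(2), of 0 L] by (simp add: J_def period_reg_def)
  have cG: "\<bar>c k\<bar> \<le> G" for k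
    using J[of k] period_reg_nonneg[of k] G(1) by (cases "period_reg k = 0") (auto simp: c_def abs_divide divide_le_eq)
  have cI: "c k * period_reg k = J k" for k
    using J[of k] by (cases "period_reg k = 0") (auto simp: c_def)
  define f where "f k x = g x - c k" for k x
  have fc: "continuous_on {0..L} (f k)" for k unfolding f_def[abs_def] by (intro continuous_intros g)
  have fF: "\<bar>f k x\<bar> \<le> 2 * G" if "x \<in> {0..L}" for k x
    using G(2)[OF that] cG[of k] unfolding f_def by linarith
  have mean0: "integral {0..L} (\<lambda>x. f k x * theta (dk k) (u x)) = 0" for k
  proof -
    have "integral {0..L} (\<lambda>x. f k x * theta (dk k) (u x))
       = integral {0..L} (\<lambda>x. g x * theta (dk k) (u x)) - integral {0..L} (\<lambda>x. c k * theta (dk k) (u x))"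
      unfolding f_def left_diff_distrib
      by (intro integral_diff integrable_continuous_real continuous_on_mult continuous_on_const g theta_u_cont dk)
    then show ?thesis using cI[of k] by (simp add: J_def period_reg_def)
  qed
  define h where "h k x = 1 / 2 * integral {0..x} (\<lambda>y. f k y * theta (dk k) (u y)) + 0" for k x
  have h0: "h k 0 = 0" "h k L = 0" for k using mean0 by (auto simp: h_def)
  \<comment> \<open>Because f k has mean zero, h can be integrated from either end. The end on the
    same side of x0 is used, as the tail bound is valid only up to the bottom of the well.\<close>
  have hM: "\<bar>h k x\<bar> \<le> G * M * sq (dk k) x" if x: "x \<in> {0..L}" for k x
  proof (cases "x \<le> x0")
    case True
    have "\<bar>integral {0..x} (\<lambda>y. f k y * theta (dk k) (u y))\<bar> \<le> 2 * G * integral {0..x} (\<lambda>y. theta (dk k) (u y))"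
      by (rule theta_weighted_integral_bound[OF dk(1) fc fF]) (use x in auto)
    also have "\<dots> \<le> 2 * G * (M * sq (dk k) x)"
      using True x G by (intro mult_left_mono M dk) auto
    finally show ?thesis by (simp add: h_def)
  next
    case False
    have "\<bar>integral {x..L} (\<lambda>y. f k y * theta (dk k) (u y))\<bar> \<le> 2 * G * integral {x..L} (\<lambda>y. theta (dk k) (u y))"
      by (rule theta_weighted_integral_bound[OF dk(1) fc fF]) (use x in auto)
    also have "\<dots> \<le> 2 * G * (M * sq (dk k) x)"
      using False x G by (intro mult_left_mono M dk) auto
    finally show ?thesis
      using theta_integral_split[OF dk(1)[of k] fc[of k] x] mean0[of k] by (simp add: h_def)
  qed
  have clim: "c \<longlonglongrightarrow> Cconst V x0 L e * integral {xminus V x0 e<..<xplus V x0 L e} (\<lambda>x. g x / sqrt (e - V x))"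
    using tendsto_divide[OF theta_integral_limit[OF e g dk(1,3)] period_reg_limit(1)[OF e]] period_reg_limit(2)[OF e]
    by (simp add: c_def[abs_def] J_def Cconst_period)
  let ?l = "Cconst V x0 L e * integral {xminus V x0 e<..<xplus V x0 L e} (\<lambda>x. g x / sqrt (e - V x))"
  have "(\<lambda>n. integral {0..L} (\<lambda>x. g x * A n x) - ?l) \<longlonglongrightarrow> 0"
  proof (rule tendsto_zero_by_bounds[where C = 2])
    fix \<kappa> :: real assume \<kappa>: "\<kappa> > 0"
    have "\<forall>\<^sub>F k in sequentially. \<forall>\<^sub>F n in sequentially.
      \<bar>h k L / sq (dk k) L * bL n - h k 0 / sq (dk k) 0 * b0 n - integral {0..L} (\<lambda>x. f k x * A n x)\<bar> \<le> \<kappa>"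
    proof (rule regularised_limit[OF e dk(1,3) \<kappa> _ fc fF hM])
      show "(h k has_real_derivative f k x * theta (dk k) (u x) / 2) (at x within {0..L})" if "x \<in> {0..L}" for k x
        unfolding h_def[abs_def] by (rule theta_primitive[OF dk(1) fc that])
    qed
    moreover have "\<forall>\<^sub>F k in sequentially. dist (c k) ?l < \<kappa>" by (rule tendstoD[OF clim \<kappa>])
    ultimately have "\<forall>\<^sub>F k in sequentially. dist (c k) ?l < \<kappa> \<and> (\<forall>\<^sub>F n in sequentially.
      \<bar>h k L / sq (dk k) L * bL n - h k 0 / sq (dk k) 0 * b0 n - integral {0..L} (\<lambda>x. f k x * A n x)\<bar> \<le> \<kappa>)"
      by eventually_elim simp
    then obtain k where k: "dist (c k) ?l < \<kappa>" "\<forall>\<^sub>F n in sequentially.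
      \<bar>h k L / sq (dk k) L * bL n - h k 0 / sq (dk k) 0 * b0 n - integral {0..L} (\<lambda>x. f k x * A n x)\<bar> \<le> \<kappa>"
      using eventually_happens'[OF sequentially_bot] by blast
    from k(2) show "\<forall>\<^sub>F n in sequentially. \<bar>integral {0..L} (\<lambda>x. g x * A n x) - ?l\<bar> \<le> 2 * \<kappa>"
    proof eventually_elim
      case (elim n)
      have "integral {0..L} (\<lambda>x. f k x * A n x) = integral {0..L} (\<lambda>x. g x * A n x) - c k"
        unfolding f_def using mean_diff[OF g continuous_on_const[of _ "c k"], of n] by (simp add: A_norm)
      then have "\<bar>integral {0..L} (\<lambda>x. g x * A n x) - c k\<bar> \<le> \<kappa>" using elim h0 by simp
      then show ?case using k(1) unfolding dist_real_def by linarith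
    qed
  qed
  then show ?thesis using Lim_null by blast
qed

lemma boundary_limit_coefficient:
  assumes e: "V x0 < e" and x: "V x < e"
  shows "(\<lambda>k. period_reg k / 2 / sq (dk k) x) \<longlonglongrightarrow> period / 2 / sqrt (u x)" "period / 2 / sqrt (u x) > 0"
    "1 / (period / 2 / sqrt (u x)) = 2 * Cconst V x0 L e * sqrt (e - V x)"
proof -
  have ux: "u x > 0" using x by simp
  have "(\<lambda>k. sq (dk k) x) \<longlonglongrightarrow> sqrt (u x)"
    using ux by (intro tendsto_real_sqrt ppart_tendsto dk) simp
  then show "(\<lambda>k. period_reg k / 2 / sq (dk k) x) \<longlonglongrightarrow> period / 2 / sqrt (u x)"
    using ux by (intro tendsto_divide period_reg_limit e tendsto_const) auto
  show "period / 2 / sqrt (u x) > 0" using ux period_reg_limit(2)[OF e] by simp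
  show "1 / (period / 2 / sqrt (u x)) = 2 * Cconst V x0 L e * sqrt (e - V x)"
    by (simp add: Cconst_period)
qed

text \<open>With f = 1 and a multiplier vanishing at 0, only bL remains, with coefficient period_reg
  k / 2 / sq (dk k) L, against total mass 1.\<close>

lemma right_boundary_limit:
  assumes e: "V x0 < e" and VL: "V L < e"
  shows "bL \<longlonglongrightarrow> 2 * Cconst V x0 L e * sqrt (e - V L)"
proof -
  obtain M where M: "M > 0"
    "\<And>d x. d > 0 \<Longrightarrow> x \<in> {0..x0} \<Longrightarrow> integral {0..x} (\<lambda>y. theta d (e - V y)) \<le> M * sq d x"
    by (rule theta_tail_bounds[OF e]) blast
  obtain K where K: "K \<ge> 0" "\<And>k. period_reg k \<le> K" using period_reg_bounded[OF e] by blast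
  define m where "m = sqrt (u L)"
  have m: "m > 0" using VL by (simp add: m_def)
  define h where "h k x = 1 / 2 * integral {0..x} (\<lambda>y. 1 * theta (dk k) (u y)) + 0" for k x
  \<comment> \<open>There is no mean zero to exploit to the right of x0. There V x <= V L < e keeps
    sqrt q above m, and K bounds h, whence K / m; the tail bound M covers the left half.\<close>
  have hM: "\<bar>h k x\<bar> \<le> (M + K / m) * sq (dk k) x" if x: "x \<in> {0..L}" for k x
  proof -
    have s0: "sq (dk k) x > 0" by (rule sq_pos[OF dk(1)])
    have nn: "0 \<le> integral {a..b} (\<lambda>y. 1 * theta (dk k) (u y))" if "0 \<le> a" "b \<le> L" for a b
    proof -
      have "continuous_on {a..b} (\<lambda>y. theta (dk k) (u y))"
        by (rule continuous_on_subset[OF theta_u_cont[OF dk(1)]]) (use that in auto)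
      then show ?thesis
        by (intro integral_nonneg integrable_continuous_real) (auto simp: theta_nonneg[OF dk(1)])
    qed
    show ?thesis
    proof (cases "x \<le> x0")
      case True
      have "\<bar>h k x\<bar> \<le> integral {0..x} (\<lambda>y. theta (dk k) (u y))"
        using nn[of 0 x] x by (simp add: h_def)
      also have "\<dots> \<le> M * sq (dk k) x" using True x by (intro M dk) auto
      also have "\<dots> \<le> (M + K / m) * sq (dk k) x" using s0 K m by (intro mult_right_mono) auto
      finally show ?thesis .
    next
      case False
      have "\<bar>h k x\<bar> \<le> period_reg k"
        using theta_integral_split[OF dk(1)[of k] continuous_on_const[of _ 1] x] nn[of 0 x] nn[of x L] x
        by (simp add: h_def period_reg_def)
      also have "\<dots> \<le> K / m * m" using K(2)[of k] m by simp
      also have "\<dots> \<le> K / m * sq (dk k) x"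
      proof (intro mult_left_mono)
        have "V x \<le> V L" using V_increasing[of x L] False x by (cases "x = L") auto
        then show "m \<le> sq (dk k) x"
          unfolding m_def using ppart_ge[OF dk(1)[of k], of "u x"] by (intro real_sqrt_le_mono) linarith
      qed (use K m in simp)
      also have "\<dots> \<le> (M + K / m) * sq (dk k) x" using s0 M(1) by (intro mult_right_mono) auto
      finally show ?thesis .
    qed
  qed
  have hL: "h k L = period_reg k / 2" "h k 0 = 0" for k by (auto simp: h_def period_reg_def)
  show ?thesis
    unfolding boundary_limit_coefficient(3)[OF e VL, symmetric]
  proof (rule tendsto_inverse_by_approximation[OF boundary_limit_coefficient(1,2)[OF e VL]])
    fix \<kappa> :: real assume \<kappa>: "\<kappa> > 0"
    have "\<forall>\<^sub>F k in sequentially. \<forall>\<^sub>F n in sequentially.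
      \<bar>h k L / sq (dk k) L * bL n - h k 0 / sq (dk k) 0 * b0 n - integral {0..L} (\<lambda>x. 1 * A n x)\<bar> \<le> \<kappa>"
    proof (rule regularised_limit[OF e dk(1,3) \<kappa> _ continuous_on_const _ hM, where F = 1])
      show "(h k has_real_derivative 1 * theta (dk k) (u x) / 2) (at x within {0..L})" if "x \<in> {0..L}" for k x
        unfolding h_def[abs_def] by (rule theta_primitive[OF dk(1) continuous_on_const that])
    qed auto
    then show "\<forall>\<^sub>F k in sequentially. \<forall>\<^sub>F n in sequentially. \<bar>period_reg k / 2 / sq (dk k) L * bL n - 1\<bar> \<le> \<kappa>"
      by (simp add: hL A_norm)
  qed
qed

text \<open>The mirror image: the constant -period_reg k / 2 makes the multiplier vanish at L, so
  that only b0 remains, again with a positive coefficient.\<close>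

lemma left_boundary_limit:
  assumes e: "V x0 < e" and V0: "V 0 < e"
  shows "b0 \<longlonglongrightarrow> 2 * Cconst V x0 L e * sqrt (e - V 0)"
proof -
  obtain M where M: "M > 0"
    "\<And>d x. d > 0 \<Longrightarrow> x \<in> {x0..L} \<Longrightarrow> integral {x..L} (\<lambda>y. theta d (e - V y)) \<le> M * sq d x"
    by (rule theta_tail_bounds[OF e]) blast
  obtain K where K: "K \<ge> 0" "\<And>k. period_reg k \<le> K" using period_reg_bounded[OF e] by blast
  define m where "m = sqrt (u 0)"
  have m: "m > 0" using V0 by (simp add: m_def)
  define h where "h k x = 1 / 2 * integral {0..x} (\<lambda>y. 1 * theta (dk k) (u y)) + - (period_reg k / 2)" for k x
  have hM: "\<bar>h k x\<bar> \<le> (M + K / m) * sq (dk k) x" if x: "x \<in> {0..L}" for k x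
  proof -
    have s0: "sq (dk k) x > 0" by (rule sq_pos[OF dk(1)])
    have nn: "0 \<le> integral {a..b} (\<lambda>y. 1 * theta (dk k) (u y))" if "0 \<le> a" "b \<le> L" for a b
    proof -
      have "continuous_on {a..b} (\<lambda>y. theta (dk k) (u y))"
        by (rule continuous_on_subset[OF theta_u_cont[OF dk(1)]]) (use that in auto)
      then show ?thesis
        by (intro integral_nonneg integrable_continuous_real) (auto simp: theta_nonneg[OF dk(1)])
    qed
    have heq: "h k x = - (integral {x..L} (\<lambda>y. theta (dk k) (u y)) / 2)"
      using theta_integral_split[OF dk(1)[of k] continuous_on_const[of _ 1] x]
      by (simp add: h_def period_reg_def)
    show ?thesis
    proof (cases "x0 \<le> x")
      case True
      have "\<bar>h k x\<bar> \<le> integral {x..L} (\<lambda>y. theta (dk k) (u y))"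
        using nn[of x L] x by (simp add: heq)
      also have "\<dots> \<le> M * sq (dk k) x" using True x by (intro M dk) auto
      also have "\<dots> \<le> (M + K / m) * sq (dk k) x" using s0 K m by (intro mult_right_mono) auto
      finally show ?thesis .
    next
      case False
      have "\<bar>h k x\<bar> \<le> period_reg k"
        using theta_integral_split[OF dk(1)[of k] continuous_on_const[of _ 1] x] nn[of 0 x] nn[of x L] x
        by (simp add: heq period_reg_def)
      also have "\<dots> \<le> K / m * m" using K(2)[of k] m by simp
      also have "\<dots> \<le> K / m * sq (dk k) x"
      proof (intro mult_left_mono)
        have "V x \<le> V 0" using V_decreasing[of 0 x] False x by (cases "x = 0") auto
        then show "m \<le> sq (dk k) x"
          unfolding m_def using ppart_ge[OF dk(1)[of k], of "u x"] by (intro real_sqrt_le_mono) linarith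
      qed (use K m in simp)
      also have "\<dots> \<le> (M + K / m) * sq (dk k) x" using s0 M(1) by (intro mult_right_mono) auto
      finally show ?thesis .
    qed
  qed
  have hL: "h k L = 0" "h k 0 = - (period_reg k / 2)" for k by (auto simp: h_def period_reg_def)
  show ?thesis
    unfolding boundary_limit_coefficient(3)[OF e V0, symmetric]
  proof (rule tendsto_inverse_by_approximation[OF boundary_limit_coefficient(1,2)[OF e V0]])
    fix \<kappa> :: real assume \<kappa>: "\<kappa> > 0"
    have "\<forall>\<^sub>F k in sequentially. \<forall>\<^sub>F n in sequentially.
      \<bar>h k L / sq (dk k) L * bL n - h k 0 / sq (dk k) 0 * b0 n - integral {0..L} (\<lambda>x. 1 * A n x)\<bar> \<le> \<kappa>"
    proof (rule regularised_limit[OF e dk(1,3) \<kappa> _ continuous_on_const _ hM, where F = 1])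
      show "(h k has_real_derivative 1 * theta (dk k) (u x) / 2) (at x within {0..L})" if "x \<in> {0..L}" for k x
        unfolding h_def[abs_def] by (rule theta_primitive[OF dk(1) continuous_on_const that])
    qed auto
    then show "\<forall>\<^sub>F k in sequentially. \<forall>\<^sub>F n in sequentially. \<bar>period_reg k / 2 / sq (dk k) 0 * b0 n - 1\<bar> \<le> \<kappa>"
      by (simp add: hL A_norm)
  qed
qed

end

subsection \<open>Limits for finite and infinite energies\<close>

context quasimode_family
begin

text \<open>The kinetic energy is nonnegative, so the energy balance places E n above the mean of W
  n up to a vanishing error.\<close>

lemma energy_limit_ge:
  assumes E: "E \<longlonglongrightarrow> e" and v: "\<And>x. x \<in> {0..L} \<Longrightarrow> v \<le> V x"
  shows "v \<le> e"
proof (rule field_le_epsilon)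
  fix \<kappa> :: real assume \<kappa>: "\<kappa> > 0"
  have "\<forall>\<^sub>F n in sequentially. \<bar>integral {0..L} (B n) + integral {0..L} (\<lambda>x. (W n x - E n) * A n x)\<bar> < \<kappa> / 2"
    by (rule order_tendstoD(2)[OF tendsto_rabs_zero[OF energy_balance]]) (use \<kappa> in simp)
  moreover have "\<forall>\<^sub>F n in sequentially. \<forall>x\<in>{0..L}. \<bar>V x - W n x\<bar> \<le> \<kappa> / 2 \<and> \<bar>V' x - W' n x\<bar> \<le> \<kappa> / 2"
    by (rule W_close) (use \<kappa> in simp)
  ultimately have "\<forall>\<^sub>F n in sequentially. v - \<kappa> \<le> E n"
  proof eventually_elim
    case (elim n)
    have "integral {0..L} (\<lambda>x. (v - \<kappa> / 2 - E n) * A n x) \<le> integral {0..L} (\<lambda>x. (W n x - E n) * A n x)"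
    proof (intro integral_le integrable_continuous_real continuous_intros A_cont W_cont mult_right_mono A_nonneg)
      fix x assume x: "x \<in> {0..L}"
      show "v - \<kappa> / 2 - E n \<le> W n x - E n" using bspec[OF elim(2) x] v[OF x] by linarith
    qed
    moreover have "integral {0..L} (\<lambda>x. (v - \<kappa> / 2 - E n) * A n x) = v - \<kappa> / 2 - E n"
      by (simp add: A_norm)
    moreover have "integral {0..L} (B n) \<ge> 0" by (intro integral_nonneg B_int B_nonneg)
    ultimately show ?case using elim(1) by linarith
  qed
  then have "v - \<kappa> \<le> e" by (rule tendsto_lowerbound[OF E]) simp
  then show "v \<le> e + \<kappa>" by simp
qed

text \<open>N n converges to 1 + |e|, so the normalisation can be multiplied back; replacing E n by
  e costs (E n - e) times a bounded mean.\<close>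

lemma virial_limit_finite:
  assumes E: "E \<longlonglongrightarrow> e"
    and h: "\<And>x. x \<in> {0..L} \<Longrightarrow> (h has_real_derivative h' x) (at x within {0..L})"
    and h': "continuous_on {0..L} h'"
  shows "(\<lambda>n. h L * B n L - h 0 * B n 0 - integral {0..L} (\<lambda>x. (2 * h' x * (e - V x) - h x * V' x) * A n x)) \<longlonglongrightarrow> 0"
proof -
  have hc: "continuous_on {0..L} h" by (rule DERIV_continuous_on) (rule h)
  let ?X = "\<lambda>n. h L * B n L - h 0 * B n 0"
  let ?I = "\<lambda>n. integral {0..L} (\<lambda>x. (2 * h' x * (E n - V x) - h x * V' x) * A n x)"
  let ?J = "\<lambda>n. integral {0..L} (\<lambda>x. (2 * h' x) * A n x)"
  have "N \<longlonglongrightarrow> 1 + \<bar>e\<bar>" unfolding N_def[abs_def] by (intro tendsto_intros E)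
  from tendsto_mult[OF virial_limit[OF h h'] this]
  have 1: "(\<lambda>n. ?X n - ?I n) \<longlonglongrightarrow> 0" using N_pos by (simp add: less_imp_neq[THEN not_sym])
  have c: "continuous_on {0..L} (\<lambda>x. 2 * h' x)" by (intro continuous_intros h')
  obtain M where M: "M > 0" "\<And>x. x \<in> {0..L} \<Longrightarrow> \<bar>2 * h' x\<bar> \<le> M"
    using bounded_on_interval[OF c] by blast
  have J: "\<bar>?J n\<bar> \<le> M" for n
    by (rule abs_integral_A_le[OF c M(2)])
  have "(\<lambda>n. E n - e) \<longlonglongrightarrow> 0" using E by (simp add: LIM_zero_iff)
  then have 2: "(\<lambda>n. (E n - e) * ?J n) \<longlonglongrightarrow> 0"
    by (rule tendsto_zero_mult_bounded[OF _ J])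
  have eq: "?X n - integral {0..L} (\<lambda>x. (2 * h' x * (e - V x) - h x * V' x) * A n x) = (?X n - ?I n) + (E n - e) * ?J n" for n
  proof -
    have "?I n = integral {0..L} (\<lambda>x. (2 * h' x * (e - V x) - h x * V' x) * A n x + (E n - e) * ((2 * h' x) * A n x))"
      by (rule arg_cong[where f = "integral {0..L}"]) (simp add: fun_eq_iff algebra_simps)
    also have "\<dots> = integral {0..L} (\<lambda>x. (2 * h' x * (e - V x) - h x * V' x) * A n x)
        + integral {0..L} (\<lambda>x. (E n - e) * ((2 * h' x) * A n x))"
      by (intro integral_add integrable_continuous_real continuous_intros h' hc V_cont V'_cont A_cont)
    also have "integral {0..L} (\<lambda>x. (E n - e) * ((2 * h' x) * A n x)) = (E n - e) * ?J n"
      by (rule integral_mult_right)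
    finally show ?thesis by simp
  qed
  show ?thesis unfolding eq using tendsto_add[OF 1 2] by (simp only: add_0_left)
qed

text \<open>The contributions of V and V' have bounded means, so they vanish after division by E
  n.\<close>

lemma virial_limit_infinite:
  assumes E: "filterlim E at_top sequentially"
    and h: "\<And>x. x \<in> {0..L} \<Longrightarrow> (h has_real_derivative h' x) (at x within {0..L})"
    and h': "continuous_on {0..L} h'"
  shows "(\<lambda>n. (h L * B n L - h 0 * B n 0) / E n - 2 * integral {0..L} (\<lambda>x. h' x * A n x)) \<longlonglongrightarrow> 0"
proof -
  have hc: "continuous_on {0..L} h" by (rule DERIV_continuous_on) (rule h)
  let ?X = "\<lambda>n. h L * B n L - h 0 * B n 0"
  let ?I = "\<lambda>n. integral {0..L} (\<lambda>x. (2 * h' x * (E n - V x) - h x * V' x) * A n x)"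
  let ?J = "\<lambda>n. integral {0..L} (\<lambda>x. h' x * A n x)"
  let ?g = "\<lambda>x. 2 * h' x * V x + h x * V' x"
  let ?K = "\<lambda>n. integral {0..L} (\<lambda>x. ?g x * A n x)"
  have gc: "continuous_on {0..L} ?g" by (intro continuous_intros h' hc V_cont V'_cont)
  obtain M where M: "M > 0" "\<And>x. x \<in> {0..L} \<Longrightarrow> \<bar>?g x\<bar> \<le> M"
    using bounded_on_interval[OF gc] by blast
  have K: "\<bar>?K n\<bar> \<le> M" for n by (rule abs_integral_A_le[OF gc M(2)])
  have inv: "(\<lambda>n. inverse (E n)) \<longlonglongrightarrow> 0" by (rule tendsto_inverse_0_at_top[OF E])
  have pos: "\<forall>\<^sub>F n in sequentially. E n > 0"
    using E by (simp add: filterlim_at_top_dense)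
  \<comment> \<open>For E n > 0 this factor equals N n / E n and converts the normalisation by N n
    into one by E n.\<close>
  have "(\<lambda>n. inverse (E n) + 1) \<longlonglongrightarrow> 0 + 1" by (intro tendsto_intros inv)
  from tendsto_mult[OF virial_limit[OF h h'] this]
  have 1: "(\<lambda>n. (?X n - ?I n) / N n * (inverse (E n) + 1)) \<longlonglongrightarrow> 0" by simp
  have 2: "(\<lambda>n. inverse (E n) * ?K n) \<longlonglongrightarrow> 0"
    by (rule tendsto_zero_mult_bounded[OF inv K])
  have "\<forall>\<^sub>F n in sequentially. (?X n - ?I n) / N n * (inverse (E n) + 1) - inverse (E n) * ?K n
      = ?X n / E n - 2 * ?J n"
    using pos
  proof eventually_elim
    case (elim n)
    have "?I n = integral {0..L} (\<lambda>x. (2 * E n) * (h' x * A n x) - ?g x * A n x)"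
      by (rule arg_cong[where f = "integral {0..L}"]) (simp add: fun_eq_iff algebra_simps)
    also have "\<dots> = integral {0..L} (\<lambda>x. (2 * E n) * (h' x * A n x)) - ?K n"
      by (intro integral_diff integrable_continuous_real continuous_intros h' hc V_cont V'_cont A_cont)
    also have "integral {0..L} (\<lambda>x. (2 * E n) * (h' x * A n x)) = 2 * E n * ?J n"
      by (rule integral_mult_right)
    finally have I: "?I n = 2 * E n * ?J n - ?K n" .
    have "inverse (E n) + 1 = N n / E n" using elim by (simp add: N_def field_simps)
    then have N: "y / N n * (inverse (E n) + 1) = y / E n" for y
      using N_pos[of n] by simp
    have alg: "(x - (2 * E n * j - k)) / E n - inverse (E n) * k = x / E n - 2 * j" for x j k
      using elim by (simp add: field_simps)
    show ?case unfolding N I by (rule alg)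
  qed
  from Lim_transform_eventually[OF _ this, of 0] tendsto_diff[OF 1 2] show ?thesis by simp
qed

text \<open>Once V has disappeared, the equation for the multiplier is h' = f - c and has no
  singularity. The multipliers x and x - L isolate one end each, and the primitive of f minus its
  Lebesgue mean vanishes at both.\<close>

lemma infinite_energy_limits:
  assumes E: "filterlim E at_top sequentially"
  shows "(\<lambda>n. B n 0 / E n) \<longlonglongrightarrow> 2 / L" "(\<lambda>n. B n L / E n) \<longlonglongrightarrow> 2 / L"
    and "continuous_on {0..L} f \<Longrightarrow> (\<lambda>n. integral {0..L} (\<lambda>x. f x * A n x)) \<longlonglongrightarrow> integral {0..L} f / L"
proof -
  have "(\<lambda>n. (L * B n L - 0 * B n 0) / E n - 2 * integral {0..L} (\<lambda>x. 1 * A n x)) \<longlonglongrightarrow> 0"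
    by (rule virial_limit_infinite[OF E]) (auto intro!: derivative_eq_intros)
  then have "(\<lambda>n. L * (B n L / E n) - 2) \<longlonglongrightarrow> 0" by (simp add: A_norm)
  then have "(\<lambda>n. L * (B n L / E n)) \<longlonglongrightarrow> 2" by (simp only: LIM_zero_iff)
  from tendsto_divide[OF this tendsto_const, of L] show "(\<lambda>n. B n L / E n) \<longlonglongrightarrow> 2 / L"
    using L_pos by simp
  have "(\<lambda>n. ((L - L) * B n L - (0 - L) * B n 0) / E n - 2 * integral {0..L} (\<lambda>x. 1 * A n x)) \<longlonglongrightarrow> 0"
    by (rule virial_limit_infinite[OF E]) (auto intro!: derivative_eq_intros)
  then have "(\<lambda>n. L * (B n 0 / E n) - 2) \<longlonglongrightarrow> 0" by (simp add: A_norm)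
  then have "(\<lambda>n. L * (B n 0 / E n)) \<longlonglongrightarrow> 2" by (simp only: LIM_zero_iff)
  from tendsto_divide[OF this tendsto_const, of L] show "(\<lambda>n. B n 0 / E n) \<longlonglongrightarrow> 2 / L"
    using L_pos by simp
  assume f: "continuous_on {0..L} f"
  define c where "c = integral {0..L} f / L"
  define h where "h x = integral {0..x} (\<lambda>y. f y - c)" for x
  have fi: "f integrable_on {0..L}" using f by (rule integrable_continuous_real)
  have fc: "continuous_on {0..L} (\<lambda>y. f y - c)" by (intro continuous_intros f)
  have "integral {0..L} (\<lambda>y. f y - c) = integral {0..L} f - integral {0..L} (\<lambda>y. c)"
    by (intro integral_diff fi integrable_const_ivl)
  then have hL: "h L = 0" "h 0 = 0" using L_pos by (simp_all add: h_def c_def)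
  have "(\<lambda>n. (h L * B n L - h 0 * B n 0) / E n - 2 * integral {0..L} (\<lambda>x. (f x - c) * A n x)) \<longlonglongrightarrow> 0"
    unfolding h_def by (rule virial_limit_infinite[OF E integral_has_real_derivative[OF fc] fc])
  then have "(\<lambda>n. - 2 * integral {0..L} (\<lambda>x. (f x - c) * A n x)) \<longlonglongrightarrow> 0" by (simp add: hL)
  from tendsto_divide[OF this tendsto_const, of "-2"]
  have "(\<lambda>n. integral {0..L} (\<lambda>x. (f x - c) * A n x)) \<longlonglongrightarrow> 0" by simp
  moreover have "integral {0..L} (\<lambda>x. (f x - c) * A n x) = integral {0..L} (\<lambda>x. f x * A n x) - c" for n
  proof -
    have "integral {0..L} (\<lambda>x. (f x - c) * A n x) = integral {0..L} (\<lambda>x. f x * A n x) - integral {0..L} (\<lambda>x. c * A n x)"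
      unfolding left_diff_distrib
      by (intro integral_diff integrable_continuous_real continuous_intros f A_cont)
    then show ?thesis by (simp add: A_norm)
  qed
  ultimately show "(\<lambda>n. integral {0..L} (\<lambda>x. f x * A n x)) \<longlonglongrightarrow> integral {0..L} f / L"
    unfolding c_def[symmetric] by (simp only: LIM_zero_iff)
qed

end

theorem theorem1p4:
  fixes L x0 :: real
    and V V' :: "real \<Rightarrow> real"
    and Veps Vdeps :: "real \<Rightarrow> real \<Rightarrow> real"
    and eps E :: "nat \<Rightarrow> real"
    and Es :: ereal
    and psi dpsi ddpsi r :: "nat \<Rightarrow> real \<Rightarrow> complex"
  assumes L_pos: "L > 0"
    and V_C1: "\<forall>x\<in>{0..L}. (V has_real_derivative V' x) (at x within {0..L})"
    and V'_cont: "continuous_on {0..L} V'"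
    and Veps_C1: "\<forall>\<epsilon>\<in>{0<..1}. \<forall>x\<in>{0..L}.
                   (Veps \<epsilon> has_real_derivative Vdeps \<epsilon> x) (at x within {0..L})"
    and Vdeps_cont: "\<forall>\<epsilon>\<in>{0<..1}. continuous_on {0..L} (Vdeps \<epsilon>)"
    and Veps_conv: "\<forall>e>0. \<exists>\<delta>>0. \<forall>\<epsilon>\<in>{0<..1}. \<epsilon> < \<delta> \<longrightarrow>
                   (\<forall>x\<in>{0..L}. \<bar>V x - Veps \<epsilon> x\<bar> \<le> e \<and> \<bar>V' x - Vdeps \<epsilon> x\<bar> \<le> e)"
    and x0_in: "x0 \<in> {0<..<L}"
    and crit_unique: "\<forall>x\<in>{0..L}. V' x = 0 \<longleftrightarrow> x = x0"
    and x0_min: "\<forall>x\<in>{0..L}. V x0 \<le> V x"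
    and eps_range: "\<forall>n. eps n \<in> {0<..1}"
    and eps_lim: "eps \<longlonglongrightarrow> 0"
    and E_lim: "(\<lambda>n. ereal (E n)) \<longlonglongrightarrow> Es"
    and Es_not_minf: "Es \<noteq> - \<infinity>"
    and psi_deriv: "\<forall>n. \<forall>x\<in>{0..L}. (psi n has_vector_derivative dpsi n x) (at x within {0..L})"
    and dpsi_AC: "\<forall>n. \<forall>x\<in>{0..L}. dpsi n x = dpsi n 0 + integral {0..x} (ddpsi n)"
    and ddpsi_meas: "\<forall>n. ddpsi n \<in> borel_measurable (lebesgue_on {0..L})"
    and ddpsi_L2: "\<forall>n. (\<lambda>x. (cmod (ddpsi n x))\<^sup>2) integrable_on {0..L}"
    and psi_bc: "\<forall>n. psi n 0 = 0 \<and> psi n L = 0"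
    and psi_norm: "\<forall>n. integral {0..L} (\<lambda>x. (cmod (psi n x))\<^sup>2) = 1"
    and r_meas: "\<forall>n. r n \<in> borel_measurable (lebesgue_on {0..L})"
    and r_L2: "\<forall>n. (\<lambda>x. (cmod (r n x))\<^sup>2) integrable_on {0..L}"
    and equation: "\<forall>n. AE x in lborel. x \<in> {0..L} \<longrightarrow>
        - complex_of_real ((eps n)\<^sup>2) * ddpsi n x
        + complex_of_real (Veps (eps n) x - E n) * psi n x = r n x"
    and r_small: "(\<lambda>n. sqrt (integral {0..L} (\<lambda>x. (cmod (r n x))\<^sup>2)) / eps n) \<longlonglongrightarrow> 0"
  shows "ereal (V x0) \<le> Es
    \<and> (\<forall>f. continuous_on {0..L} f \<longrightarrow>
          (\<lambda>n. integral {0..L} (\<lambda>x. f x * (cmod (psi n x))\<^sup>2))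
            \<longlonglongrightarrow> limit_measure_integral V x0 L Es f)
    \<and> (\<forall>e. Es = ereal e \<longrightarrow>
          (\<lambda>n. (cmod (complex_of_real (eps n) * dpsi n 0))\<^sup>2)
            \<longlonglongrightarrow> (if V 0 < e then 2 * Cconst V x0 L e * sqrt (e - V 0) else 0)
        \<and> (\<lambda>n. (cmod (complex_of_real (eps n) * dpsi n L))\<^sup>2)
            \<longlonglongrightarrow> (if V L < e then 2 * Cconst V x0 L e * sqrt (e - V L) else 0))
    \<and> (Es = \<infinity> \<longrightarrow>
          (\<lambda>n. (cmod (complex_of_real (eps n) * dpsi n 0))\<^sup>2 / E n) \<longlonglongrightarrow> 2 / L
        \<and> (\<lambda>n. (cmod (complex_of_real (eps n) * dpsi n L))\<^sup>2 / E n) \<longlonglongrightarrow> 2 / L)"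
proof -
  interpret Q: quasimode_family L V V' Veps Vdeps eps E psi dpsi ddpsi r
    by (rule quasimode_family.intro)
      (rule L_pos V_C1[THEN bspec] V'_cont Veps_C1[THEN bspec, THEN bspec] Vdeps_cont[THEN bspec]
        Veps_conv[THEN spec, THEN mp] eps_range[THEN spec] eps_lim psi_deriv[THEN spec, THEN bspec]
        dpsi_AC[THEN spec, THEN bspec] psi_bc[THEN spec, THEN conjunct1] psi_bc[THEN spec, THEN conjunct2]
        psi_norm[THEN spec] r_meas[THEN spec] r_L2[THEN spec] equation[THEN spec] r_small | assumption)+
  interpret P: potential_well L x0 V V'
    using x0_in
    by (intro potential_well.intro V_C1[THEN bspec] V'_cont crit_unique[THEN bspec] x0_min[THEN bspec]) auto
  have B_eq: "(cmod (complex_of_real (eps n) * dpsi n x))\<^sup>2 = Q.B n x" for n x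
    by (simp add: Q.B_def norm_mult power_mult_distrib)
  have A_eq: "(cmod (psi n x))\<^sup>2 = Q.A n x" for n x by (simp add: Q.A_def)
  have "ereal (V x0) \<le> Es \<and>
      (\<forall>f. continuous_on {0..L} f \<longrightarrow>
          (\<lambda>n. integral {0..L} (\<lambda>x. f x * Q.A n x)) \<longlonglongrightarrow> limit_measure_integral V x0 L Es f) \<and>
      (\<forall>e. Es = ereal e \<longrightarrow>
          (\<lambda>n. Q.B n 0) \<longlonglongrightarrow> (if V 0 < e then 2 * Cconst V x0 L e * sqrt (e - V 0) else 0) \<and>
          (\<lambda>n. Q.B n L) \<longlonglongrightarrow> (if V L < e then 2 * Cconst V x0 L e * sqrt (e - V L) else 0)) \<and>
      (Es = \<infinity> \<longrightarrow> (\<lambda>n. Q.B n 0 / E n) \<longlonglongrightarrow> 2 / L \<and> (\<lambda>n. Q.B n L / E n) \<longlonglongrightarrow> 2 / L)"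
  proof (cases Es)
    case MInf
    then show ?thesis using Es_not_minf by simp
  next
    case PInf
    then have E: "filterlim E at_top sequentially"
      using E_lim by (simp add: tendsto_PInfty_eq_at_top)
    note lim = Q.infinite_energy_limits[OF E]
    show ?thesis
      using lim PInf by (simp add: limit_measure_integral_def)
  next
    case (real e)
    then have E: "E \<longlonglongrightarrow> e" using E_lim by simp
    have e: "V x0 \<le> e" by (rule Q.energy_limit_ge[OF E]) (use x0_min in blast)
    interpret S: virial_sequence L x0 V V' e Q.A "\<lambda>n. Q.B n L" "\<lambda>n. Q.B n 0"
      by unfold_locales
        (rule e Q.A_cont Q.A_nonneg Q.A_norm Q.B_nonneg Q.virial_limit_finite[OF E] | assumption)+
    have meas: "(\<lambda>n. integral {0..L} (\<lambda>x. f x * Q.A n x)) \<longlonglongrightarrow> limit_measure_integral V x0 L Es f"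
      if f: "continuous_on {0..L} f" for f
    proof (cases "e = V x0")
      case True
      then show ?thesis using S.ground_state_limit(3)[OF True f] real by (simp add: limit_measure_integral_def)
    next
      case False
      then have "V x0 < e" using e by simp
      from S.measure_limit[OF this f] show ?thesis
        using real False by (simp add: limit_measure_integral_def)
    qed
    \<comment> \<open>V 0 < e implies V x0 < e, where the boundary limit applies; otherwise the term
      vanishes, which includes e = V x0 since V x0 < V 0.\<close>
    have bd0: "(\<lambda>n. Q.B n 0) \<longlonglongrightarrow> (if V 0 < e then 2 * Cconst V x0 L e * sqrt (e - V 0) else 0)"
      using S.left_boundary_limit S.boundary_vanishes(2) P.V_gt_min[of 0] P.x0_pos P.x0_less by fastforce
    have bdL: "(\<lambda>n. Q.B n L) \<longlonglongrightarrow> (if V L < e then 2 * Cconst V x0 L e * sqrt (e - V L) else 0)"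
      using S.right_boundary_limit S.boundary_vanishes(1) P.V_gt_min[of L] P.x0_pos P.x0_less by fastforce
    show ?thesis
      using e meas bd0 bdL real by simp
  qed
  then show ?thesis unfolding A_eq B_eq .
qed

end
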